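(* Let $p>2$ be a prime, let $k$ be a field of characteristic $0$ containing a primitive $p$-th root of unity $\zeta_p$, and let $a,b\in k^\times$ be such that the symbol $\{a,b\}$ is nontrivial in $K^M_2(k)/p$. Then the standard norm variety $X(a,b)$ for $\{a,b\}$ is birationally isomorphic over $k$ to the Severi-Brauer variety $SB(A)$ associated to the cyclic algebra $A=(a,b,\zeta_p)_k$.
   Context: $(a,b,\zeta_p)_k$ is the cyclic (symbol) algebra of degree $p$ over $k$ generated by $x,y$ with relations $x^p=a$, $y^p=b$, $yx=\zeta_p xy$. Symmetric power construction (for a smooth quasi-projective $k$-variety $X$ and an element $c\in k^\times$). Let $\bigtriangleup\subset X^p$ be the union of all diagonals. The symmetric group $S_p$ acts freely on $X^p\setminus\bigtriangleup$; put $U=(X^p\setminus\bigtriangleup)/S_p$, a smooth open subset of the symmetric power $S^p(X)=X^p/S_p$. Let $\pi: X\times S^{p-1}(X)\to S^p(X)$ be the map $(x,y)\mapsto x+y$ (addition of effective zero-cycles); over $U$ it is finite étale of degree $p$, with $\pi^{-1}(U)=(X^p\setminus\bigtriangleup)/S_{p-1}$. Let $\mathcal{A}=\pi_*(\mathcal{O}_{\pi^{-1}(U)})$, a locally free $\mathcal{O}_U$-algebra of rank $p$, let $V=\mathrm{Spec}(S^\bullet(\mathcal{A}^\vee))$ be the corresponding rank $p$ vector bundle over $U$, and let $N:\mathcal{A}\to\mathcal{O}_U$ be the norm map, which is locally a homogeneous polynomial function of degree $p$ on $V$. Let $W\subset V$ be the hypersurface $N-c=0$. Standard norm variety $X(a,b)$.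 Start with $X=X(a)=\mathrm{Spec}(L)$, where $L=k(\sqrt[p]{a})$, and apply the construction with $c=b$. In this case $U\cong\mathrm{Spec}(k)$ and $\pi^{-1}(U)\cong\mathrm{Spec}(L)$, so $W$ is the affine hypersurface $N_{L/k}-b=0$ in the $p$-dimensional affine space associated with the $k$-vector space $L$. The standard norm variety $X(a,b)$ is a smooth projective geometrically irreducible $k$-variety containing $W$ as an open subvariety (determined up to birational isomorphism). *)

theory Defs
  imports
    "HOL-Algebra.Free_Abelian_Groups"
    "HOL-Algebra.Generated_Fields"
    "HOL-Algebra.QuotRing"
    "HOL-Algebra.Algebraic_Closure_Type"
    "HOL-Analysis.Function_Topology"
    "HOL-Library.Poly_Mapping"
    "HOL-Library.Function_Algebras"
    "HOL-Library.Extended_Nat"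
    "Jordan_Normal_Form.Determinant"
begin

section \<open>Milnor K-theory in degree two\<close>

definition milnor_K2_relations :: "('k::field \<times> 'k \<Rightarrow>\<^sub>0 int) set" where
  "milnor_K2_relations =
     {frag_of (a * a', b) - frag_of (a, b) - frag_of (a', b) | a a' b. a \<noteq> 0 \<and> a' \<noteq> 0 \<and> b \<noteq> 0}
   \<union> {frag_of (a, b * b') - frag_of (a, b) - frag_of (a, b') | a b b'. a \<noteq> 0 \<and> b \<noteq> 0 \<and> b' \<noteq> 0}
   \<union> {frag_of (a, 1 - a) | a. a \<noteq> 0 \<and> a \<noteq> 1}"

definition free_on_pairs :: "('k::field \<times> 'k \<Rightarrow>\<^sub>0 int) monoid" where
  "free_on_pairs = free_Abelian_group ((UNIV - {0}) \<times> (UNIV - {0}))"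

text \<open>The two bilinearity relations present the tensor square of the multiplicative group, the
  third one is the Steinberg relation.  All groups are written multiplicatively, following
  the conventions of the group library.\<close>

definition milnor_K2 :: "('k::field \<times> 'k \<Rightarrow>\<^sub>0 int) set monoid" where
  "milnor_K2 = free_on_pairs Mod generate free_on_pairs milnor_K2_relations"

definition milnor_K2_symbol :: "'k::field \<Rightarrow> 'k \<Rightarrow> ('k \<times> 'k \<Rightarrow>\<^sub>0 int) set" where
  "milnor_K2_symbol a b =
     generate free_on_pairs milnor_K2_relations #>\<^bsub>free_on_pairs\<^esub> frag_of (a, b)"

definition milnor_K2_powers :: "nat \<Rightarrow> ('k::field \<times> 'k \<Rightarrow>\<^sub>0 int) set set" where
  "milnor_K2_powers p = (\<lambda>u. u [^]\<^bsub>milnor_K2\<^esub> p) ` carrier milnor_K2"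

definition milnor_K2_mod :: "nat \<Rightarrow> ('k::field \<times> 'k \<Rightarrow>\<^sub>0 int) set set monoid" where
  "milnor_K2_mod p = milnor_K2 Mod milnor_K2_powers p"

definition milnor_K2_mod_symbol :: "nat \<Rightarrow> 'k::field \<Rightarrow> 'k \<Rightarrow> ('k \<times> 'k \<Rightarrow>\<^sub>0 int) set set" where
  "milnor_K2_mod_symbol p a b = milnor_K2_powers p #>\<^bsub>milnor_K2\<^esub> milnor_K2_symbol a b"

section \<open>Projective varieties over a subfield\<close>

text \<open>Varieties over \<open>k\<close> are handled classically: a reduced quasi-projective \<open>k\<close>-scheme, \<open>k\<close> of
  characteristic 0, is the locally closed subset of projective space formed by its points over an
  algebraically closed extension \<open>K\<close>, and everything that is "over \<open>k\<close>" is required to be given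
  by polynomials with coefficients in the subfield \<open>F\<close> of \<open>K\<close> that is the image of \<open>k\<close>.  Taking
  \<open>F = UNIV\<close> gives the corresponding geometric notion.\<close>

type_synonym ('i, 'c) mpol = "('i \<Rightarrow>\<^sub>0 nat) \<Rightarrow>\<^sub>0 'c"

definition mpol_eval :: "('i, 'c::comm_ring_1) mpol \<Rightarrow> ('i \<Rightarrow> 'c) \<Rightarrow> 'c" where
  "mpol_eval P v = (\<Sum>m\<in>Poly_Mapping.keys P.
      Poly_Mapping.lookup P m * (\<Prod>i\<in>Poly_Mapping.keys m. v i ^ Poly_Mapping.lookup m i))"

definition mpol_deriv :: "'i \<Rightarrow> ('i, 'c::comm_ring_1) mpol \<Rightarrow> ('i, 'c) mpol" where
  "mpol_deriv i P = (\<Sum>m\<in>Poly_Mapping.keys P.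
      Poly_Mapping.single (m - Poly_Mapping.single i 1)
        (of_nat (Poly_Mapping.lookup m i) * Poly_Mapping.lookup P m))"

definition homogeneous_over :: "'c::comm_ring_1 set \<Rightarrow> 'i set \<Rightarrow> nat \<Rightarrow> ('i, 'c) mpol \<Rightarrow> bool" where
  "homogeneous_over F I d P \<longleftrightarrow> (\<forall>m\<in>Poly_Mapping.keys P.
      Poly_Mapping.lookup P m \<in> F \<and> Poly_Mapping.keys m \<subseteq> I \<and>
      (\<Sum>i\<in>Poly_Mapping.keys m. Poly_Mapping.lookup m i) = d)"

text \<open>\<open>K\<^sup>I\<close> consists of the functions vanishing outside \<open>I\<close>; a point of the projective space on \<open>I\<close>
  is the one-dimensional subspace spanned by a nonzero such function.\<close>

definition coord_space :: "'i set \<Rightarrow> ('i \<Rightarrow> 'c::field) set" where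
  "coord_space I = {v. \<forall>i. i \<notin> I \<longrightarrow> v i = 0}"

definition line_of :: "('i \<Rightarrow> 'c::field) \<Rightarrow> ('i \<Rightarrow> 'c) set" where
  "line_of v = range (\<lambda>c i. c * v i)"

definition proj_space :: "'i set \<Rightarrow> ('i \<Rightarrow> 'c::field) set set" where
  "proj_space I = line_of ` (coord_space I - {\<lambda>_. 0})"

definition nonvanishing_locus :: "'i set \<Rightarrow> ('i, 'c::field) mpol \<Rightarrow> ('i \<Rightarrow> 'c) set set" where
  "nonvanishing_locus I P = {l \<in> proj_space I. \<exists>v\<in>l. mpol_eval P v \<noteq> 0}"

definition zariski :: "'c::field set \<Rightarrow> 'i set \<Rightarrow> ('i \<Rightarrow> 'c) set topology" where
  "zariski F I = topology_generated_by {nonvanishing_locus I P | P d. homogeneous_over F I d P}"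

definition irreducible_in :: "'a topology \<Rightarrow> 'a set \<Rightarrow> bool" where
  "irreducible_in T V \<longleftrightarrow> V \<subseteq> topspace T \<and> V \<noteq> {} \<and>
     (\<forall>A B. closedin T A \<and> closedin T B \<and> V \<subseteq> A \<union> B \<longrightarrow> V \<subseteq> A \<or> V \<subseteq> B)"

definition krull_dim :: "'a topology \<Rightarrow> enat" where
  "krull_dim T = Sup {enat n | n. \<exists>Z :: nat \<Rightarrow> 'a set.
     (\<forall>i\<le>n. closedin T (Z i) \<and> irreducible_in T (Z i)) \<and> (\<forall>i<n. Z i \<subset> Z (Suc i))}"

global_interpretation fun_vs: vector_space "\<lambda>(c::'c::field) (v::'i \<Rightarrow> 'c) i. c * v i"
  defines fun_dim = fun_vs.dim and fun_span = fun_vs.span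
  by unfold_locales (auto simp: fun_eq_iff algebra_simps)

text \<open>The projective tangent space of a projective variety at \<open>l\<close>, as a linear subspace of \<open>K\<^sup>I\<close>
  (so its dimension exceeds the one of the Zariski tangent space by one).  It is computed from the
  whole homogeneous ideal of \<open>V\<close> over \<open>F\<close>, not from arbitrarily chosen equations.\<close>

definition tangent_cone_space ::
    "'c::field set \<Rightarrow> 'i set \<Rightarrow> ('i \<Rightarrow> 'c) set set \<Rightarrow> ('i \<Rightarrow> 'c) set \<Rightarrow> ('i \<Rightarrow> 'c) set" where
  "tangent_cone_space F I V l = {w \<in> coord_space I. \<forall>P d.
      homogeneous_over F I d P \<and> (\<forall>m\<in>V. \<forall>v\<in>m. mpol_eval P v = 0) \<longrightarrow>
      (\<forall>v\<in>l - {\<lambda>_. 0}. (\<Sum>i\<in>I. mpol_eval (mpol_deriv i P) v * w i) = 0)}"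

text \<open>Jacobian criterion, for irreducible \<open>V\<close> (which has the same dimension at all its points).\<close>

definition smooth_projective :: "'c::field set \<Rightarrow> 'i set \<Rightarrow> ('i \<Rightarrow> 'c) set set \<Rightarrow> bool" where
  "smooth_projective F I V \<longleftrightarrow> closedin (zariski F I) V \<and>
     (\<forall>l\<in>V. enat (fun_dim (tangent_cone_space F I V l)) = krull_dim (subtopology (zariski F I) V) + 1)"

definition regular_map :: "'c::field set \<Rightarrow> 'i set \<Rightarrow> ('i \<Rightarrow> 'c) set set \<Rightarrow>
    'j set \<Rightarrow> ('j \<Rightarrow> 'c) set set \<Rightarrow> (('i \<Rightarrow> 'c) set \<Rightarrow> ('j \<Rightarrow> 'c) set) \<Rightarrow> bool" where
  "regular_map F I V J W \<phi> \<longleftrightarrow> \<phi> ` V \<subseteq> W \<and>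
     (\<forall>l\<in>V. \<exists>U f d. openin (subtopology (zariski F I) V) U \<and> l \<in> U \<and>
        (\<forall>j\<in>J. homogeneous_over F I d (f j)) \<and>
        (\<forall>m\<in>U. \<forall>v\<in>m - {\<lambda>_. 0}.
           (\<exists>j\<in>J. mpol_eval (f j) v \<noteq> 0) \<and>
           \<phi> m = line_of (\<lambda>j. if j \<in> J then mpol_eval (f j) v else 0)))"

definition isomorphic_over :: "'c::field set \<Rightarrow> 'i set \<Rightarrow> ('i \<Rightarrow> 'c) set set \<Rightarrow>
    'j set \<Rightarrow> ('j \<Rightarrow> 'c) set set \<Rightarrow> bool" where
  "isomorphic_over F I V J W \<longleftrightarrow> (\<exists>\<phi> \<psi>. regular_map F I V J W \<phi> \<and> regular_map F J W I V \<psi> \<and>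
     (\<forall>l\<in>V. \<psi> (\<phi> l) = l) \<and> (\<forall>m\<in>W. \<phi> (\<psi> m) = m))"

definition birational_over :: "'c::field set \<Rightarrow> 'i set \<Rightarrow> ('i \<Rightarrow> 'c) set set \<Rightarrow>
    'j set \<Rightarrow> ('j \<Rightarrow> 'c) set set \<Rightarrow> bool" where
  "birational_over F I V J W \<longleftrightarrow> (\<exists>U B.
     openin (subtopology (zariski F I) V) U \<and> V \<subseteq> Abstract_Topology.closure_of (zariski F I) U \<and>
     openin (subtopology (zariski F J) W) B \<and> W \<subseteq> Abstract_Topology.closure_of (zariski F J) B \<and>
     isomorphic_over F I U J B)"

section \<open>Finite-dimensional algebras and scalar extension to the algebraic closure\<close>

text \<open>A \<open>k\<close>-algebra is a ring \<open>R\<close> together with its structure map \<open>h\<close> from \<open>k\<close>.\<close>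

definition algebra_basis ::
    "('a, 'm) ring_scheme \<Rightarrow> ('k::field \<Rightarrow> 'a) \<Rightarrow> nat \<Rightarrow> (nat \<Rightarrow> 'a) \<Rightarrow> bool" where
  "algebra_basis R h n e \<longleftrightarrow> e ` {..<n} \<subseteq> carrier R \<and>
     (\<forall>u\<in>carrier R. \<exists>!c. c \<in> coord_space {..<n} \<and>
        u = (\<Oplus>\<^bsub>R\<^esub>i\<in>{..<n}. h (c i) \<otimes>\<^bsub>R\<^esub> e i))"

definition algebra_coords ::
    "('a, 'm) ring_scheme \<Rightarrow> ('k::field \<Rightarrow> 'a) \<Rightarrow> nat \<Rightarrow> (nat \<Rightarrow> 'a) \<Rightarrow> 'a \<Rightarrow> nat \<Rightarrow> 'k" where
  "algebra_coords R h n e u = (THE c. c \<in> coord_space {..<n} \<and>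
        u = (\<Oplus>\<^bsub>R\<^esub>i\<in>{..<n}. h (c i) \<otimes>\<^bsub>R\<^esub> e i))"

text \<open>Multiplication of the scalar extension of \<open>R\<close> to the algebraic closure, in coordinates with
  respect to \<open>e\<close>.\<close>

definition ext_mult ::
    "('a, 'm) ring_scheme \<Rightarrow> ('k::field \<Rightarrow> 'a) \<Rightarrow> nat \<Rightarrow> (nat \<Rightarrow> 'a) \<Rightarrow>
     (nat \<Rightarrow> 'k alg_closure) \<Rightarrow> (nat \<Rightarrow> 'k alg_closure) \<Rightarrow> nat \<Rightarrow> 'k alg_closure" where
  "ext_mult R h n e u v = (\<lambda>l. \<Sum>i<n. \<Sum>j<n.
      u i * v j * to_ac (algebra_coords R h n e (e i \<otimes>\<^bsub>R\<^esub> e j) l))"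

definition ext_norm ::
    "('a, 'm) ring_scheme \<Rightarrow> ('k::field \<Rightarrow> 'a) \<Rightarrow> nat \<Rightarrow> (nat \<Rightarrow> 'a) \<Rightarrow>
     (nat \<Rightarrow> 'k alg_closure) \<Rightarrow> 'k alg_closure" where
  "ext_norm R h n e z =
     det (mat n n (\<lambda>(l, j). ext_mult R h n e z (\<lambda>i. if i = j then 1 else 0) l))"

section \<open>Standard norm varieties for symbols of length two\<close>

definition simple_extension :: "'k::field alg_closure \<Rightarrow> 'k alg_closure ring" where
  "simple_extension \<alpha> = (ring_of_type_algebra :: 'k alg_closure ring)
     \<lparr>carrier := generate_field ring_of_type_algebra (insert \<alpha> (range to_ac))\<rparr>"

text \<open>The affine hypersurface \<open>N = b\<close> in the affine space of an algebra, where affine space with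
  coordinates indexed by \<open>{..<n}\<close> is the standard chart of the projective space whose additional
  homogeneous coordinate is \<open>None\<close>.\<close>

abbreviation affine_index :: "nat \<Rightarrow> nat option set" where
  "affine_index n \<equiv> insert None (Some ` {..<n})"

definition norm_hypersurface ::
    "('a, 'm) ring_scheme \<Rightarrow> ('k::field \<Rightarrow> 'a) \<Rightarrow> nat \<Rightarrow> (nat \<Rightarrow> 'a) \<Rightarrow> 'k \<Rightarrow>
     (nat option \<Rightarrow> 'k alg_closure) set set" where
  "norm_hypersurface R h n e b =
     {line_of (case_option 1 z) | z. z \<in> coord_space {..<n} \<and> ext_norm R h n e z = to_ac b}"

text \<open>The symmetric power construction applied to \<open>Spec L\<close>, \<open>L = k(a\<^bsup>1/p\<^esup>)\<close>, has the base \<open>U = Spec k\<close>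
  and yields the hypersurface \<open>N = b\<close> in the affine space of \<open>L\<close>; "containing" it as an open
  subvariety is up to isomorphism over \<open>k\<close>.  A \<open>k\<close>-basis of \<open>L\<close> of length \<open>p\<close> exists when \<open>a\<close> is not a
  \<open>p\<close>-th power and \<open>k\<close> contains the \<open>p\<close>-th roots of unity, as holds if \<open>{a, b}\<close> is nontrivial mod \<open>p\<close>.\<close>

definition standard_norm_variety ::
    "nat \<Rightarrow> 'k::field \<Rightarrow> 'k \<Rightarrow> nat \<Rightarrow> (nat \<Rightarrow> 'k alg_closure) set set \<Rightarrow> bool" where
  "standard_norm_variety p a b n V \<longleftrightarrow>
     smooth_projective (range to_ac) {..n} V \<and>
     irreducible_in (zariski UNIV {..n}) V \<and>
     (\<exists>\<alpha> e B. \<alpha> ^ p = to_ac a \<and> algebra_basis (simple_extension \<alpha>) to_ac p e \<and>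
        openin (subtopology (zariski (range to_ac) {..n}) V) B \<and>
        isomorphic_over (range to_ac)
          (affine_index p) (norm_hypersurface (simple_extension \<alpha>) to_ac p e b) {..n} B)"

section \<open>Cyclic algebras\<close>

definition primitive_root_of_unity :: "nat \<Rightarrow> 'k::field \<Rightarrow> bool" where
  "primitive_root_of_unity n \<zeta> \<longleftrightarrow> 0 < n \<and> \<zeta> ^ n = 1 \<and> (\<forall>j. 0 < j \<and> j < n \<longrightarrow> \<zeta> ^ j \<noteq> 1)"

datatype generator = GenX | GenY

datatype word = Word (letters: "generator list")

text \<open>Words form a monoid under concatenation, written additively so that finitely supported
  functions on words carry the convolution product: \<open>word \<Rightarrow>\<^sub>0 'k\<close> is the free algebra on \<open>GenX\<close>
  and \<open>GenY\<close>.\<close>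

instantiation word :: monoid_add
begin

definition zero_word :: word where "0 = Word []"

definition plus_word :: "word \<Rightarrow> word \<Rightarrow> word" where "u + v = Word (letters u @ letters v)"

instance by standard (auto simp: zero_word_def plus_word_def)

end

definition free_const :: "'k::field \<Rightarrow> (word \<Rightarrow>\<^sub>0 'k)" where
  "free_const c = Poly_Mapping.single 0 c"

definition free_gen :: "generator \<Rightarrow> (word \<Rightarrow>\<^sub>0 'k::field)" where
  "free_gen g = Poly_Mapping.single (Word [g]) 1"

definition cyclic_ideal :: "nat \<Rightarrow> 'k::field \<Rightarrow> 'k \<Rightarrow> 'k \<Rightarrow> (word \<Rightarrow>\<^sub>0 'k) set" where
  "cyclic_ideal p a b \<zeta> = Idl\<^bsub>ring_of_type_algebra\<^esub>
     {free_gen GenX ^ p - free_const a,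
      free_gen GenY ^ p - free_const b,
      free_gen GenY * free_gen GenX - free_const \<zeta> * free_gen GenX * free_gen GenY}"

definition cyclic_algebra :: "nat \<Rightarrow> 'k::field \<Rightarrow> 'k \<Rightarrow> 'k \<Rightarrow> (word \<Rightarrow>\<^sub>0 'k) set ring" where
  "cyclic_algebra p a b \<zeta> = ring_of_type_algebra Quot cyclic_ideal p a b \<zeta>"

definition cyclic_scalar :: "nat \<Rightarrow> 'k::field \<Rightarrow> 'k \<Rightarrow> 'k \<Rightarrow> 'k \<Rightarrow> (word \<Rightarrow>\<^sub>0 'k) set" where
  "cyclic_scalar p a b \<zeta> c = cyclic_ideal p a b \<zeta> +>\<^bsub>ring_of_type_algebra\<^esub> free_const c"

section \<open>Severi-Brauer varieties\<close>

definition pluecker_index :: "nat \<Rightarrow> nat \<Rightarrow> nat set set" where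
  "pluecker_index d n = {S. S \<subseteq> {..<n} \<and> card S = d}"

definition pluecker :: "nat \<Rightarrow> nat \<Rightarrow> (nat \<Rightarrow> nat \<Rightarrow> 'c::field) \<Rightarrow> nat set \<Rightarrow> 'c" where
  "pluecker d n w = (\<lambda>S. if S \<in> pluecker_index d n
     then det (mat d d (\<lambda>(i, j). w i (sorted_list_of_set S ! j))) else 0)"

text \<open>For a \<open>k\<close>-algebra \<open>R\<close> of degree \<open>d\<close>, with \<open>k\<close>-basis \<open>e\<close> of length \<open>d\<^sup>2\<close>: the subvariety of the
  Grassmannian of \<open>d\<close>-dimensional subspaces (Pluecker embedded with respect to \<open>e\<close>) whose geometric
  points are the right ideals of dimension \<open>d\<close> of the scalar extension of \<open>R\<close>.\<close>

definition severi_brauer ::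
    "('a, 'm) ring_scheme \<Rightarrow> ('k::field \<Rightarrow> 'a) \<Rightarrow> nat \<Rightarrow> (nat \<Rightarrow> 'a) \<Rightarrow>
     (nat set \<Rightarrow> 'k alg_closure) set set" where
  "severi_brauer R h d e = {line_of (pluecker d (d\<^sup>2) w) | w.
     w ` {..<d} \<subseteq> coord_space {..<d\<^sup>2} \<and>
     fun_dim (fun_span (w ` {..<d})) = d \<and>
     (\<forall>u\<in>fun_span (w ` {..<d}). \<forall>v\<in>coord_space {..<d\<^sup>2}.
        ext_mult R h (d\<^sup>2) e u v \<in> fun_span (w ` {..<d}))}"

end

theory Submission
  imports Defs
begin

text \<open>Over the algebraic closure the cyclic algebra \<open>A\<close> becomes a matrix algebra in which \<open>L = k(x)\<close> is
  the diagonal torus, with \<open>x\<close> the diagonal matrix of the \<open>p\<close>-th roots of \<open>a\<close>, and \<open>y\<close> is \<open>\<beta>\<close> times the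
  cyclic shift, where \<open>\<beta>\<^sup>p = b\<close>.  A right ideal of dimension \<open>p\<close> consists of the matrices all of whose
  columns are multiples of one vector \<open>v\<close>.  Suppose that no coordinate of \<open>v\<close> vanishes.  Then left
  multiplication by \<open>y\<close> agrees on this ideal with left multiplication by exactly one diagonal matrix
  \<open>z\<close>, namely \<open>z\<^sub>m = \<beta> v\<^sub>m\<^sub>+\<^sub>1 / v\<^sub>m\<close> with cyclic indices, and the product of its entries is \<open>N(z) = \<beta>\<^sup>p = b\<close>.
  Conversely, a diagonal matrix \<open>z\<close> of norm \<open>b\<close> determines \<open>v\<close> up to a scalar.  So the hypersurface
  \<open>N = b\<close> corresponds to the open torus orbit in the Severi-Brauer variety.  What has to be shown is
  that this correspondence is given, in both directions, by forms over the ground field \<open>k\<close> in Pluecker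
  and affine coordinates with respect to arbitrary bases of \<open>A\<close> and \<open>L\<close>.

  From \<open>z\<close> to the ideal (\<open>rank_one_Q\<close>, \<open>regular_orbit_map\<close>): the element \<open>w = y\<^sup>-\<^sup>1 z\<close> satisfies \<open>w\<^sup>p = 1\<close>, and
  the ideal is generated by \<open>1 + w + \<dots> + w\<^sup>p\<^sup>-\<^sup>1\<close>, which is polynomial in \<open>z\<close> with coefficients in \<open>k\<close>.  The
  multiples of this element by the powers of \<open>x\<close> form a basis of the ideal.

  From the ideal to \<open>z\<close> (\<open>rank_one_cramer\<close>, \<open>regular_orbit_inverse\<close>): the projection of a matrix to its
  diagonal is a \<open>k\<close>-linear map from \<open>A\<close> to \<open>L\<close>.  It is bijective on the ideal if and only if no coordinate
  of \<open>v\<close> vanishes, so the orbit is where certain determinants do not all vanish, hence open over \<open>k\<close>.  If \<open>u\<close>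
  is the element of the ideal with diagonal part 1, then \<open>z\<close> is the diagonal part of \<open>y u\<close>, and Cramer's
  rule writes it as a quotient of forms.  A basis of the ideal is recovered locally from its Pluecker
  coordinates by exchanging single columns of a nonvanishing minor (\<open>minor_replace_column\<close>).

  The orbit is dense, because any \<open>v\<close> can be moved into it along the line \<open>v + \<tau> (1, \<dots>, 1)\<close>
  (\<open>orbit_dense\<close>).  The norm hypersurface is isomorphic to an open subset of the standard norm variety,
  which is dense since the latter is irreducible.  Composing the two isomorphisms gives the birational
  isomorphism.\<close>

section \<open>Forms over a subring and polynomial maps\<close>

locale coefficient_ring =
  fixes F :: "'c::field set"
  assumes zero_mem: "0 \<in> F" and one_mem: "1 \<in> F"
    and add_mem: "x \<in> F \<Longrightarrow> y \<in> F \<Longrightarrow> x + y \<in> F"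
    and mult_mem: "x \<in> F \<Longrightarrow> y \<in> F \<Longrightarrow> x * y \<in> F"
    and uminus_mem: "x \<in> F \<Longrightarrow> - x \<in> F"

text \<open>Working with polynomial functions instead of polynomials lets sums, products, substitutions and
  determinants be recognised as forms over \<open>F\<close> without computing any coefficients.\<close>

definition form :: "'c::field set \<Rightarrow> 'i set \<Rightarrow> nat \<Rightarrow> (('i \<Rightarrow> 'c) \<Rightarrow> 'c) \<Rightarrow> bool" where
  "form F I d g \<longleftrightarrow> (\<exists>P. homogeneous_over F I d P \<and> mpol_eval P = g)"

lemma mpol_eval_superset:
  assumes "finite A" "Poly_Mapping.keys P \<subseteq> A"
  shows "mpol_eval P v = (\<Sum>m\<in>A. Poly_Mapping.lookup P m *
    (\<Prod>i\<in>Poly_Mapping.keys m. v i ^ Poly_Mapping.lookup m i))"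
  unfolding mpol_eval_def
  by (rule sum.mono_neutral_left) (use assms in \<open>auto simp: in_keys_iff\<close>)

lemma mpol_eval_add: "mpol_eval (P + Q) v = mpol_eval P v + mpol_eval Q v"
proof -
  let ?A = "Poly_Mapping.keys P \<union> Poly_Mapping.keys Q"
  have "Poly_Mapping.keys (P + Q) \<subseteq> ?A" by (rule Poly_Mapping.keys_add)
  then show ?thesis
    by (simp add: mpol_eval_superset[of ?A] lookup_add distrib_right sum.distrib)
qed

lemma form_scale:
  assumes "form F I d g" shows "g (\<lambda>i. c * v i) = c ^ d * g v"
proof -
  obtain P where P: "homogeneous_over F I d P" "mpol_eval P = g"
    using assms by (auto simp: form_def)
  have "mpol_eval P (\<lambda>i. c * v i) = c ^ d * mpol_eval P v"
    unfolding mpol_eval_def sum_distrib_left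
  proof (rule sum.cong[OF refl])
    fix m assume "m \<in> Poly_Mapping.keys P"
    then have "(\<Sum>i\<in>Poly_Mapping.keys m. Poly_Mapping.lookup m i) = d"
      using P(1) by (auto simp: homogeneous_over_def)
    then have "(\<Prod>i\<in>Poly_Mapping.keys m. c ^ Poly_Mapping.lookup m i) = c ^ d"
      by (simp flip: power_sum)
    then show "Poly_Mapping.lookup P m * (\<Prod>i\<in>Poly_Mapping.keys m. (c * v i) ^ Poly_Mapping.lookup m i)
      = c ^ d * (Poly_Mapping.lookup P m * (\<Prod>i\<in>Poly_Mapping.keys m. v i ^ Poly_Mapping.lookup m i))"
      by (simp add: power_mult_distrib prod.distrib)
  qed
  with P show ?thesis by simp
qed

context coefficient_ring begin

lemma power_mem: "x \<in> F \<Longrightarrow> x ^ n \<in> F"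
  by (induction n) (auto intro: one_mem mult_mem)

lemma form_zero: "form F I d (\<lambda>v. 0)"
  unfolding form_def
  by (rule exI[of _ 0]) (auto simp: homogeneous_over_def mpol_eval_def)

lemma form_add:
  assumes "form F I d g" "form F I d h"
  shows "form F I d (\<lambda>v. g v + h v)"
proof -
  obtain P Q where P: "homogeneous_over F I d P" "mpol_eval P = g"
    and Q: "homogeneous_over F I d Q" "mpol_eval Q = h"
    using assms by (auto simp: form_def)
  have "homogeneous_over F I d (P + Q)"
    unfolding homogeneous_over_def
  proof
    fix m assume "m \<in> Poly_Mapping.keys (P + Q)"
    then have "m \<in> Poly_Mapping.keys P \<union> Poly_Mapping.keys Q"
      using Poly_Mapping.keys_add[of P Q] by auto
    moreover have "Poly_Mapping.lookup P m \<in> F" "Poly_Mapping.lookup Q m \<in> F"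
      using P Q zero_mem by (auto simp: homogeneous_over_def in_keys_iff)
    ultimately show "Poly_Mapping.lookup (P + Q) m \<in> F \<and> Poly_Mapping.keys m \<subseteq> I \<and>
        (\<Sum>i\<in>Poly_Mapping.keys m. Poly_Mapping.lookup m i) = d"
      using P Q by (auto simp: homogeneous_over_def lookup_add intro: add_mem)
  qed
  then show ?thesis
    unfolding form_def using P Q by (intro exI[of _ "P + Q"]) (auto simp: mpol_eval_add fun_eq_iff)
qed

lemma form_sum: "(\<And>x. x \<in> A \<Longrightarrow> form F I d (g x)) \<Longrightarrow> form F I d (\<lambda>v. \<Sum>x\<in>A. g x v)"
  by (induction A rule: infinite_finite_induct) (auto intro: form_add form_zero)

lemma form_monomial:
  assumes "c \<in> F" "Poly_Mapping.keys m \<subseteq> I"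
    "(\<Sum>i\<in>Poly_Mapping.keys m. Poly_Mapping.lookup m i) = d"
  shows "form F I d (\<lambda>v. c * (\<Prod>i\<in>Poly_Mapping.keys m. v i ^ Poly_Mapping.lookup m i))"
proof -
  have "mpol_eval (Poly_Mapping.single m c) v
      = c * (\<Prod>i\<in>Poly_Mapping.keys m. v i ^ Poly_Mapping.lookup m i)" for v
    by (subst mpol_eval_superset[of "{m}"]) auto
  then show ?thesis
    unfolding form_def using assms
    by (intro exI[of _ "Poly_Mapping.single m c"]) (auto simp: homogeneous_over_def fun_eq_iff)
qed

lemma form_const: "c \<in> F \<Longrightarrow> form F I 0 (\<lambda>v. c)"
  using form_monomial[of c 0 I 0] by simp

lemma form_coord: "i \<in> I \<Longrightarrow> form F I 1 (\<lambda>v. v i)"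
  using form_monomial[of 1 "Poly_Mapping.single i 1" I 1] one_mem by simp

lemma lookup_prod_superset:
  fixes v :: "'i \<Rightarrow> 'c"
  assumes "finite A" "Poly_Mapping.keys m \<subseteq> A"
  shows "(\<Prod>i\<in>Poly_Mapping.keys m. v i ^ Poly_Mapping.lookup m i)
    = (\<Prod>i\<in>A. v i ^ Poly_Mapping.lookup m i)"
  by (rule prod.mono_neutral_left) (use assms in \<open>auto simp: in_keys_iff\<close>)

text \<open>Expanded into monomials, a product of two forms is a sum of monomials of degree \<open>d + d'\<close>.\<close>

lemma form_mult:
  assumes "form F I d g" "form F I d' h"
  shows "form F I (d + d') (\<lambda>v. g v * h v)"
proof -
  obtain P Q where P: "homogeneous_over F I d P" "mpol_eval P = g"
    and Q: "homogeneous_over F I d' Q" "mpol_eval Q = h"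
    using assms by (auto simp: form_def)
  have eq: "(\<lambda>v. g v * h v) = (\<lambda>v. \<Sum>m\<in>Poly_Mapping.keys P. \<Sum>m'\<in>Poly_Mapping.keys Q.
      (Poly_Mapping.lookup P m * Poly_Mapping.lookup Q m') *
      (\<Prod>i\<in>Poly_Mapping.keys (m + m'). v i ^ Poly_Mapping.lookup (m + m') i))"
  proof
    fix v :: "'a \<Rightarrow> 'c"
    have mon: "(\<Prod>i\<in>Poly_Mapping.keys (m + m'). v i ^ Poly_Mapping.lookup (m + m') i)
      = (\<Prod>i\<in>Poly_Mapping.keys m. v i ^ Poly_Mapping.lookup m i)
        * (\<Prod>i\<in>Poly_Mapping.keys m'. v i ^ Poly_Mapping.lookup m' i)" for m m' :: "'a \<Rightarrow>\<^sub>0 nat"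
    proof -
      let ?A = "Poly_Mapping.keys m \<union> Poly_Mapping.keys m'"
      have "Poly_Mapping.keys (m + m') \<subseteq> ?A" by (rule Poly_Mapping.keys_add)
      then show ?thesis
        by (subst (1 2 3) lookup_prod_superset[of ?A]) (auto simp: lookup_add power_add prod.distrib)
    qed
    show "g v * h v = (\<Sum>m\<in>Poly_Mapping.keys P. \<Sum>m'\<in>Poly_Mapping.keys Q.
      (Poly_Mapping.lookup P m * Poly_Mapping.lookup Q m') *
      (\<Prod>i\<in>Poly_Mapping.keys (m + m'). v i ^ Poly_Mapping.lookup (m + m') i))"
      unfolding mon P(2)[symmetric] Q(2)[symmetric] mpol_eval_def sum_product
      by (intro sum.cong refl) (simp add: mult_ac)
  qed
  show ?thesis unfolding eq
  proof (intro form_sum form_monomial)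
    fix m m' assume m: "m \<in> Poly_Mapping.keys P" and m': "m' \<in> Poly_Mapping.keys Q"
    show "Poly_Mapping.lookup P m * Poly_Mapping.lookup Q m' \<in> F"
      using m m' P Q by (auto simp: homogeneous_over_def intro: mult_mem)
    show "Poly_Mapping.keys (m + m') \<subseteq> I"
      using Poly_Mapping.keys_add[of m m'] m m' P Q by (fastforce simp: homogeneous_over_def)
    let ?A = "Poly_Mapping.keys m \<union> Poly_Mapping.keys m'"
    have sup: "(\<Sum>i\<in>Poly_Mapping.keys k. Poly_Mapping.lookup k i) = (\<Sum>i\<in>?A. Poly_Mapping.lookup k i)"
      if "Poly_Mapping.keys k \<subseteq> ?A" for k :: "'a \<Rightarrow>\<^sub>0 nat"
      by (rule sum.mono_neutral_left) (use that in \<open>auto simp: in_keys_iff\<close>)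
    have "(\<Sum>i\<in>Poly_Mapping.keys (m + m'). Poly_Mapping.lookup (m + m') i)
      = (\<Sum>i\<in>Poly_Mapping.keys m. Poly_Mapping.lookup m i)
        + (\<Sum>i\<in>Poly_Mapping.keys m'. Poly_Mapping.lookup m' i)"
      using Poly_Mapping.keys_add[of m m']
      by (subst (1 2 3) sup) (auto simp: lookup_add sum.distrib)
    then show "(\<Sum>i\<in>Poly_Mapping.keys (m + m'). Poly_Mapping.lookup (m + m') i) = d + d'"
      using m m' P Q by (auto simp: homogeneous_over_def)
  qed
qed

lemma form_cmult: "c \<in> F \<Longrightarrow> form F I d g \<Longrightarrow> form F I d (\<lambda>v. c * g v)"
  using form_mult[OF form_const, of c I d g] by simp

lemma form_prod:
  assumes "\<And>x. x \<in> A \<Longrightarrow> form F I (d x) (g x)"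
  shows "form F I (\<Sum>x\<in>A. d x) (\<lambda>v. \<Prod>x\<in>A. g x v)"
  using assms
  by (induction A rule: infinite_finite_induct) (auto simp: form_const one_mem intro!: form_mult)

lemma form_power: "form F I d g \<Longrightarrow> form F I (n * d) (\<lambda>v. g v ^ n)"
  by (induction n) (auto simp: form_const one_mem intro!: form_mult)

text \<open>Coordinates outside \<open>J\<close> are set to 0, the convention by which a regular map is given by forms.\<close>

lemma form_compose:
  assumes "form F J d' g" "\<And>j. j \<in> J \<Longrightarrow> form F I d (f j)"
  shows "form F I (d * d') (\<lambda>v. g (\<lambda>j. if j \<in> J then f j v else 0))"
proof -
  obtain P where P: "homogeneous_over F J d' P" "mpol_eval P = g"
    using assms by (auto simp: form_def)
  have "form F I (d * d') (\<lambda>v. mpol_eval P (\<lambda>j. if j \<in> J then f j v else 0))"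
    unfolding mpol_eval_def
  proof (rule form_sum)
    fix m assume m: "m \<in> Poly_Mapping.keys P"
    then have mem: "Poly_Mapping.lookup P m \<in> F" and sub: "Poly_Mapping.keys m \<subseteq> J"
      and deg: "(\<Sum>j\<in>Poly_Mapping.keys m. Poly_Mapping.lookup m j) = d'"
      using P by (auto simp: homogeneous_over_def)
    have "form F I (\<Sum>j\<in>Poly_Mapping.keys m. Poly_Mapping.lookup m j * d)
      (\<lambda>v. \<Prod>j\<in>Poly_Mapping.keys m. (if j \<in> J then f j v else 0) ^ Poly_Mapping.lookup m j)"
    proof (intro form_prod form_power)
      fix j assume "j \<in> Poly_Mapping.keys m"
      then have "j \<in> J" using sub by auto
      then show "form F I d (\<lambda>v. if j \<in> J then f j v else 0)" using assms(2) by simp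
    qed
    moreover have "(\<Sum>j\<in>Poly_Mapping.keys m. Poly_Mapping.lookup m j * d) = d * d'"
      using deg by (simp add: sum_distrib_right[symmetric])
    ultimately show "form F I (d * d') (\<lambda>v. Poly_Mapping.lookup P m * (\<Prod>j\<in>Poly_Mapping.keys m.
        (if j \<in> J then f j v else 0) ^ Poly_Mapping.lookup m j))"
      using mem by (intro form_cmult) simp_all
  qed
  then show ?thesis using P(2) by simp
qed

lemma form_det:
  assumes "\<And>i j. i < n \<Longrightarrow> j < n \<Longrightarrow> form F I d (a i j)"
  shows "form F I (n * d) (\<lambda>v. det (mat n n (\<lambda>(i, j). a i j v)))"
proof -
  have eq: "(\<lambda>v. det (mat n n (\<lambda>(i, j). a i j v)))
    = (\<lambda>v. \<Sum>q\<in>{q. q permutes {0..<n}}. signof q * (\<Prod>i\<in>{0..<n}. a i (q i) v))"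
  proof
    fix v
    show "det (mat n n (\<lambda>(i, j). a i j v))
      = (\<Sum>q\<in>{q. q permutes {0..<n}}. signof q * (\<Prod>i\<in>{0..<n}. a i (q i) v))"
      by (subst det_def'[of _ n]) (auto intro!: sum.cong prod.cong simp: permutes_in_image)
  qed
  show ?thesis unfolding eq
  proof (intro form_sum form_cmult)
    fix q assume q: "q \<in> {q. q permutes {0..<n}}"
    show "signof q \<in> F"
      by (auto simp: sign_def one_mem uminus_mem)
    have "form F I (\<Sum>i\<in>{0..<n}. d) (\<lambda>v. \<Prod>i\<in>{0..<n}. a i (q i) v)"
      by (rule form_prod) (use q assms in \<open>auto simp: permutes_in_image\<close>)
    then show "form F I (n * d) (\<lambda>v. \<Prod>i\<in>{0..<n}. a i (q i) v)" by simp
  qed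
qed

lemma form_adj_mat:
  assumes "\<And>i j. i < n \<Longrightarrow> j < n \<Longrightarrow> form F I d (a i j)" "i < n" "j < n"
  shows "form F I ((n - 1) * d) (\<lambda>v. adj_mat (mat n n (\<lambda>(i, j). a i j v)) $$ (i, j))"
proof -
  have eq: "(\<lambda>v. adj_mat (mat n n (\<lambda>(i, j). a i j v)) $$ (i, j))
    = (\<lambda>v. (- 1) ^ (j + i) * det (mat (n - 1) (n - 1) (\<lambda>(k, l).
        a (if k < j then k else Suc k) (if l < i then l else Suc l) v)))"
    using assms(2,3)
    by (auto simp: adj_mat_def cofactor_def mat_delete_def fun_eq_iff
        intro!: arg_cong[of _ _ det])
  show ?thesis unfolding eq
    by (intro form_cmult form_det assms(1) power_mem uminus_mem one_mem) auto
qed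

end

section \<open>Lines, open sets and regular maps\<close>

lemma mem_line_of: "u \<in> line_of v \<longleftrightarrow> (\<exists>c. u = (\<lambda>i. c * v i))"
  by (auto simp: line_of_def)

lemma self_mem_line_of: "v \<in> line_of v"
  by (auto simp: mem_line_of intro!: exI[of _ 1])

lemma line_of_scale:
  assumes "c \<noteq> 0" shows "line_of (\<lambda>i. c * v i) = line_of v"
proof -
  have "\<exists>e. (\<lambda>i. d * v i) = (\<lambda>i. e * (c * v i))" for d
    using assms by (intro exI[of _ "d / c"]) (auto simp: fun_eq_iff)
  then show ?thesis
    by (auto simp: line_of_def image_iff fun_eq_iff)
qed

lemma line_of_mem_proj_space: "v \<in> coord_space I \<Longrightarrow> v \<noteq> (\<lambda>_. 0) \<Longrightarrow> line_of v \<in> proj_space I"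
  by (auto simp: proj_space_def)

lemma proj_space_nonzero_mem:
  assumes "l \<in> proj_space I" "v \<in> l" "v \<noteq> (\<lambda>_. 0)"
  shows "l = line_of v" "v \<in> coord_space I"
proof -
  obtain w where w: "w \<in> coord_space I" "l = line_of w"
    using assms(1) by (auto simp: proj_space_def)
  then obtain c where c: "v = (\<lambda>i. c * w i)" using assms(2) by (auto simp: mem_line_of)
  with assms(3) have "c \<noteq> 0" by auto
  with c w show "l = line_of v" by (simp add: line_of_scale)
  show "v \<in> coord_space I" using c w by (auto simp: coord_space_def)
qed

lemma proj_space_obtain_nonzero:
  assumes "l \<in> proj_space I"
  obtains v where "v \<in> coord_space I" "v \<noteq> (\<lambda>_. 0)" "l = line_of v"
  using assms by (auto simp: proj_space_def)

definition form_locus :: "'i set \<Rightarrow> (('i \<Rightarrow> 'c::field) \<Rightarrow> 'c) \<Rightarrow> ('i \<Rightarrow> 'c) set set" where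
  "form_locus I g = {l \<in> proj_space I. \<exists>v\<in>l. g v \<noteq> 0}"

text \<open>By homogeneity, whether a form vanishes on a line can be tested on any spanning vector.\<close>

lemma line_of_mem_form_locus:
  assumes "form F I d g" "v \<in> coord_space I" "v \<noteq> (\<lambda>_. 0)"
  shows "line_of v \<in> form_locus I g \<longleftrightarrow> g v \<noteq> 0"
proof
  assume "line_of v \<in> form_locus I g"
  then obtain c where "g (\<lambda>i. c * v i) \<noteq> 0" by (auto simp: form_locus_def mem_line_of)
  with form_scale[OF assms(1)] show "g v \<noteq> 0" by auto
next
  assume "g v \<noteq> 0"
  then show "line_of v \<in> form_locus I g"
    using assms self_mem_line_of[of v] by (auto simp: form_locus_def line_of_mem_proj_space)
qed

lemma openin_form_locus: "form F I d g \<Longrightarrow> openin (zariski F I) (form_locus I g)"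
  unfolding zariski_def form_def form_locus_def openin_topology_generated_by_iff
  by (rule generate_topology_on.Basis) (auto simp: nonvanishing_locus_def)

text \<open>A property of open sets that survives finite intersections and arbitrary unions need only be
  checked on the subbasic sets, where it becomes a statement about a single form.\<close>

lemma zariski_induct [consumes 1, case_names Empty Int UN Basis]:
  assumes "openin (zariski F I) S" "P {}"
    "\<And>A B. openin (zariski F I) A \<Longrightarrow> openin (zariski F I) B \<Longrightarrow> P A \<Longrightarrow> P B \<Longrightarrow> P (A \<inter> B)"
    "\<And>C. (\<And>A. A \<in> C \<Longrightarrow> openin (zariski F I) A) \<Longrightarrow> (\<And>A. A \<in> C \<Longrightarrow> P A) \<Longrightarrow> P (\<Union>C)"
    "\<And>d g. form F I d g \<Longrightarrow> P (form_locus I g)"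
  shows "P S"
proof -
  have "generate_topology_on {nonvanishing_locus I P | P d. homogeneous_over F I d P} S"
    using assms(1) by (simp add: zariski_def openin_topology_generated_by_iff)
  then show ?thesis
  proof induction
    case (Basis s)
    then show ?case using assms(5)
      by (auto simp: form_def form_locus_def nonvanishing_locus_def)
  qed (use assms in \<open>auto simp: zariski_def openin_topology_generated_by_iff\<close>)
qed

lemma zariski_mono:
  assumes "openin (zariski F I) S" "F \<subseteq> G" shows "openin (zariski G I) S"
  using assms(1)
proof (induction rule: zariski_induct)
  case (Basis d g)
  then have "form G I d g"
    using assms(2) by (fastforce simp: form_def homogeneous_over_def)
  then show ?case by (rule openin_form_locus)
qed auto

text \<open>The constant form \<open>1\<close> of degree 0 vanishes nowhere.\<close>

lemma (in coefficient_ring) topspace_zariski: "topspace (zariski F I) = proj_space I"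
proof
  show "topspace (zariski F I) \<subseteq> proj_space I"
    by (auto simp: zariski_def topology_generated_by_topspace nonvanishing_locus_def)
  have "proj_space I = form_locus I (\<lambda>_. 1)"
    unfolding form_locus_def by (auto simp: proj_space_def intro: self_mem_line_of)
  moreover have "openin (zariski F I) \<dots>"
    by (rule openin_form_locus[OF form_const]) (rule one_mem)
  ultimately show "proj_space I \<subseteq> topspace (zariski F I)" using openin_subset by metis
qed

lemma coefficient_ring_UNIV: "coefficient_ring UNIV"
  by unfold_locales auto

lemma regular_mapE:
  assumes "regular_map F I V J W \<phi>" "l \<in> V"
  obtains U f d where "openin (subtopology (zariski F I) V) U" "l \<in> U"
    "\<And>j. j \<in> J \<Longrightarrow> form F I d (f j)"
    "\<And>m v. m \<in> U \<Longrightarrow> v \<in> m \<Longrightarrow> v \<noteq> (\<lambda>_. 0) \<Longrightarrow> \<exists>j\<in>J. f j v \<noteq> 0"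
    "\<And>m v. m \<in> U \<Longrightarrow> v \<in> m \<Longrightarrow> v \<noteq> (\<lambda>_. 0) \<Longrightarrow> \<phi> m = line_of (\<lambda>j. if j \<in> J then f j v else 0)"
proof -
  from bspec[OF conjunct2[OF assms(1)[unfolded regular_map_def]] assms(2)]
  obtain U f d where *: "openin (subtopology (zariski F I) V) U" "l \<in> U"
    "\<forall>j\<in>J. homogeneous_over F I d (f j)"
    "\<forall>m\<in>U. \<forall>v\<in>m - {\<lambda>_. 0}. (\<exists>j\<in>J. mpol_eval (f j) v \<noteq> 0) \<and>
           \<phi> m = line_of (\<lambda>j. if j \<in> J then mpol_eval (f j) v else 0)"
    by (elim exE conjE)
  show ?thesis
    by (rule that[of U d "\<lambda>j. mpol_eval (f j)"]) (use * in \<open>auto simp: form_def\<close>)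
qed

lemma regular_mapI:
  assumes "\<phi> ` V \<subseteq> W"
    "\<And>l. l \<in> V \<Longrightarrow> \<exists>U f d. openin (subtopology (zariski F I) V) U \<and> l \<in> U \<and>
        (\<forall>j\<in>J. form F I d (f j)) \<and>
        (\<forall>m\<in>U. \<forall>v\<in>m - {\<lambda>_. 0}.
           (\<exists>j\<in>J. f j v \<noteq> 0) \<and> \<phi> m = line_of (\<lambda>j. if j \<in> J then f j v else 0))"
  shows "regular_map F I V J W \<phi>"
  unfolding regular_map_def
proof (intro conjI ballI assms(1))
  fix l assume l: "l \<in> V"
  from assms(2)[OF l] obtain U f d where *: "openin (subtopology (zariski F I) V) U" "l \<in> U"
    "\<forall>j\<in>J. form F I d (f j)"
    "\<forall>m\<in>U. \<forall>v\<in>m - {\<lambda>_. 0}. (\<exists>j\<in>J. f j v \<noteq> 0) \<and> \<phi> m = line_of (\<lambda>j. if j \<in> J then f j v else 0)"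
    by (elim exE conjE)
  then obtain P where P: "\<And>j. j \<in> J \<Longrightarrow> homogeneous_over F I d (P j)"
    "\<And>j. j \<in> J \<Longrightarrow> mpol_eval (P j) = f j"
    unfolding form_def by metis
  have "(\<lambda>j. if j \<in> J then mpol_eval (P j) v else 0) = (\<lambda>j. if j \<in> J then f j v else 0)" for v
    using P by auto
  then show "\<exists>U f d. openin (subtopology (zariski F I) V) U \<and> l \<in> U \<and>
        (\<forall>j\<in>J. homogeneous_over F I d (f j)) \<and>
        (\<forall>m\<in>U. \<forall>v\<in>m - {\<lambda>_. 0}.
           (\<exists>j\<in>J. mpol_eval (f j) v \<noteq> 0) \<and>
           \<phi> m = line_of (\<lambda>j. if j \<in> J then mpol_eval (f j) v else 0))"
    using * P by (intro exI[of _ U] exI[of _ P] exI[of _ d]) auto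
qed

text \<open>The forms of the first map are substituted into those of the second.  This describes the
  composite only where the first map lands in the region on which the second is given by those
  forms; that region is open because the preimage of a form locus is again a form locus.\<close>

lemma (in coefficient_ring) regular_map_compose:
  assumes \<phi>: "regular_map F I V J W \<phi>" and \<psi>: "regular_map F J W L Z \<psi>"
  shows "regular_map F I V L Z (\<lambda>l. \<psi> (\<phi> l))"
proof (rule regular_mapI)
  show "(\<lambda>l. \<psi> (\<phi> l)) ` V \<subseteq> Z" using assms by (auto simp: regular_map_def image_subset_iff)
  fix l assume l: "l \<in> V"
  from \<phi> l have \<phi>l: "\<phi> l \<in> W" by (auto simp: regular_map_def)
  obtain U f d where U: "openin (subtopology (zariski F I) V) U" "l \<in> U"
    and f: "\<And>j. j \<in> J \<Longrightarrow> form F I d (f j)"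
    and f0: "\<And>m v. m \<in> U \<Longrightarrow> v \<in> m \<Longrightarrow> v \<noteq> (\<lambda>_. 0) \<Longrightarrow> \<exists>j\<in>J. f j v \<noteq> 0"
    and \<phi>f: "\<And>m v. m \<in> U \<Longrightarrow> v \<in> m \<Longrightarrow> v \<noteq> (\<lambda>_. 0) \<Longrightarrow> \<phi> m = line_of (\<lambda>j. if j \<in> J then f j v else 0)"
    by (rule regular_mapE[OF \<phi> l]) blast
  obtain U' g d' where U': "openin (subtopology (zariski F J) W) U'" "\<phi> l \<in> U'"
    and g: "\<And>j. j \<in> L \<Longrightarrow> form F J d' (g j)"
    and g0: "\<And>m v. m \<in> U' \<Longrightarrow> v \<in> m \<Longrightarrow> v \<noteq> (\<lambda>_. 0) \<Longrightarrow> \<exists>j\<in>L. g j v \<noteq> 0"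
    and \<psi>g: "\<And>m v. m \<in> U' \<Longrightarrow> v \<in> m \<Longrightarrow> v \<noteq> (\<lambda>_. 0) \<Longrightarrow> \<psi> m = line_of (\<lambda>j. if j \<in> L then g j v else 0)"
    by (rule regular_mapE[OF \<psi> \<phi>l]) blast
  let ?f = "\<lambda>v j. if j \<in> J then f j v else 0"
  have UV: "U \<subseteq> V" "U \<subseteq> proj_space I"
    using openin_subset[OF U(1)] topspace_zariski by auto
  have fnz: "?f v \<noteq> (\<lambda>_. 0)" if "m \<in> U" "v \<in> m" "v \<noteq> (\<lambda>_. 0)" for m v
    using f0[OF that] by (auto simp: fun_eq_iff)
  have fcs: "?f v \<in> coord_space J" for v by (auto simp: coord_space_def)
  have preim: "openin (subtopology (zariski F I) V) {m \<in> U. \<phi> m \<in> S}" if "openin (zariski F J) S" for S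
    using that
  proof (induction rule: zariski_induct)
    case (Int A B)
    have "{m \<in> U. \<phi> m \<in> A \<inter> B} = {m \<in> U. \<phi> m \<in> A} \<inter> {m \<in> U. \<phi> m \<in> B}" by auto
    then show ?case using Int by auto
  next
    case (UN C)
    have "{m \<in> U. \<phi> m \<in> \<Union>C} = \<Union>((\<lambda>A. {m \<in> U. \<phi> m \<in> A}) ` C)" by auto
    then show ?case using UN by auto
  next
    case (Basis e h)
    have comp: "form F I (d * e) (\<lambda>v. h (?f v))"
      by (rule form_compose[OF Basis f])
    have "m \<in> form_locus I (\<lambda>v. h (?f v)) \<longleftrightarrow> \<phi> m \<in> form_locus J h" if m: "m \<in> U" for m
    proof -
      obtain v where v: "v \<in> coord_space I" "v \<noteq> (\<lambda>_. 0)" "m = line_of v"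
        using m UV by (meson proj_space_obtain_nonzero subsetD)
      then have vm: "v \<in> m" by (simp add: self_mem_line_of)
      show ?thesis
        using line_of_mem_form_locus[OF comp v(1,2)] line_of_mem_form_locus[OF Basis fcs fnz[OF m vm v(2)]]
          \<phi>f[OF m vm v(2)] v(3) by simp
    qed
    then have "{m \<in> U. \<phi> m \<in> form_locus J h} = U \<inter> form_locus I (\<lambda>v. h (?f v))" by auto
    then show ?case using U(1) openin_form_locus[OF comp]
      by (metis (no_types, lifting) UV(1) inf.absorb_iff1 inf_assoc openin_Int openin_subtopology_Int2 topspace_subtopology_subset)
  qed auto
  obtain S where S: "openin (zariski F J) S" "U' = S \<inter> W"
    using U'(1) by (auto simp: openin_subtopology)
  show "\<exists>U f d. openin (subtopology (zariski F I) V) U \<and> l \<in> U \<and>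
        (\<forall>j\<in>L. form F I d (f j)) \<and>
        (\<forall>m\<in>U. \<forall>v\<in>m - {\<lambda>_. 0}.
           (\<exists>j\<in>L. f j v \<noteq> 0) \<and> \<psi> (\<phi> m) = line_of (\<lambda>j. if j \<in> L then f j v else 0))"
  proof (intro exI conjI ballI)
    show "openin (subtopology (zariski F I) V) {m \<in> U. \<phi> m \<in> S}" by (rule preim) (rule S)
    show "l \<in> {m \<in> U. \<phi> m \<in> S}" using U U' S by auto
    show "form F I (d * d') (\<lambda>v. g j (?f v))" if "j \<in> L" for j
      by (rule form_compose[OF g[OF that] f])
    fix m v assume "m \<in> {m \<in> U. \<phi> m \<in> S}" "v \<in> m - {\<lambda>_. 0}"
    then have m: "m \<in> U" "\<phi> m \<in> S" "v \<in> m" "v \<noteq> (\<lambda>_. 0)" by auto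
    then have "\<phi> m \<in> U'" using S UV \<phi> by (auto simp: regular_map_def)
    moreover have "?f v \<in> \<phi> m" using \<phi>f[OF m(1,3,4)] by (simp add: self_mem_line_of)
    ultimately show "\<exists>j\<in>L. g j (?f v) \<noteq> 0" "\<psi> (\<phi> m) = line_of (\<lambda>j. if j \<in> L then g j (?f v) else 0)"
      using g0[OF _ _ fnz[OF m(1,3,4)]] \<psi>g[OF _ _ fnz[OF m(1,3,4)]] by auto
  qed
qed

text \<open>The closure of \<open>B\<close> and the complement of an open set cutting out \<open>B\<close> cover \<open>V\<close>.  Both are closed
  over \<open>F\<close>, hence closed geometrically, so geometric irreducibility puts \<open>V\<close> inside one of them.\<close>

lemma (in coefficient_ring) open_dense_of_irreducible:
  assumes "irreducible_in (zariski UNIV I) V" "openin (subtopology (zariski F I) V) B" "B \<noteq> {}"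
  shows "V \<subseteq> Abstract_Topology.closure_of (zariski F I) B"
proof -
  let ?C = "Abstract_Topology.closure_of (zariski F I) B"
  interpret U: coefficient_ring "UNIV :: 'c set" by (rule coefficient_ring_UNIV)
  have closed: "closedin (zariski UNIV I) S" if "closedin (zariski F I) S" for S
    using that zariski_mono[of F I _ UNIV] by (auto simp: closedin_def topspace_zariski U.topspace_zariski)
  obtain S where S: "openin (zariski F I) S" "B = S \<inter> V"
    using assms(2) by (auto simp: openin_subtopology)
  have VT: "V \<subseteq> proj_space I" using assms(1) by (simp add: irreducible_in_def U.topspace_zariski)
  have "closedin (zariski F I) (topspace (zariski F I) - S)" using S(1) by auto
  moreover have "closedin (zariski F I) ?C" by simp
  moreover have "V \<subseteq> (topspace (zariski F I) - S) \<union> ?C"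
    using VT S(2) closure_of_subset[of B "zariski F I"] by (auto simp: topspace_zariski)
  ultimately have "V \<subseteq> topspace (zariski F I) - S \<or> V \<subseteq> ?C"
    using assms(1) closed unfolding irreducible_in_def by blast
  then show ?thesis using S(2) assms(3) by auto
qed

text \<open>Along a polynomially parametrised curve a form becomes a polynomial in the parameter.  Hence an
  open set that meets such a curve contains all but finitely many of its points.\<close>

lemma openin_zariski_along_curve:
  fixes \<gamma> :: "'c::field \<Rightarrow> 'i \<Rightarrow> 'c"
  assumes "openin (zariski F I) S"
    and \<gamma>: "\<And>i. \<exists>q. \<forall>\<tau>. \<gamma> \<tau> i = poly q \<tau>" and cs: "\<And>\<tau>. \<gamma> \<tau> \<in> coord_space I"
  shows "finite {\<tau>. line_of (\<gamma> \<tau>) \<notin> S} \<or> (\<forall>\<tau>. line_of (\<gamma> \<tau>) \<notin> S)"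
  using assms(1)
proof (induction rule: zariski_induct)
  case (Int A B)
  have "{\<tau>. line_of (\<gamma> \<tau>) \<notin> A \<inter> B} = {\<tau>. line_of (\<gamma> \<tau>) \<notin> A} \<union> {\<tau>. line_of (\<gamma> \<tau>) \<notin> B}" by auto
  then show ?case using Int by auto
next
  case (UN C)
  show ?case
  proof (cases "\<exists>A\<in>C. finite {\<tau>. line_of (\<gamma> \<tau>) \<notin> A}")
    case True
    then obtain A where "A \<in> C" "finite {\<tau>. line_of (\<gamma> \<tau>) \<notin> A}" by auto
    then show ?thesis by (intro disjI1, elim rev_finite_subset) auto
  next
    case False
    then show ?thesis using UN(2) by blast
  qed
next
  case (Basis d g)
  obtain q where q: "\<And>i \<tau>. \<gamma> \<tau> i = poly (q i) \<tau>" using \<gamma> by metis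
  obtain P where P: "mpol_eval P = g" using Basis by (auto simp: form_def)
  have "\<exists>r. \<forall>\<tau>. g (\<gamma> \<tau>) = poly r \<tau>"
    by (rule exI[of _ "\<Sum>m\<in>Poly_Mapping.keys P. smult (Poly_Mapping.lookup P m)
        (\<Prod>i\<in>Poly_Mapping.keys m. q i ^ Poly_Mapping.lookup m i)"])
      (simp add: P[symmetric] mpol_eval_def q poly_sum poly_prod)
  then obtain r where r: "\<And>\<tau>. g (\<gamma> \<tau>) = poly r \<tau>" by metis
  show ?case
  proof (cases "r = 0 \<or> (\<forall>i. q i = 0)")
    case True
    have "line_of (\<gamma> \<tau>) \<notin> form_locus I g" for \<tau>
    proof (cases "\<gamma> \<tau> = (\<lambda>_. 0)")
      case True
      then have "line_of (\<gamma> \<tau>) \<notin> proj_space I"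
      proof -
        have "line_of (\<gamma> \<tau>) = {\<lambda>_. 0}" using True by (auto simp: line_of_def)
        moreover have "line_of v \<noteq> {\<lambda>_. 0}" if "v \<noteq> (\<lambda>_. 0)" for v :: "'i \<Rightarrow> 'c"
          using that self_mem_line_of[of v] by auto
        ultimately show ?thesis by (auto simp: proj_space_def image_iff)
      qed
      then show ?thesis by (simp add: form_locus_def)
    next
      case False
      with True q r have "g (\<gamma> \<tau>) = 0" by (auto simp: fun_eq_iff)
      then show ?thesis using line_of_mem_form_locus[OF Basis cs False] by simp
    qed
    then show ?thesis by auto
  next
    case False
    then obtain i where "q i \<noteq> 0" "r \<noteq> 0" by auto
    then have "finite ({\<tau>. poly (q i) \<tau> = 0} \<union> {\<tau>. poly r \<tau> = 0})" by (simp add: poly_roots_finite)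
    moreover have "{\<tau>. line_of (\<gamma> \<tau>) \<notin> form_locus I g} \<subseteq> \<dots>"
      using line_of_mem_form_locus[OF Basis cs] q r by (force simp: fun_eq_iff)
    ultimately show ?thesis using finite_subset by blast
  qed
qed auto

section \<open>Minors and Pluecker coordinates\<close>

lemma left_inverse_imp_right_inverse:
  fixes A B :: "nat \<Rightarrow> nat \<Rightarrow> 'c::field"
  assumes "\<And>i j. i < n \<Longrightarrow> j < n \<Longrightarrow> (\<Sum>l<n. A i l * B l j) = (if i = j then 1 else 0)"
    and "i < n" "j < n"
  shows "(\<Sum>l<n. B i l * A l j) = (if i = j then 1 else 0)"
proof -
  let ?A = "mat n n (\<lambda>(i, j). A i j)" and ?B = "mat n n (\<lambda>(i, j). B i j)"
  have "?A * ?B = 1\<^sub>m n"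
    by (rule eq_matI) (use assms(1) in \<open>auto simp: scalar_prod_def atLeast0LessThan\<close>)
  then have "?B * ?A = 1\<^sub>m n"
    by (intro mat_mult_left_right_inverse[of ?A n ?B]) auto
  then have "(?B * ?A) $$ (i, j) = (if i = j then 1 else 0)" using assms by simp
  then show ?thesis using assms(2,3) by (simp add: scalar_prod_def atLeast0LessThan)
qed

lemma sum_fun_apply: "(\<Sum>x\<in>A. f x) j = (\<Sum>x\<in>A. f x j :: 'c::comm_monoid_add)"
  by (induction A rule: infinite_finite_induct) auto

text \<open>The columns are selected by an arbitrary function, possibly with repetitions and in any order, so
  that a single column can be exchanged by a function update.\<close>

definition minor :: "nat \<Rightarrow> (nat \<Rightarrow> nat \<Rightarrow> 'c::field) \<Rightarrow> (nat \<Rightarrow> nat) \<Rightarrow> 'c" where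
  "minor d w f = det (mat d d (\<lambda>(i, j). w i (f j)))"

lemma minor_not_inj:
  assumes "\<not> inj_on f {..<d}" shows "minor d w f = 0"
proof -
  obtain i j where ij: "i < d" "j < d" "i \<noteq> j" "f i = f j"
    using assms by (auto simp: inj_on_def)
  show ?thesis unfolding minor_def
    by (rule det_identical_columns[OF _ ij(3,1,2)]) (use ij in \<open>auto intro!: eq_vecI\<close>)
qed

text \<open>Sorting the columns is a permutation depending only on \<open>f\<close>, so the sign is the same for all
  matrices: up to sign, minors are coordinate functions in the Pluecker embedding.\<close>

lemma minor_eq_pluecker:
  fixes f :: "nat \<Rightarrow> nat"
  assumes "inj_on f {..<d}" "f ` {..<d} \<subseteq> {..<n}"
  shows "f ` {..<d} \<in> pluecker_index d n"
    "\<exists>c\<in>{1, -1}. \<forall>w :: nat \<Rightarrow> nat \<Rightarrow> 'c::field. minor d w f = c * pluecker d n w (f ` {..<d})"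
proof -
  let ?S = "f ` {..<d}" and ?xs = "sorted_list_of_set (f ` {..<d})"
  show S: "?S \<in> pluecker_index d n"
    using assms by (auto simp: pluecker_index_def card_image)
  have xs: "set ?xs = ?S" "distinct ?xs" "length ?xs = d"
    using assms by (auto simp: card_image)
  have bij: "bij_betw ((!) ?xs) {..<d} ?S"
    using bij_betw_nth[OF xs(2), of "{..<d}" ?S] xs by simp
  define q where "q j = (if j < d then inv_into {..<d} ((!) ?xs) (f j) else j)" for j
  have q: "q j < d" "?xs ! q j = f j" if "j < d" for j
    using that bij_betw_inv_into_right[OF bij, of "f j"] inv_into_into[of "f j" "(!) ?xs" "{..<d}"] bij
    by (auto simp: q_def bij_betw_def)
  have "bij_betw q {..<d} {..<d}"
  proof (rule bij_betwI')
    show "q x = q y \<longleftrightarrow> x = y" if "x \<in> {..<d}" "y \<in> {..<d}" for x y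
      using that q assms(1) by (metis inj_on_eq_iff lessThan_iff)
    show "q x \<in> {..<d}" if "x \<in> {..<d}" for x using that q by auto
    show "\<exists>x\<in>{..<d}. y = q x" if y: "y \<in> {..<d}" for y
    proof -
      have "?xs ! y \<in> ?S" using y xs(1,3) nth_mem[of y ?xs] by simp
      then obtain x where x: "x < d" "?xs ! y = f x" by auto
      then have "q x = y"
        using q[OF x(1)] y xs(2,3) by (metis lessThan_iff nth_eq_iff_index_eq)
      then show ?thesis using x by auto
    qed
  qed
  then have perm: "q permutes {0..<d}"
    by (intro bij_imp_permutes) (auto simp: atLeast0LessThan q_def)
  have eq: "minor d w f = signof q * pluecker d n w ?S" for w :: "nat \<Rightarrow> nat \<Rightarrow> 'c"
  proof -
    let ?A = "mat d d (\<lambda>(i, j). w i (?xs ! j))"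
    have "minor d w f = det (mat d d (\<lambda>(i, j). ?A $$ (i, q j)))"
      unfolding minor_def by (rule arg_cong[of _ _ det], rule eq_matI) (use q in auto)
    also have "\<dots> = det (mat d d (\<lambda>(i, j). ?A\<^sup>T $$ (q i, j)))"
      by (subst det_transpose[symmetric, of _ d], simp, rule arg_cong[of _ _ det], rule eq_matI)
        (use q in auto)
    also have "\<dots> = signof q * det ?A\<^sup>T"
      using perm by (intro det_permute_rows) auto
    also have "det ?A\<^sup>T = det ?A" by (rule det_transpose[of _ d]) simp
    also have "det ?A = pluecker d n w ?S" using S by (simp add: pluecker_def)
    finally show ?thesis .
  qed
  show "\<exists>c\<in>{1, -1}. \<forall>w :: nat \<Rightarrow> nat \<Rightarrow> 'c::field. minor d w f = c * pluecker d n w ?S"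
    by (rule bexI[of _ "signof q"]) (auto simp: eq sign_def)
qed

lemma pluecker_eq_minor:
  assumes "S \<in> pluecker_index d n"
  shows "pluecker d n w S = minor d w (\<lambda>j. sorted_list_of_set S ! j)"
  using assms by (simp add: pluecker_def minor_def)

lemma pluecker_index_nth_less:
  assumes "S \<in> pluecker_index d n" "j < d"
  shows "sorted_list_of_set S ! j < n"
proof -
  have "finite S" "card S = d" "S \<subseteq> {..<n}"
    using assms(1) finite_subset[of S "{..<n}"] by (auto simp: pluecker_index_def)
  then have "sorted_list_of_set S ! j \<in> S" using assms(2) nth_mem[of j "sorted_list_of_set S"] by simp
  then show ?thesis using \<open>S \<subseteq> {..<n}\<close> by auto
qed

lemma minor_row_combination:
  "minor d (\<lambda>i j. \<Sum>r<d. G i r * w r j) f = det (mat d d (\<lambda>(i, j). G i j)) * minor d w f"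
proof -
  have "mat d d (\<lambda>(i, j). \<Sum>r<d. G i r * w r (f j))
    = mat d d (\<lambda>(i, j). G i j) * mat d d (\<lambda>(i, j). w i (f j))"
    by (rule eq_matI) (auto simp: scalar_prod_def atLeast0LessThan)
  then show ?thesis unfolding minor_def by (simp add: det_mult[of _ d])
qed

lemma pluecker_row_combination:
  "pluecker d n (\<lambda>i j. \<Sum>r<d. G i r * w r j) =
    (\<lambda>S. det (mat d d (\<lambda>(i, j). G i j)) * pluecker d n w S)"
proof
  fix S show "pluecker d n (\<lambda>i j. \<Sum>r<d. G i r * w r j) S =
    det (mat d d (\<lambda>(i, j). G i j)) * pluecker d n w S"
    by (cases "S \<in> pluecker_index d n")
      (simp add: pluecker_eq_minor minor_row_combination, simp add: pluecker_def)
qed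

lemma pluecker_cong:
  assumes "\<And>i j. i < d \<Longrightarrow> j < n \<Longrightarrow> w i j = w' i j"
  shows "pluecker d n w = pluecker d n w'"
proof
  fix S show "pluecker d n w S = pluecker d n w' S"
    using pluecker_index_nth_less[of S d n] assms
    by (auto simp: pluecker_def intro!: arg_cong[of _ _ det] eq_matI)
qed

text \<open>Replacing one column of a minor by an arbitrary column recovers, by cofactor expansion,
  a row combination of the matrix; its coefficients form the adjugate of the minor.\<close>

lemma minor_replace_column:
  assumes "i < d"
  shows "minor d w (s(i := j)) = (\<Sum>r<d. adj_mat (mat d d (\<lambda>(i, j). w i (s j))) $$ (i, r) * w r j)"
proof -
  let ?A = "mat d d (\<lambda>(k, l). w k (s l))"
  let ?B = "mat d d (\<lambda>(k, l). w k ((s(i := j)) l))"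
  have cof: "cofactor ?B r i = cofactor ?A r i" if "r < d" for r
    unfolding cofactor_def mat_delete_def
    by (intro arg_cong2[of _ _ _ _ times] refl arg_cong[of _ _ det] eq_matI) (use that assms in auto)
  have "minor d w (s(i := j)) = (\<Sum>r<d. ?B $$ (r, i) * cofactor ?B r i)"
    unfolding minor_def by (rule laplace_expansion_column[of _ d]) (use assms in auto)
  also have "\<dots> = (\<Sum>r<d. adj_mat ?A $$ (i, r) * w r j)"
    using assms cof by (intro sum.cong) (auto simp: adj_mat_def)
  finally show ?thesis .
qed

text \<open>A coarse Cauchy-Binet formula, with functions in place of subsets.  It shows that a matrix with a
  right inverse has a nonvanishing maximal minor.\<close>

lemma det_product_expansion:
  fixes w C :: "nat \<Rightarrow> nat \<Rightarrow> 'c::field"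
  shows "det (mat d d (\<lambda>(i, m). \<Sum>l<n. w i l * C l m))
    = (\<Sum>f\<in>{0..<d} \<rightarrow>\<^sub>E {..<n}. (\<Prod>m\<in>{0..<d}. C (f m) m) * minor d w f)"
proof -
  let ?Q = "{q. q permutes {0..<d}}"
  have det_cols: "det (mat d d (\<lambda>(i, m). a i m))
    = (\<Sum>q\<in>?Q. signof q * (\<Prod>m\<in>{0..<d}. a (q m) m))" for a :: "nat \<Rightarrow> nat \<Rightarrow> 'c"
  proof -
    have "det (mat d d (\<lambda>(i, m). a i m)) = det (mat d d (\<lambda>(m, i). a i m))"
      by (subst det_transpose[symmetric, of _ d], simp, rule arg_cong[of _ _ det], rule eq_matI) auto
    also have "\<dots> = (\<Sum>q\<in>?Q. signof q * (\<Prod>m\<in>{0..<d}. a (q m) m))"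
      by (subst det_def'[of _ d]) (auto intro!: sum.cong prod.cong simp: permutes_in_image)
    finally show ?thesis .
  qed
  have "det (mat d d (\<lambda>(i, m). \<Sum>l<n. w i l * C l m))
    = (\<Sum>q\<in>?Q. signof q * (\<Sum>f\<in>{0..<d} \<rightarrow>\<^sub>E {..<n}. \<Prod>m\<in>{0..<d}. w (q m) (f m) * C (f m) m))"
    unfolding det_cols by (subst prod_sum_PiE) auto
  also have "\<dots> = (\<Sum>f\<in>{0..<d} \<rightarrow>\<^sub>E {..<n}. \<Sum>q\<in>?Q.
      (\<Prod>m\<in>{0..<d}. C (f m) m) * (signof q * (\<Prod>m\<in>{0..<d}. w (q m) (f m))))"
    unfolding sum_distrib_left
    by (subst sum.swap) (simp add: prod.distrib mult_ac)
  also have "\<dots> = (\<Sum>f\<in>{0..<d} \<rightarrow>\<^sub>E {..<n}. (\<Prod>m\<in>{0..<d}. C (f m) m) * minor d w f)"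
    unfolding minor_def det_cols by (simp add: sum_distrib_left)
  finally show ?thesis .
qed

subsection \<open>Independent rows\<close>

lemma mem_fun_span_rows:
  fixes w :: "nat \<Rightarrow> 'i \<Rightarrow> 'c::field"
  shows "u \<in> fun_span (w ` {..<d}) \<longleftrightarrow> (\<exists>c. u = (\<lambda>j. \<Sum>i<d. c i * w i j))"
proof
  assume "u \<in> fun_span (w ` {..<d})"
  then show "\<exists>c. u = (\<lambda>j. \<Sum>i<d. c i * w i j)"
  proof (induction rule: fun_vs.span_induct_alt)
    case base
    show ?case by (rule exI[of _ "\<lambda>_. 0"]) (auto simp: fun_eq_iff)
  next
    case (step a x y)
    then obtain i c where i: "i < d" "x = w i" and c: "y = (\<lambda>j. \<Sum>i<d. c i * w i j)" by auto
    show ?case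
    proof (rule exI[of _ "\<lambda>k. (if k = i then a else 0) + c k"], rule ext)
      fix j
      have "(\<Sum>k<d. (if k = i then a else 0) * w k j) = a * w i j"
        using i by (subst sum.remove[of _ i]) auto
      then show "((\<lambda>k. a * x k) + y) j = (\<Sum>k<d. ((if k = i then a else 0) + c k) * w k j)"
        using i c by (simp add: distrib_right sum.distrib)
    qed
  qed
next
  assume "\<exists>c. u = (\<lambda>j. \<Sum>i<d. c i * w i j)"
  then obtain c where c: "u = (\<lambda>j. \<Sum>i<d. c i * w i j)" by auto
  have "u = (\<Sum>i<d. (\<lambda>j. c i * w i j))" unfolding c by (auto simp: fun_eq_iff sum_fun_apply)
  also have "\<dots> \<in> fun_span (w ` {..<d})"
    by (intro fun_vs.span_sum fun_vs.span_scale fun_vs.span_base) auto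
  finally show "u \<in> fun_span (w ` {..<d})" .
qed

definition independent_rows :: "nat \<Rightarrow> (nat \<Rightarrow> nat \<Rightarrow> 'c::field) \<Rightarrow> bool" where
  "independent_rows d w \<longleftrightarrow> (\<forall>c. (\<forall>j. (\<Sum>i<d. c i * w i j) = 0) \<longrightarrow> (\<forall>i<d. c i = 0))"

lemma independent_rows_zeroD:
  assumes "independent_rows d w" "\<And>j. (\<Sum>i<d. c i * w i j) = 0" "i < d"
  shows "c i = 0"
  using assms unfolding independent_rows_def by blast

lemma independent_rowsD:
  assumes "independent_rows d w"
  shows "inj_on w {..<d}" "\<not> fun_vs.dependent (w ` {..<d})"
proof -
  show inj: "inj_on w {..<d}"
  proof (rule inj_onI, rule ccontr)
    fix i k assume ik: "i \<in> {..<d}" "k \<in> {..<d}" "w i = w k" "i \<noteq> k"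
    let ?c = "\<lambda>l. if l = i then 1 else if l = k then - 1 else 0"
    have "(\<Sum>l<d. ?c l * w l j) = 0" for j
      using ik by (subst sum.remove[of _ i], simp, simp, subst sum.remove[of _ k]) auto
    from independent_rows_zeroD[OF assms this, of i] ik(1) show False by simp
  qed
  show "\<not> fun_vs.dependent (w ` {..<d})"
  proof
    assume "fun_vs.dependent (w ` {..<d})"
    then obtain u where u: "\<exists>v\<in>w ` {..<d}. u v \<noteq> 0" "(\<Sum>v\<in>w ` {..<d}. (\<lambda>j. u v * v j)) = 0"
      by (auto simp: fun_vs.dependent_finite)
    have "(\<Sum>i<d. u (w i) * w i j) = 0" for j
    proof -
      have "(\<Sum>i<d. u (w i) * w i j) = (\<Sum>v\<in>w ` {..<d}. u v * v j)"
        by (simp add: sum.reindex[OF inj])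
      also have "\<dots> = (\<Sum>v\<in>w ` {..<d}. (\<lambda>j. u v * v j)) j" by (simp add: sum_fun_apply)
      finally show ?thesis using u(2) by simp
    qed
    from independent_rows_zeroD[OF assms this] show False using u(1) by auto
  qed
qed

text \<open>A spanning family whose length is the dimension is a basis.\<close>

lemma fun_dim_rows_iff: "fun_dim (fun_span (w ` {..<d})) = d \<longleftrightarrow> independent_rows d w"
proof
  assume "independent_rows d w"
  then show "fun_dim (fun_span (w ` {..<d})) = d"
    using independent_rowsD by (metis fun_vs.dim_eq_card_independent fun_vs.dim_span card_image card_lessThan)
next
  assume dim: "fun_dim (fun_span (w ` {..<d})) = d"
  let ?S = "w ` {..<d}"
  obtain B where B: "B \<subseteq> ?S" "\<not> fun_vs.dependent B" "?S \<subseteq> fun_span B" "card B = fun_dim ?S"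
    using fun_vs.basis_exists[of ?S] by metis
  have "card B = d" using B dim by simp
  moreover have "card ?S \<le> d" using card_image_le[of "{..<d}" w] by simp
  ultimately have BS: "B = ?S" "card ?S = d"
    using card_subset_eq[OF _ B(1)] card_mono[OF _ B(1)] by simp_all
  then have inj: "inj_on w {..<d}" by (simp add: eq_card_imp_inj_on)
  show "independent_rows d w" unfolding independent_rows_def
  proof (intro allI impI)
    fix c i assume c: "\<forall>j. (\<Sum>i<d. c i * w i j) = 0" and i: "i < d"
    let ?u = "\<lambda>v. c (inv_into {..<d} w v)"
    have "(\<Sum>v\<in>?S. (\<lambda>j. ?u v * v j)) = 0"
    proof
      fix j
      have "(\<Sum>v\<in>?S. (\<lambda>j. ?u v * v j)) j = (\<Sum>v\<in>?S. ?u v * v j)" by (simp add: sum_fun_apply)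
      also have "\<dots> = (\<Sum>i<d. c i * w i j)" by (simp add: sum.reindex[OF inj] inv_into_f_f[OF inj])
      finally show "(\<Sum>v\<in>?S. (\<lambda>j. ?u v * v j)) j = 0 j" using c by simp
    qed
    then have "?u (w i) = 0"
      using B(2) BS(1) i by (auto simp: fun_vs.dependent_finite)
    then show "c i = 0" using i inv_into_f_f[OF inj] by simp
  qed
qed

text \<open>The columns of \<open>C\<close> are linear functionals dual to the rows of \<open>w\<close>.\<close>

lemma independent_rows_right_inverse:
  assumes "independent_rows d w" "\<And>i. i < d \<Longrightarrow> w i \<in> coord_space {..<n}"
  obtains C where "\<And>i m. i < d \<Longrightarrow> m < d \<Longrightarrow> (\<Sum>l<n. w i l * C l m) = (if i = m then 1 else 0)"
proof -
  let ?sc = "\<lambda>(c::'a) (v::nat \<Rightarrow> 'a) i. c * v i"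
  interpret vector_space_pair ?sc ?sc ..
  note ind = independent_rowsD[OF assms(1)]
  let ?g = "\<lambda>v (m::nat). if m = inv_into {..<d} w v then (1::'a) else 0"
  obtain g where g: "Vector_Spaces.linear ?sc ?sc g" "\<forall>v\<in>w ` {..<d}. g v = ?g v"
    using linear_independent_extend[OF ind(2), of ?g] by blast
  interpret g: Vector_Spaces.linear ?sc ?sc g by (rule g)
  define C where "C l = g (\<lambda>j. if j = l then 1 else 0)" for l
  show ?thesis
  proof (rule that[of C])
    fix i m assume im: "i < d" "m < d"
    have "w i = (\<Sum>l<n. (\<lambda>j. w i l * (if j = l then 1 else 0)))"
    proof
      fix j
      have "(\<Sum>l<n. w i l * (if j = l then 1 else 0)) = (if j < n then w i j else 0)"
        by (simp add: if_distrib cong: if_cong)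
      then show "w i j = (\<Sum>l<n. (\<lambda>j. w i l * (if j = l then 1 else 0))) j"
        using assms(2)[OF im(1)] by (simp add: sum_fun_apply coord_space_def)
    qed
    then have "g (w i) = g (\<Sum>l<n. (\<lambda>j. w i l * (if j = l then 1 else 0)))" by (rule arg_cong)
    also have "\<dots> = (\<Sum>l<n. (\<lambda>m. w i l * C l m))" by (simp only: g.sum g.scale C_def)
    finally have "g (w i) m = (\<Sum>l<n. w i l * C l m)" by (simp add: sum_fun_apply)
    moreover have "g (w i) m = (if i = m then 1 else 0)"
      using g(2) im inv_into_f_f[OF ind(1)] by auto
    ultimately show "(\<Sum>l<n. w i l * C l m) = (if i = m then 1 else 0)" by simp
  qed
qed

lemma independent_rows_nonzero_minor:
  assumes "independent_rows d w" "\<And>i. i < d \<Longrightarrow> w i \<in> coord_space {..<n}"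
  obtains s where "\<And>j. j < d \<Longrightarrow> s j < n" "minor d w s \<noteq> 0"
proof -
  obtain C where C: "\<And>i m. i < d \<Longrightarrow> m < d \<Longrightarrow> (\<Sum>l<n. w i l * C l m) = (if i = m then 1 else 0)"
    using independent_rows_right_inverse[OF assms] by metis
  have "mat d d (\<lambda>(i, m). \<Sum>l<n. w i l * C l m) = 1\<^sub>m d"
    by (rule eq_matI) (auto simp: C)
  then have "det (mat d d (\<lambda>(i, m). \<Sum>l<n. w i l * C l m)) \<noteq> 0" by simp
  then obtain f where f: "f \<in> {0..<d} \<rightarrow>\<^sub>E {..<n}" "minor d w f \<noteq> 0"
    unfolding det_product_expansion by (metis (no_types, lifting) mult_zero_right sum.neutral)
  show ?thesis by (rule that[of f]) (use f in auto)
qed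

lemma independent_rows_pluecker_nonzero:
  assumes "independent_rows d w" "\<And>i. i < d \<Longrightarrow> w i \<in> coord_space {..<n}"
  shows "pluecker d n w \<noteq> (\<lambda>_. 0)"
proof -
  obtain s where s: "\<And>j. j < d \<Longrightarrow> s j < n" "minor d w s \<noteq> 0"
    using independent_rows_nonzero_minor[OF assms] by metis
  then have inj: "inj_on s {..<d}" using minor_not_inj by blast
  obtain c where c: "\<forall>w :: nat \<Rightarrow> nat \<Rightarrow> 'a. minor d w s = c * pluecker d n w (s ` {..<d})"
    using minor_eq_pluecker(2)[OF inj, of n] s(1) by blast
  have "pluecker d n w (s ` {..<d}) \<noteq> 0" using c s(2) by auto
  then show ?thesis by (metis (no_types))
qed

lemma pluecker_mem_coord_space: "pluecker d n w \<in> coord_space (pluecker_index d n)"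
  by (auto simp: coord_space_def pluecker_def)

section \<open>A split algebra with a maximal torus\<close>

text \<open>The linear algebra shared by the two varieties.  The matrix \<open>E l\<close> is the image of the \<open>l\<close>-th basis
  vector of the split algebra, and \<open>sg l m\<close> is the image of the \<open>l\<close>-th basis vector of the field \<open>L\<close>
  under its \<open>m\<close>-th embedding.  In matrix form \<open>L\<close> is the diagonal torus, \<open>x\<close> is the diagonal matrix
  with entries \<open>lam m\<close>, and \<open>y\<close> is \<open>\<beta>\<close> times the cyclic shift.

  The arrays with entries in \<open>F\<close> are the linear maps that have to be defined over the ground field:
  \<open>dg\<close> takes \<open>u\<close> to its diagonal part, read as an element of \<open>L\<close>; \<open>dy\<close> takes \<open>u\<close> to the diagonal part
  of \<open>y u\<close>; \<open>unit\<close> is the element 1 of \<open>L\<close>; \<open>tw\<close> is the bilinear map \<open>(z, u) \<mapsto> y\<^sup>-\<^sup>1 z u\<close>; and \<open>xv j\<close>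
  is the element \<open>x\<^sup>j\<close>.  The multiplication of the algebra in coordinates is \<open>mulA\<close>.\<close>

locale cyclic_data = coefficient_ring F for F :: "'c::field_char_0 set" +
  fixes p n :: nat and \<beta> :: 'c
    and E :: "nat \<Rightarrow> nat \<Rightarrow> nat \<Rightarrow> 'c"
    and sg :: "nat \<Rightarrow> nat \<Rightarrow> 'c"
    and mulA :: "(nat \<Rightarrow> 'c) \<Rightarrow> (nat \<Rightarrow> 'c) \<Rightarrow> nat \<Rightarrow> 'c"
    and dg dy :: "nat \<Rightarrow> nat \<Rightarrow> 'c"
    and unit :: "nat \<Rightarrow> 'c"
    and tw :: "nat \<Rightarrow> nat \<Rightarrow> nat \<Rightarrow> 'c"
    and xv :: "nat \<Rightarrow> nat \<Rightarrow> 'c"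
    and lam :: "nat \<Rightarrow> 'c"
  assumes p_pos: "0 < p" and \<beta>_nz: "\<beta> \<noteq> 0"
    and E_inj: "\<And>u. u \<in> coord_space {..<n} \<Longrightarrow>
      (\<And>i k. i < p \<Longrightarrow> k < p \<Longrightarrow> (\<Sum>l<n. u l * E l i k) = 0) \<Longrightarrow> u = (\<lambda>_. 0)"
    and E_surj: "\<And>M. \<exists>u\<in>coord_space {..<n}. \<forall>i<p. \<forall>k<p. (\<Sum>l<n. u l * E l i k) = M i k"
    and mulA_coord: "\<And>u v. u \<in> coord_space {..<n} \<Longrightarrow> v \<in> coord_space {..<n} \<Longrightarrow>
      mulA u v \<in> coord_space {..<n}"
    and E_mulA: "\<And>u v i k. u \<in> coord_space {..<n} \<Longrightarrow> v \<in> coord_space {..<n} \<Longrightarrow> i < p \<Longrightarrow> k < p \<Longrightarrow>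
      (\<Sum>l<n. mulA u v l * E l i k) = (\<Sum>m<p. (\<Sum>l<n. u l * E l i m) * (\<Sum>l<n. v l * E l m k))"
    and sg_inj: "\<And>z. z \<in> coord_space {..<p} \<Longrightarrow>
      (\<And>m. m < p \<Longrightarrow> (\<Sum>l<p. z l * sg l m) = 0) \<Longrightarrow> z = (\<lambda>_. 0)"
    and sg_surj: "\<And>t. \<exists>z\<in>coord_space {..<p}. \<forall>m<p. (\<Sum>l<p. z l * sg l m) = t m"
    and dg_mem: "\<And>t l. t < n \<Longrightarrow> l < p \<Longrightarrow> dg t l \<in> F"
    and dg: "\<And>t m. t < n \<Longrightarrow> m < p \<Longrightarrow> (\<Sum>l<p. dg t l * sg l m) = E t m m"
    and dy_mem: "\<And>t l. t < n \<Longrightarrow> l < p \<Longrightarrow> dy t l \<in> F"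
    and dy: "\<And>t m. t < n \<Longrightarrow> m < p \<Longrightarrow> (\<Sum>l<p. dy t l * sg l m) = \<beta> * E t (Suc m mod p) m"
    and unit_mem: "\<And>l. l < p \<Longrightarrow> unit l \<in> F"
    and unit: "\<And>m. m < p \<Longrightarrow> (\<Sum>l<p. unit l * sg l m) = 1"
    and tw_mem: "\<And>l j t. l < p \<Longrightarrow> j < n \<Longrightarrow> t < n \<Longrightarrow> tw l j t \<in> F"
    and tw: "\<And>l j m k. l < p \<Longrightarrow> j < n \<Longrightarrow> m < p \<Longrightarrow> k < p \<Longrightarrow>
      (\<Sum>t<n. tw l j t * E t (Suc m mod p) k) = sg l m * E j m k / \<beta>"
    and xv_mem: "\<And>j t. j < p \<Longrightarrow> t < n \<Longrightarrow> xv j t \<in> F"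
    and xv: "\<And>j m k. j < p \<Longrightarrow> m < p \<Longrightarrow> k < p \<Longrightarrow>
      (\<Sum>t<n. xv j t * E t m k) = (if m = k then lam k ^ j else 0)"
    and lam_inj: "inj_on lam {..<p}"
begin

definition Phi :: "(nat \<Rightarrow> 'c) \<Rightarrow> nat \<Rightarrow> nat \<Rightarrow> 'c" where
  "Phi u i k = (\<Sum>l<n. u l * E l i k)"

definition sig :: "(nat \<Rightarrow> 'c) \<Rightarrow> nat \<Rightarrow> 'c" where
  "sig z m = (\<Sum>l<p. z l * sg l m)"

definition norm_locus :: "(nat option \<Rightarrow> 'c) set set" where
  "norm_locus = {line_of (case_option 1 z) | z. z \<in> coord_space {..<p} \<and> (\<Prod>m<p. sig z m) = \<beta> ^ p}"

definition ideal_variety :: "(nat set \<Rightarrow> 'c) set set" where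
  "ideal_variety = {line_of (pluecker p n w) | w. w ` {..<p} \<subseteq> coord_space {..<n} \<and>
     fun_dim (fun_span (w ` {..<p})) = p \<and>
     (\<forall>u\<in>fun_span (w ` {..<p}). \<forall>v\<in>coord_space {..<n}. mulA u v \<in> fun_span (w ` {..<p}))}"

lemma Phi_add: "Phi (\<lambda>l. u l + v l) i k = Phi u i k + Phi v i k"
  by (simp add: Phi_def distrib_right sum.distrib)

lemma Phi_scale: "Phi (\<lambda>l. a * v l) i k = a * Phi v i k"
  by (simp add: Phi_def mult.assoc sum_distrib_left)

lemma Phi_diff: "Phi (\<lambda>l. u l - v l) i k = Phi u i k - Phi v i k"
  by (simp add: Phi_def left_diff_distrib sum_subtractf)

lemma Phi_sum: "Phi (\<lambda>l. \<Sum>r\<in>A. c r * w r l) i k = (\<Sum>r\<in>A. c r * Phi (w r) i k)"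
  unfolding Phi_def sum_distrib_left sum_distrib_right
  by (subst sum.swap) (simp add: mult.assoc)

lemma Phi_eqD:
  assumes "u \<in> coord_space {..<n}" "v \<in> coord_space {..<n}"
    "\<And>i k. i < p \<Longrightarrow> k < p \<Longrightarrow> Phi u i k = Phi v i k"
  shows "u = v"
proof -
  have "(\<lambda>l. u l - v l) = (\<lambda>_. 0)"
    by (rule E_inj) (use assms Phi_diff in \<open>auto simp: coord_space_def Phi_def\<close>)
  then show ?thesis by (auto simp: fun_eq_iff)
qed

lemma sig_eqD:
  assumes "u \<in> coord_space {..<p}" "v \<in> coord_space {..<p}"
    "\<And>m. m < p \<Longrightarrow> sig u m = sig v m"
  shows "u = v"
proof -
  have "(\<lambda>l. u l - v l) = (\<lambda>_. 0)"
    by (rule sg_inj)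
      (use assms in \<open>auto simp: coord_space_def sig_def left_diff_distrib sum_subtractf\<close>)
  then show ?thesis by (auto simp: fun_eq_iff)
qed

lemma Phi_mulA:
  assumes "u \<in> coord_space {..<n}" "v \<in> coord_space {..<n}" "i < p" "k < p"
  shows "Phi (mulA u v) i k = (\<Sum>m<p. Phi u i m * Phi v m k)"
  using E_mulA[OF assms] by (simp add: Phi_def)

lemma row_combination_coord:
  assumes "\<And>r. r < d \<Longrightarrow> w r \<in> coord_space I"
  shows "(\<lambda>l. \<Sum>r<d. c r * w r l) \<in> coord_space I"
  using assms by (auto simp: coord_space_def)

subsection \<open>Right ideals of dimension \<open>p\<close>\<close>

text \<open>The rows stand for the matrices \<open>v s\<^sub>i\<^sup>T\<close>.  They lie in the right ideal of all matrices whose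
  columns are multiples of \<open>v\<close>, and they are a basis of it as soon as the \<open>s\<^sub>i\<close> are a basis.\<close>

definition rank_one :: "(nat \<Rightarrow> 'c) \<Rightarrow> (nat \<Rightarrow> nat \<Rightarrow> 'c) \<Rightarrow> (nat \<Rightarrow> nat \<Rightarrow> 'c) \<Rightarrow> bool" where
  "rank_one v s w \<longleftrightarrow> (\<forall>i<p. w i \<in> coord_space {..<n} \<and>
     (\<forall>m<p. \<forall>k<p. Phi (w i) m k = v m * s i k))"

lemma rank_oneD:
  assumes "rank_one v s w" "i < p"
  shows "w i \<in> coord_space {..<n}" "\<And>m k. m < p \<Longrightarrow> k < p \<Longrightarrow> Phi (w i) m k = v m * s i k"
  using assms by (auto simp: rank_one_def)

definition square_basis :: "(nat \<Rightarrow> nat \<Rightarrow> 'c) \<Rightarrow> bool" where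
  "square_basis s \<longleftrightarrow> (\<forall>c. (\<forall>k<p. (\<Sum>i<p. c i * s i k) = 0) \<longrightarrow> (\<forall>i<p. c i = 0))"

lemma square_basis_zeroD:
  assumes "square_basis s" "\<And>k. k < p \<Longrightarrow> (\<Sum>i<p. c i * s i k) = 0" "i < p"
  shows "c i = 0"
  using assms unfolding square_basis_def by blast

lemma square_basis_inverse:
  assumes "square_basis s"
  obtains C where
    "\<And>i k. i < p \<Longrightarrow> k < p \<Longrightarrow> (\<Sum>l<p. s i l * C l k) = (if i = k then 1 else 0)"
    "\<And>i k. i < p \<Longrightarrow> k < p \<Longrightarrow> (\<Sum>l<p. C i l * s l k) = (if i = k then 1 else 0)"
proof -
  let ?s = "\<lambda>i k. if k < p then s i k else 0"
  have ind: "independent_rows p ?s"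
    unfolding independent_rows_def
  proof (intro allI impI)
    fix c i assume c: "\<forall>j. (\<Sum>i<p. c i * (if j < p then s i j else 0)) = 0" and i: "i < p"
    show "c i = 0"
    proof (rule square_basis_zeroD[OF assms _ i])
      fix k assume "k < p"
      then show "(\<Sum>i<p. c i * s i k) = 0" using c[THEN spec, of k] by simp
    qed
  qed
  obtain C where C: "\<And>i m. i < p \<Longrightarrow> m < p \<Longrightarrow> (\<Sum>l<p. ?s i l * C l m) = (if i = m then 1 else 0)"
    by (rule independent_rows_right_inverse[OF ind, of p]) (auto simp: coord_space_def)
  have C': "(\<Sum>l<p. s i l * C l k) = (if i = k then 1 else 0)" if "i < p" "k < p" for i k
    using C[OF that] by simp
  show ?thesis
    by (rule that[OF C' left_inverse_imp_right_inverse[of p s C]]) (auto simp: C')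
qed

lemma square_basis_det:
  assumes "square_basis s" shows "det (mat p p (\<lambda>(i, k). s i k)) \<noteq> 0"
proof -
  obtain C where C: "\<And>i k. i < p \<Longrightarrow> k < p \<Longrightarrow> (\<Sum>l<p. s i l * C l k) = (if i = k then 1 else 0)"
    by (rule square_basis_inverse[OF assms]) blast
  have "mat p p (\<lambda>(i, k). s i k) * mat p p (\<lambda>(i, k). C i k) = 1\<^sub>m p"
    by (rule eq_matI) (auto simp: scalar_prod_def atLeast0LessThan C)
  then have "det (mat p p (\<lambda>(i, k). s i k)) * det (mat p p (\<lambda>(i, k). C i k)) = 1"
    by (metis det_mult det_one mat_carrier)
  then show ?thesis by auto
qed

lemma rank_one_independent:
  assumes "rank_one v s w" "square_basis s" "m < p" "v m \<noteq> 0"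
  shows "independent_rows p w"
  unfolding independent_rows_def
proof (intro allI impI)
  fix c i assume c: "\<forall>j. (\<Sum>i<p. c i * w i j) = 0" and i: "i < p"
  show "c i = 0"
  proof (rule square_basis_zeroD[OF assms(2) _ i])
    fix k assume k: "k < p"
    have "v m * (\<Sum>i<p. c i * s i k) = (\<Sum>i<p. c i * Phi (w i) m k)"
      unfolding sum_distrib_left using rank_oneD[OF assms(1)] assms(3) k
      by (intro sum.cong) auto
    also have "\<dots> = Phi (\<lambda>_. 0) m k" using c by (simp flip: Phi_sum)
    also have "\<dots> = 0" by (simp add: Phi_def)
    finally show "(\<Sum>i<p. c i * s i k) = 0" using assms(4) by simp
  qed
qed

text \<open>Any element of the ideal is some \<open>v t\<^sup>T\<close>, and \<open>t\<close> is a combination of the basis \<open>s\<close>.\<close>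

lemma rank_one_row_change:
  assumes "rank_one v s w" "square_basis s" "u \<in> coord_space {..<n}"
    "\<And>m k. m < p \<Longrightarrow> k < p \<Longrightarrow> Phi u m k = v m * t k"
  shows "\<exists>c. u = (\<lambda>l. \<Sum>i<p. c i * w i l)"
proof -
  obtain C where C: "\<And>i k. i < p \<Longrightarrow> k < p \<Longrightarrow> (\<Sum>l<p. C i l * s l k) = (if i = k then 1 else 0)"
    by (rule square_basis_inverse[OF assms(2)]) blast
  let ?c = "\<lambda>i. \<Sum>k<p. t k * C k i"
  have "u = (\<lambda>l. \<Sum>i<p. ?c i * w i l)"
  proof (rule Phi_eqD[OF assms(3) row_combination_coord])
    show "w r \<in> coord_space {..<n}" if "r < p" for r using rank_oneD(1)[OF assms(1) that] .
    fix m k assume mk: "m < p" "k < p"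
    have "Phi (\<lambda>l. \<Sum>i<p. ?c i * w i l) m k = (\<Sum>i<p. ?c i * (v m * s i k))"
      unfolding Phi_sum using rank_oneD(2)[OF assms(1)] mk by (intro sum.cong) auto
    also have "\<dots> = v m * (\<Sum>k'<p. t k' * (\<Sum>i<p. C k' i * s i k))"
      unfolding sum_distrib_left sum_distrib_right
      by (subst sum.swap) (simp add: mult_ac)
    also have "(\<Sum>k'<p. t k' * (\<Sum>i<p. C k' i * s i k)) = (\<Sum>k'<p. if k' = k then t k else 0)"
      using mk by (intro sum.cong) (auto simp: C)
    also have "\<dots> = t k" using mk by simp
    finally show "Phi u m k = Phi (\<lambda>l. \<Sum>i<p. ?c i * w i l) m k" using assms(4)[OF mk] by simp
  qed
  then show ?thesis by (rule exI[of _ ?c])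
qed

text \<open>Right multiplication takes \<open>v t\<^sup>T\<close> to another matrix of the same shape.\<close>

lemma rank_one_mem_ideal_variety:
  assumes "rank_one v s w" "square_basis s" "m < p" "v m \<noteq> 0"
  shows "line_of (pluecker p n w) \<in> ideal_variety"
proof -
  have ind: "fun_dim (fun_span (w ` {..<p})) = p"
    by (rule fun_dim_rows_iff[THEN iffD2, OF rank_one_independent[OF assms]])
  have "mulA u x \<in> fun_span (w ` {..<p})" if u: "u \<in> fun_span (w ` {..<p})" and x: "x \<in> coord_space {..<n}" for u x
  proof -
    obtain c where c: "u = (\<lambda>j. \<Sum>i<p. c i * w i j)" using u by (auto simp: mem_fun_span_rows)
    have uc: "u \<in> coord_space {..<n}"
      unfolding c by (rule row_combination_coord) (rule rank_oneD(1)[OF assms(1)])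
    have Phi_u: "Phi u m k = v m * (\<Sum>i<p. c i * s i k)" if "m < p" "k < p" for m k
      unfolding c Phi_sum sum_distrib_left using that rank_oneD(2)[OF assms(1)]
      by (intro sum.cong) auto
    have "\<exists>c. mulA u x = (\<lambda>l. \<Sum>i<p. c i * w i l)"
    proof (rule rank_one_row_change[OF assms(1,2) mulA_coord[OF uc x]])
      fix m k assume mk: "m < p" "k < p"
      show "Phi (mulA u x) m k = v m * (\<Sum>k'<p. (\<Sum>i<p. c i * s i k') * Phi x k' k)"
        unfolding Phi_mulA[OF uc x mk] sum_distrib_left[of "v m"]
        by (intro sum.cong) (use mk in \<open>auto simp: Phi_u mult.assoc\<close>)
    qed
    then show ?thesis by (simp add: mem_fun_span_rows)
  qed
  then show ?thesis
    using ind rank_oneD(1)[OF assms(1)] by (auto simp: ideal_variety_def)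
qed

text \<open>Two bases of one ideal differ by an invertible matrix, whose determinant scales the Pluecker
  coordinates.\<close>

lemma rank_one_same_line:
  assumes "rank_one v s w" "square_basis s" "rank_one v s' w'" "square_basis s'" "m < p" "v m \<noteq> 0"
  shows "line_of (pluecker p n w') = line_of (pluecker p n w)"
proof -
  have "\<exists>c. w' i = (\<lambda>l. \<Sum>r<p. c r * w r l)" if "i < p" for i
    by (rule rank_one_row_change[OF assms(1,2)]) (use rank_oneD[OF assms(3) that] in auto)
  then obtain G where G: "\<And>i. i < p \<Longrightarrow> w' i = (\<lambda>l. \<Sum>r<p. G i r * w r l)" by metis
  have "pluecker p n w' = pluecker p n (\<lambda>i l. \<Sum>r<p. G i r * w r l)"
    by (rule pluecker_cong) (simp add: G)
  then have eq: "pluecker p n w' = (\<lambda>S. det (mat p p (\<lambda>(i, j). G i j)) * pluecker p n w S)"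
    by (simp add: pluecker_row_combination)
  moreover have "pluecker p n w' \<noteq> (\<lambda>_. 0)"
    using rank_one_independent[OF assms(3-6)] rank_oneD(1)[OF assms(3)]
    by (intro independent_rows_pluecker_nonzero) auto
  ultimately have "det (mat p p (\<lambda>(i, j). G i j)) \<noteq> 0" by auto
  with eq show ?thesis by (simp add: line_of_scale)
qed

text \<open>A right ideal of dimension \<open>p\<close> contains a nonzero matrix; let \<open>v\<close> be a nonzero column of it.
  Multiplying by matrix units from the right puts \<open>v\<close> into any chosen column and 0 elsewhere.  The
  \<open>p\<close> matrices obtained are independent, so by dimension they span the ideal.\<close>

lemma ideal_variety_rank_one:
  assumes "l \<in> ideal_variety"
  obtains v s w m where "l = line_of (pluecker p n w)" "rank_one v s w" "square_basis s" "m < p" "v m \<noteq> 0"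
proof -
  obtain w where l: "l = line_of (pluecker p n w)" and wc': "w ` {..<p} \<subseteq> coord_space {..<n}"
    and dim: "fun_dim (fun_span (w ` {..<p})) = p"
    and ideal: "\<forall>u\<in>fun_span (w ` {..<p}). \<forall>x\<in>coord_space {..<n}. mulA u x \<in> fun_span (w ` {..<p})"
    using assms unfolding ideal_variety_def mem_Collect_eq by (elim exE conjE)
  have wc: "\<And>i. i < p \<Longrightarrow> w i \<in> coord_space {..<n}" using wc' by blast
  have ind: "independent_rows p w" using dim by (rule fun_dim_rows_iff[THEN iffD1])
  have w0: "w 0 \<in> fun_span (w ` {..<p})" by (rule fun_vs.span_base) (use p_pos in auto)
  have "w 0 \<noteq> (\<lambda>_. 0)"
  proof
    assume "w 0 = (\<lambda>_. 0)"
    then have "\<And>j. (\<Sum>i<p. (if i = 0 then 1 else 0) * w i j) = 0"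
      by (auto intro!: sum.neutral simp: if_distrib)
    then show False using independent_rows_zeroD[OF ind _ p_pos, of "\<lambda>i. if i = 0 then 1 else 0"] by simp
  qed
  then obtain m0 k0 where mk0: "m0 < p" "k0 < p" "Phi (w 0) m0 k0 \<noteq> 0"
    using E_inj[OF wc[OF p_pos]] unfolding Phi_def by blast
  define v where "v m = Phi (w 0) m k0" for m
  have "\<exists>G. \<forall>m<p. \<forall>k'<p. Phi (\<lambda>l. \<Sum>r<p. G r * w r l) m k' = (if k' = k then v m else 0)"
    if k: "k < p" for k
  proof -
    obtain x where x: "x \<in> coord_space {..<n}"
      "\<And>i k'. i < p \<Longrightarrow> k' < p \<Longrightarrow> Phi x i k' = (if i = k0 \<and> k' = k then 1 else 0)"
      using E_surj[of "\<lambda>i k'. if i = k0 \<and> k' = k then 1 else 0"] unfolding Phi_def by blast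
    have "mulA (w 0) x \<in> fun_span (w ` {..<p})" using ideal w0 x(1) by blast
    then obtain G where G: "mulA (w 0) x = (\<lambda>l. \<Sum>r<p. G r * w r l)" by (auto simp: mem_fun_span_rows)
    have "Phi (mulA (w 0) x) m k' = (if k' = k then v m else 0)" if "m < p" "k' < p" for m k'
    proof -
      have "Phi (mulA (w 0) x) m k' = (\<Sum>i<p. if i = k0 then (if k' = k then Phi (w 0) m i else 0) else 0)"
        unfolding Phi_mulA[OF wc[OF p_pos] x(1) that] by (rule sum.cong) (use that x(2) in auto)
      then show ?thesis using mk0 by (simp add: v_def)
    qed
    then show ?thesis using G by (intro exI[of _ G]) simp
  qed
  then obtain G where G: "\<And>k m k'. k < p \<Longrightarrow> m < p \<Longrightarrow> k' < p \<Longrightarrow>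
    Phi (\<lambda>l. \<Sum>r<p. G k r * w r l) m k' = (if k' = k then v m else 0)" by metis
  have sqG: "square_basis G"
    unfolding square_basis_def
  proof (intro allI impI)
    fix c i assume c: "\<forall>k<p. (\<Sum>i<p. c i * G i k) = 0" and i: "i < p"
    have "(\<Sum>k<p. c k * Phi (\<lambda>l. \<Sum>r<p. G k r * w r l) m0 i) = (\<Sum>k<p. if k = i then c i * v m0 else 0)"
      by (rule sum.cong) (use G mk0 i in auto)
    also have "\<dots> = c i * v m0" using i by simp
    also have "(\<Sum>k<p. c k * Phi (\<lambda>l. \<Sum>r<p. G k r * w r l) m0 i)
      = (\<Sum>r<p. (\<Sum>k<p. c k * G k r) * Phi (w r) m0 i)"
      unfolding Phi_sum sum_distrib_left sum_distrib_right by (subst sum.swap) (simp add: mult.assoc)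
    also have "\<dots> = 0" using c by simp
    finally show "c i = 0" using mk0(3) by (simp add: v_def)
  qed
  obtain C where C: "\<And>i k. i < p \<Longrightarrow> k < p \<Longrightarrow> (\<Sum>l<p. C i l * G l k) = (if i = k then 1 else 0)"
    by (rule square_basis_inverse[OF sqG]) blast
  have CP: "Phi (w i) m k = v m * C i k" if "i < p" "m < p" "k < p" for i m k
  proof -
    have "Phi (w i) m k = (\<Sum>r<p. (if i = r then 1 else 0) * Phi (w r) m k)"
      using that by (simp add: if_distrib[of "\<lambda>x. x * _"] cong: if_cong)
    also have "\<dots> = (\<Sum>r<p. (\<Sum>l<p. C i l * G l r) * Phi (w r) m k)"
      by (rule sum.cong) (use that in \<open>auto simp: C\<close>)
    also have "\<dots> = (\<Sum>l<p. C i l * Phi (\<lambda>j. \<Sum>r<p. G l r * w r j) m k)"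
      unfolding Phi_sum sum_distrib_left sum_distrib_right by (subst sum.swap) (simp add: mult.assoc)
    also have "\<dots> = (\<Sum>l<p. if l = k then C i k * v m else 0)"
      by (rule sum.cong) (use that G in auto)
    finally show ?thesis using that by simp
  qed
  have r1: "rank_one v C w" using wc CP by (auto simp: rank_one_def)
  have sqC: "square_basis C"
    unfolding square_basis_def
  proof (intro allI impI)
    fix c i assume c: "\<forall>k<p. (\<Sum>i<p. c i * C i k) = 0" and i: "i < p"
    have "(\<lambda>j. \<Sum>i<p. c i * w i j) = (\<lambda>_. 0)"
    proof (rule Phi_eqD[OF row_combination_coord])
      show "(\<lambda>_. 0) \<in> coord_space {..<n}" by (auto simp: coord_space_def)
      fix m k assume mk: "m < p" "k < p"
      have "Phi (\<lambda>j. \<Sum>i<p. c i * w i j) m k = v m * (\<Sum>i<p. c i * C i k)"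
        unfolding Phi_sum sum_distrib_left by (rule sum.cong) (use mk CP in auto)
      then show "Phi (\<lambda>j. \<Sum>i<p. c i * w i j) m k = Phi (\<lambda>_. 0) m k"
        using c mk by (simp add: Phi_def)
    qed (use wc in auto)
    then have "(\<Sum>i<p. c i * w i j) = 0" for j by (simp add: fun_eq_iff)
    from independent_rows_zeroD[OF ind this i] show "c i = 0" .
  qed
  show ?thesis by (rule that[OF l r1 sqC mk0(1)]) (use mk0(3) in \<open>simp add: v_def\<close>)
qed

end

section \<open>The norm hypersurface and the torus orbit\<close>

lemma line_of_eq_nonzero:
  assumes "line_of u = line_of v" "u \<noteq> (\<lambda>_. 0)" shows "v \<noteq> (\<lambda>_. 0)"
proof
  assume "v = (\<lambda>_. 0)"
  then have "line_of v = {\<lambda>_. 0}" by (auto simp: line_of_def)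
  then show False using assms self_mem_line_of[of u] by simp
qed

context cyclic_data begin

text \<open>This is \<open>y v = z v\<close>, together with the condition that \<open>v\<close> lies in the open torus orbit.\<close>

definition eigenvector :: "(nat \<Rightarrow> 'c) \<Rightarrow> (nat \<Rightarrow> 'c) \<Rightarrow> bool" where
  "eigenvector z v \<longleftrightarrow> (\<forall>m<p. v m \<noteq> 0 \<and> \<beta> * v (Suc m mod p) = sig z m * v m)"

text \<open>The recursion \<open>v\<^sub>m\<^sub>+\<^sub>1 = z\<^sub>m v\<^sub>m / \<beta>\<close> closes up after \<open>p\<close> steps precisely because \<open>z\<close> has norm \<open>\<beta>\<^sup>p\<close>.\<close>

lemma eigenvector_exists:
  assumes "(\<Prod>m<p. sig z m) = \<beta> ^ p"
  shows "eigenvector z (\<lambda>m. (\<Prod>i<m. sig z i) / \<beta> ^ m)" (is "eigenvector z ?v")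
  unfolding eigenvector_def
proof (intro allI impI conjI)
  fix m assume m: "m < p"
  have "(\<Prod>m<p. sig z m) \<noteq> 0" using assms \<beta>_nz by simp
  then have nz: "sig z i \<noteq> 0" if "i < p" for i using that by auto
  show "?v m \<noteq> 0" using nz m \<beta>_nz by auto
  show "\<beta> * ?v (Suc m mod p) = sig z m * ?v m"
  proof (cases "Suc m < p")
    case True
    then show ?thesis using \<beta>_nz by (simp add: field_simps)
  next
    case False
    with m have p: "p = Suc m" by simp
    have "sig z m * (\<Prod>i<m. sig z i) = \<beta> * \<beta> ^ m"
      using assms unfolding p by (simp add: mult.commute)
    then show ?thesis using \<beta>_nz p by (simp add: field_simps)
  qed
qed

lemma bij_betw_Suc_mod: "bij_betw (\<lambda>m. Suc m mod p) {..<p} {..<p}"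
proof -
  have "inj_on (\<lambda>m. Suc m mod p) {..<p}"
    by (rule inj_onI) (auto simp: mod_Suc split: if_splits)
  moreover have "(\<lambda>m. Suc m mod p) ` {..<p} \<subseteq> {..<p}" using p_pos by auto
  ultimately show ?thesis by (simp add: bij_betw_def endo_inj_surj)
qed

text \<open>The quotients \<open>\<beta> v\<^sub>m\<^sub>+\<^sub>1 / v\<^sub>m\<close> have product \<open>\<beta>\<^sup>p\<close>, since the shift permutes the factors.\<close>

lemma eigenvector_for:
  assumes "\<And>m. m < p \<Longrightarrow> v m \<noteq> 0"
  obtains z where "z \<in> coord_space {..<p}" "(\<Prod>m<p. sig z m) = \<beta> ^ p" "eigenvector z v"
proof -
  obtain z where z: "z \<in> coord_space {..<p}" "\<And>m. m < p \<Longrightarrow> sig z m = \<beta> * v (Suc m mod p) / v m"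
    using sg_surj[of "\<lambda>m. \<beta> * v (Suc m mod p) / v m"] unfolding sig_def by blast
  have "(\<Prod>m<p. sig z m) = (\<Prod>m<p. \<beta> * (v (Suc m mod p) / v m))"
    by (rule prod.cong) (use z in auto)
  also have "\<dots> = \<beta> ^ p * ((\<Prod>m<p. v (Suc m mod p)) / (\<Prod>m<p. v m))"
    by (simp add: prod.distrib prod_dividef)
  also have "(\<Prod>m<p. v (Suc m mod p)) = (\<Prod>m<p. v m)"
    by (rule prod.reindex_bij_betw[OF bij_betw_Suc_mod])
  also have "(\<Prod>m<p. v m) / (\<Prod>m<p. v m) = 1" using assms by simp
  finally show ?thesis using that[OF z(1)] z(2) assms by (auto simp: eigenvector_def)
qed

subsection \<open>A basis of the ideal given by forms\<close>

text \<open>The coordinates of \<open>(y\<^sup>-\<^sup>1 z)\<^sup>r x\<^sup>j\<close>.\<close>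

primrec power_term :: "nat \<Rightarrow> nat \<Rightarrow> (nat \<Rightarrow> 'c) \<Rightarrow> nat \<Rightarrow> 'c" where
  "power_term 0 j z = (\<lambda>t. if t < n then xv j t else 0)"
| "power_term (Suc r) j z = (\<lambda>t. if t < n then
     \<Sum>l<p. \<Sum>i<n. z l * power_term r j z i * tw l i t else 0)"

text \<open>If \<open>N(z) = b\<close> then \<open>w = y\<^sup>-\<^sup>1 z\<close> satisfies \<open>w\<^sup>p = 1\<close>, so \<open>1 + w + \<dots> + w\<^sup>p\<^sup>-\<^sup>1\<close> generates the right ideal
  of the elements \<open>u\<close> with \<open>w u = u\<close>, that is, \<open>y u = z u\<close>.  Here this generator is multiplied by
  \<open>x\<^sup>j\<close> and made homogeneous of degree \<open>p - 1\<close> by the additional coordinate \<open>None\<close>.  The inverse is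
  put on \<open>y\<close> because \<open>y\<^sup>-\<^sup>1\<close> is defined over the ground field, whereas \<open>z\<^sup>-\<^sup>1\<close> is not polynomial in \<open>z\<close>.\<close>

definition Q :: "nat \<Rightarrow> (nat option \<Rightarrow> 'c) \<Rightarrow> nat \<Rightarrow> 'c" where
  "Q j h t = (\<Sum>r<p. h None ^ (p - 1 - r) * power_term r j (\<lambda>i. h (Some i)) t)"

lemma form_power_term:
  assumes "j < p"
  shows "form F (affine_index p) r (\<lambda>h. power_term r j (\<lambda>i. h (Some i)) t)"
proof (induction r arbitrary: t)
  case 0
  show ?case using assms by (cases "t < n") (auto intro: form_const xv_mem form_zero)
next
  case (Suc r)
  show ?case
  proof (cases "t < n")
    case True
    have "form F (affine_index p) (1 + r + 0)
      (\<lambda>h. h (Some l) * power_term r j (\<lambda>i. h (Some i)) i * tw l i t)" if "l < p" "i < n" for l i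
      by (intro form_mult form_coord form_const tw_mem Suc) (use that True in auto)
    then have "form F (affine_index p) (Suc r)
      (\<lambda>h. \<Sum>l<p. \<Sum>i<n. h (Some l) * power_term r j (\<lambda>i. h (Some i)) i * tw l i t)"
      by (intro form_sum) auto
    then show ?thesis using True by simp
  qed (simp add: form_zero)
qed

lemma form_Q:
  assumes "j < p" shows "form F (affine_index p) (p - 1) (\<lambda>h. Q j h t)"
  unfolding Q_def
proof (rule form_sum)
  fix r assume "r \<in> {..<p}"
  then have deg: "(p - 1 - r) * 1 + r = p - 1" by auto
  have "form F (affine_index p) ((p - 1 - r) * 1 + r)
    (\<lambda>h. h None ^ (p - 1 - r) * power_term r j (\<lambda>i. h (Some i)) t)"
    by (intro form_mult form_power form_coord form_power_term assms) auto
  then show "form F (affine_index p) (p - 1)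
    (\<lambda>h. h None ^ (p - 1 - r) * power_term r j (\<lambda>i. h (Some i)) t)" unfolding deg .
qed

text \<open>Conjugated by the diagonal matrix of the eigenvector, \<open>y\<^sup>-\<^sup>1 z\<close> becomes a cyclic permutation.\<close>

lemma Phi_power_term:
  assumes "eigenvector z v" "j < p" "m < p" "k < p"
  shows "Phi (power_term r j z) m k = (if (k + r) mod p = m then v m / v k * lam k ^ j else 0)"
  using assms(3)
proof (induction r arbitrary: m)
  case 0
  have "Phi (power_term 0 j z) m k = (\<Sum>t<n. xv j t * E t m k)"
    unfolding Phi_def by (rule sum.cong) auto
  then show ?case using xv[OF assms(2) 0 assms(4)] assms(1,4) by (auto simp: eigenvector_def)
next
  case (Suc r)
  obtain m' where m': "m' < p" "m = Suc m' mod p"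
    using bij_betw_Suc_mod Suc.prems by (metis (no_types, lifting) bij_betw_imp_surj_on imageE lessThan_iff)
  have vm: "v m' \<noteq> 0" "v m = sig z m' * v m' / \<beta>"
    using assms(1) m' \<beta>_nz unfolding eigenvector_def by (auto simp: field_simps)
  have "Phi (power_term (Suc r) j z) m k
    = (\<Sum>t<n. (\<Sum>l<p. \<Sum>i<n. z l * power_term r j z i * tw l i t) * E t m k)"
    unfolding Phi_def by (rule sum.cong) auto
  also have "\<dots> = (\<Sum>l<p. \<Sum>i<n. z l * power_term r j z i * (\<Sum>t<n. tw l i t * E t m k))"
    unfolding sum_distrib_left sum_distrib_right
    by (subst sum.swap, rule sum.cong[OF refl], subst sum.swap) (simp add: mult.assoc)
  also have "\<dots> = (\<Sum>l<p. \<Sum>i<n. z l * power_term r j z i * (sg l m' * E i m' k / \<beta>))"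
    by (intro sum.cong refl) (use tw m' assms(4) in auto)
  also have "\<dots> = sig z m' * Phi (power_term r j z) m' k / \<beta>"
  proof -
    have ac: "a * b * (c * d / e) = a * c * (b * d) / e" for a b c d e :: 'c by simp
    show ?thesis
      unfolding sig_def Phi_def sum_product sum_divide_distrib
      by (rule sum.cong[OF refl], rule sum.cong[OF refl], rule ac)
  qed
  also have "\<dots> = v m / v m' * Phi (power_term r j z) m' k" using vm by (simp add: field_simps)
  also have "\<dots> = v m / v m' * (if (k + r) mod p = m' then v m' / v k * lam k ^ j else 0)"
    by (simp only: Suc.IH[OF m'(1)])
  also have "\<dots> = (if (k + r) mod p = m' then v m / v k * lam k ^ j else 0)" using vm(1) by simp
  also have "(k + r) mod p = m' \<longleftrightarrow> (k + Suc r) mod p = m"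
  proof -
    have "(k + Suc r) mod p = Suc ((k + r) mod p) mod p" by (simp add: mod_Suc_eq)
    moreover have "(k + r) mod p < p" using p_pos by simp
    ultimately show ?thesis
      using inj_on_eq_iff[OF bij_betw_imp_inj_on[OF bij_betw_Suc_mod], of "(k + r) mod p" m'] m'
      by simp
  qed
  finally show ?case .
qed

lemma sum_cyclic_shift:
  assumes "m < p" "k < p"
  shows "(\<Sum>r<p. if (k + r) mod p = m then x else 0) = (x :: 'c)"
proof -
  \<comment> \<open>the residue of \<open>m - k\<close> modulo \<open>p\<close>\<close>
  define r0 where "r0 = (if k \<le> m then m - k else m + p - k)"
  have "(k + r) mod p = m \<longleftrightarrow> r = r0" if "r < p" for r
  proof -
    have "(k + r) mod p = (if k + r < p then k + r else k + r - p)"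
      using that assms by (simp add: le_mod_geq)
    then show ?thesis using that assms by (auto simp: r0_def)
  qed
  then have "(\<Sum>r<p. if (k + r) mod p = m then x else 0) = (\<Sum>r<p. if r = r0 then x else 0)"
    by (intro sum.cong) auto
  also have "\<dots> = x" using assms by (auto simp: r0_def)
  finally show ?thesis .
qed

text \<open>Every matrix position is hit by exactly one power of the cyclic permutation, so the powers add up
  to the matrix with entries \<open>v\<^sub>m / v\<^sub>k\<close>, which has rank one.\<close>

lemma rank_one_Q:
  assumes "eigenvector z v"
  shows "rank_one v (\<lambda>j k. lam k ^ j / v k) (\<lambda>j. Q j (case_option 1 z))"
  unfolding rank_one_def
proof (intro allI impI conjI)
  fix j assume j: "j < p"
  have zero: "power_term r j z t = 0" if "t \<ge> n" for r t using that by (cases r) auto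
  have Q: "Q j (case_option 1 z) = (\<lambda>t. \<Sum>r<p. 1 * power_term r j z t)"
    by (simp add: Q_def fun_eq_iff)
  show "Q j (case_option 1 z) \<in> coord_space {..<n}"
    unfolding Q by (auto simp: coord_space_def zero)
  fix m k assume mk: "m < p" "k < p"
  have "Phi (Q j (case_option 1 z)) m k
    = (\<Sum>r<p. if (k + r) mod p = m then v m / v k * lam k ^ j else 0)"
    unfolding Q Phi_sum by (intro sum.cong) (use assms mk j in \<open>auto simp: Phi_power_term\<close>)
  then show "Phi (Q j (case_option 1 z)) m k = v m * (lam k ^ j / v k)"
    using mk by (simp add: sum_cyclic_shift)
qed

text \<open>A linear relation is a polynomial of degree less than \<open>p\<close> with the \<open>p\<close> roots \<open>lam k\<close>.\<close>

lemma square_basis_vandermonde: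
  assumes "\<And>k. k < p \<Longrightarrow> v k \<noteq> 0"
  shows "square_basis (\<lambda>j k. lam k ^ j / v k)"
  unfolding square_basis_def
proof (intro allI impI)
  fix c i assume c: "\<forall>k<p. (\<Sum>i<p. c i * (lam k ^ i / v k)) = 0" and i: "i < p"
  let ?f = "\<Sum>i<p. monom (c i) i"
  have coeff: "coeff ?f i = (if i < p then c i else 0)" for i
    by (simp add: coeff_sum if_distrib cong: if_cong)
  have root: "poly ?f (lam k) = 0" if "k < p" for k
  proof -
    have "poly ?f (lam k) = (\<Sum>i<p. c i * (lam k ^ i / v k)) * v k"
      using assms[OF that] by (simp add: poly_sum poly_monom sum_distrib_right)
    then show ?thesis using c that by simp
  qed
  have "?f = 0"
  proof (rule ccontr)
    assume nz: "?f \<noteq> 0"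
    have sub: "lam ` {..<p} \<subseteq> {x. poly ?f x = 0}"
      by (rule image_subsetI) (simp only: lessThan_iff mem_Collect_eq root)
    have "card (lam ` {..<p}) \<le> card {x. poly ?f x = 0}"
      by (rule card_mono[OF poly_roots_finite[OF nz] sub])
    then have "p \<le> card {x. poly ?f x = 0}" by (simp only: card_image[OF lam_inj] card_lessThan)
    also have "\<dots> \<le> degree ?f" by (rule card_poly_roots_bound) (rule nz)
    also have "degree ?f \<le> p - 1" by (rule degree_le) (auto simp: coeff)
    finally show False using p_pos by simp
  qed
  then show "c i = 0" using coeff[of i] i by simp
qed

text \<open>The representative is chosen arbitrarily: the Pluecker coordinates of the rows \<open>Q\<close> are forms of one
  common degree, so the line they span does not depend on it.\<close>

definition orbit_map :: "(nat option \<Rightarrow> 'c) set \<Rightarrow> (nat set \<Rightarrow> 'c) set" where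
  "orbit_map l = line_of (pluecker p n (\<lambda>j. Q j (SOME h. h \<in> l \<and> h \<noteq> (\<lambda>_. 0))))"

lemma form_pluecker_Q:
  assumes "S \<in> pluecker_index p n"
  shows "form F (affine_index p) (p * (p - 1)) (\<lambda>h. pluecker p n (\<lambda>j. Q j h) S)"
  using form_det[where a = "\<lambda>i j h. Q i h (sorted_list_of_set S ! j)" and n = p, OF form_Q] assms
  by (simp add: pluecker_def)

lemma orbit_map_line_of:
  assumes "h \<noteq> (\<lambda>_. 0)"
  shows "orbit_map (line_of h) = line_of (pluecker p n (\<lambda>j. Q j h))"
proof -
  let ?h = "SOME h'. h' \<in> line_of h \<and> h' \<noteq> (\<lambda>_. 0)"
  have h: "?h \<in> line_of h \<and> ?h \<noteq> (\<lambda>_. 0)"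
    by (rule someI[of _ h]) (use assms self_mem_line_of in auto)
  from mem_line_of[THEN iffD1, OF conjunct1[OF h]] obtain c where c1: "?h = (\<lambda>i. c * h i)" ..
  have "c \<noteq> 0"
  proof
    assume "c = 0"
    then have "?h = (\<lambda>_. 0)" using c1 by (simp only: mult_zero_left)
    with h show False by blast
  qed
  note c = c1 this
  have "pluecker p n (\<lambda>j. Q j ?h) = (\<lambda>S. c ^ (p * (p - 1)) * pluecker p n (\<lambda>j. Q j h) S)"
  proof
    fix S show "pluecker p n (\<lambda>j. Q j ?h) S = c ^ (p * (p - 1)) * pluecker p n (\<lambda>j. Q j h) S"
    proof (cases "S \<in> pluecker_index p n")
      case True
      show ?thesis unfolding c(1) by (rule form_scale[OF form_pluecker_Q[OF True]])
    qed (simp add: pluecker_def)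
  qed
  then show ?thesis unfolding orbit_map_def using c(2) by (simp add: line_of_scale)
qed

lemma norm_locusE:
  assumes "l \<in> norm_locus"
  obtains z v where "l = line_of (case_option 1 z)" "z \<in> coord_space {..<p}"
    "eigenvector z v" "case_option 1 z \<in> coord_space (affine_index p)" "case_option 1 z \<noteq> (\<lambda>_. 0)"
proof -
  obtain z where z: "l = line_of (case_option 1 z)" "z \<in> coord_space {..<p}" "(\<Prod>m<p. sig z m) = \<beta> ^ p"
    using assms by (auto simp: norm_locus_def)
  have "case_option 1 z \<in> coord_space (affine_index p)"
    using z(2) by (auto simp: coord_space_def split: option.split)
  moreover have "case_option 1 z \<noteq> (\<lambda>_. 0)" by (metis option.simps(4) zero_neq_one)
  ultimately show ?thesis using that[OF z(1,2) eigenvector_exists[OF z(3)]] by blast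
qed

lemma eigenvector_nz: "eigenvector z v \<Longrightarrow> m < p \<Longrightarrow> v m \<noteq> 0"
  by (simp add: eigenvector_def)

lemma Q_pluecker_nonzero:
  assumes "eigenvector z v"
  shows "pluecker p n (\<lambda>j. Q j (case_option 1 z)) \<noteq> (\<lambda>_. 0)"
  using rank_one_independent[OF rank_one_Q[OF assms] square_basis_vandermonde p_pos]
    eigenvector_nz[OF assms] p_pos rank_oneD(1)[OF rank_one_Q[OF assms]]
  by (intro independent_rows_pluecker_nonzero) auto

lemma orbit_map_mem_ideal_variety: "l \<in> norm_locus \<Longrightarrow> orbit_map l \<in> ideal_variety"
proof (elim norm_locusE)
  fix z v assume l: "l = line_of (case_option 1 z)" and ev: "eigenvector z v"
    and nz: "case_option 1 z \<noteq> (\<lambda>_. 0)"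
  show "orbit_map l \<in> ideal_variety" unfolding l orbit_map_line_of[OF nz]
    by (rule rank_one_mem_ideal_variety[OF rank_one_Q[OF ev] square_basis_vandermonde p_pos])
      (use eigenvector_nz[OF ev] p_pos in auto)
qed

lemma norm_locus_subset_proj_space: "norm_locus \<subseteq> proj_space (affine_index p)"
proof
  fix l assume "l \<in> norm_locus"
  then show "l \<in> proj_space (affine_index p)"
    by (elim norm_locusE) (simp add: line_of_mem_proj_space)
qed

lemma norm_locus_nonempty: "norm_locus \<noteq> {}"
proof -
  obtain z where "z \<in> coord_space {..<p}" "(\<Prod>m<p. sig z m) = \<beta> ^ p"
    by (rule eigenvector_for[of "\<lambda>_. 1"]) auto
  then show ?thesis by (auto simp: norm_locus_def)
qed

lemma regular_orbit_map:
  "regular_map F (affine_index p) norm_locus (pluecker_index p n) (orbit_map ` norm_locus) orbit_map"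
proof (rule regular_mapI)
  fix l assume l: "l \<in> norm_locus"
  show "\<exists>U f d. openin (subtopology (zariski F (affine_index p)) norm_locus) U \<and> l \<in> U \<and>
        (\<forall>S\<in>pluecker_index p n. form F (affine_index p) d (f S)) \<and>
        (\<forall>m\<in>U. \<forall>h\<in>m - {\<lambda>_. 0}. (\<exists>S\<in>pluecker_index p n. f S h \<noteq> 0) \<and>
           orbit_map m = line_of (\<lambda>S. if S \<in> pluecker_index p n then f S h else 0))"
  proof (intro exI conjI ballI)
    show "openin (subtopology (zariski F (affine_index p)) norm_locus) norm_locus"
      using norm_locus_subset_proj_space by (simp add: topspace_zariski openin_subtopology_refl)
    show "l \<in> norm_locus" by (rule l)
    show "form F (affine_index p) (p * (p - 1)) (\<lambda>h. pluecker p n (\<lambda>j. Q j h) S)"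
      if "S \<in> pluecker_index p n" for S by (rule form_pluecker_Q) (rule that)
    fix m h assume m: "m \<in> norm_locus" and h: "h \<in> m - {\<lambda>_. 0}"
    have mh: "m = line_of h" "h \<noteq> (\<lambda>_. 0)"
      using proj_space_nonzero_mem[of m _ h] m h norm_locus_subset_proj_space by auto
    have eq: "(\<lambda>S. if S \<in> pluecker_index p n then pluecker p n (\<lambda>j. Q j h) S else 0)
      = pluecker p n (\<lambda>j. Q j h)" by (auto simp: pluecker_def)
    show "orbit_map m = line_of (\<lambda>S. if S \<in> pluecker_index p n then pluecker p n (\<lambda>j. Q j h) S else 0)"
      unfolding eq mh(1) by (rule orbit_map_line_of) (rule mh(2))
    obtain z v where z: "m = line_of (case_option 1 z)" "eigenvector z v"
      "case_option 1 z \<noteq> (\<lambda>_. 0)" by (rule norm_locusE[OF m]) blast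
    have "line_of (pluecker p n (\<lambda>j. Q j h)) = line_of (pluecker p n (\<lambda>j. Q j (case_option 1 z)))"
      using orbit_map_line_of[OF z(3)] orbit_map_line_of[OF mh(2)] z(1) mh(1) by simp
    then have "pluecker p n (\<lambda>j. Q j h) \<noteq> (\<lambda>_. 0)"
      using line_of_eq_nonzero[OF _ Q_pluecker_nonzero[OF z(2)]] by metis
    then obtain S where S: "pluecker p n (\<lambda>j. Q j h) S \<noteq> 0" by (auto simp: fun_eq_iff)
    then have "S \<in> pluecker_index p n" by (auto simp: pluecker_def split: if_splits)
    with S show "\<exists>S\<in>pluecker_index p n. pluecker p n (\<lambda>j. Q j h) S \<noteq> 0" by blast
  qed
qed blast

text \<open>If no coordinate of \<open>v\<close> vanishes, then \<open>v\<close> is an eigenvector for the point \<open>z\<close> with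
  \<open>z\<^sub>m = \<beta> v\<^sub>m\<^sub>+\<^sub>1 / v\<^sub>m\<close>, and the rows \<open>Q\<close> at \<open>z\<close> span the same ideal.\<close>

lemma rank_one_mem_orbit:
  assumes "rank_one v s w" "square_basis s" "\<And>m. m < p \<Longrightarrow> v m \<noteq> 0"
  shows "line_of (pluecker p n w) \<in> orbit_map ` norm_locus"
proof -
  obtain z where z: "z \<in> coord_space {..<p}" "(\<Prod>m<p. sig z m) = \<beta> ^ p" "eigenvector z v"
    by (rule eigenvector_for[OF assms(3)])
  have l: "line_of (case_option 1 z) \<in> norm_locus" using z by (auto simp: norm_locus_def)
  have nz: "case_option 1 z \<noteq> (\<lambda>_. 0)" by (metis option.simps(4) zero_neq_one)
  have "orbit_map (line_of (case_option 1 z)) = line_of (pluecker p n w)"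
    unfolding orbit_map_line_of[OF nz]
    by (rule rank_one_same_line[OF assms(1,2) rank_one_Q[OF z(3)] square_basis_vandermonde p_pos])
      (use assms(3) p_pos in auto)
  with l show ?thesis by blast
qed

end

section \<open>The inverse map and density of the orbit\<close>

context cyclic_data begin

text \<open>The matrix of the map that takes an element of the ideal to its diagonal part in \<open>L\<close>.\<close>

definition diag_matrix :: "(nat \<Rightarrow> nat \<Rightarrow> 'c) \<Rightarrow> 'c mat" where
  "diag_matrix w = mat p p (\<lambda>(i, l). \<Sum>t<n. w i t * dg t l)"

text \<open>Up to the factor \<open>det (diag_matrix w)\<close>, the coefficients of the element of the ideal whose diagonal
  part is 1.\<close>

definition solve :: "(nat \<Rightarrow> nat \<Rightarrow> 'c) \<Rightarrow> nat \<Rightarrow> 'c" where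
  "solve w i = (\<Sum>m<p. unit m * adj_mat (diag_matrix w) $$ (m, i))"

text \<open>The diagonal part of \<open>y u\<close>, for the element \<open>u\<close> described by \<open>solve\<close>.\<close>

definition numer :: "(nat \<Rightarrow> nat \<Rightarrow> 'c) \<Rightarrow> nat \<Rightarrow> 'c" where
  "numer w l = (\<Sum>i<p. solve w i * (\<Sum>t<n. w i t * dy t l))"

lemma diag_matrix_carrier: "diag_matrix w \<in> carrier_mat p p"
  by (simp add: diag_matrix_def)

lemma sum_rows_swap:
  "(\<Sum>i<p. c i * (\<Sum>t<n. w i t * a t)) = (\<Sum>t<n. (\<Sum>i<p. c i * w i t) * (a t :: 'c))"
  unfolding sum_distrib_left sum_distrib_right by (subst sum.swap) (simp add: mult.assoc)

lemma solve_diag: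
  assumes "l < p"
  shows "(\<Sum>t<n. (\<Sum>i<p. solve w i * w i t) * dg t l) = det (diag_matrix w) * unit l"
proof -
  let ?G = "diag_matrix w"
  have adj: "adj_mat ?G * ?G = det ?G \<cdot>\<^sub>m 1\<^sub>m p" "adj_mat ?G \<in> carrier_mat p p"
    using adj_mat[OF diag_matrix_carrier[of w]] by auto
  have "(\<Sum>t<n. (\<Sum>i<p. solve w i * w i t) * dg t l) = (\<Sum>i<p. solve w i * ?G $$ (i, l))"
    unfolding sum_rows_swap[symmetric] by (rule sum.cong) (use assms in \<open>auto simp: diag_matrix_def\<close>)
  also have "\<dots> = (\<Sum>m<p. unit m * (\<Sum>i<p. adj_mat ?G $$ (m, i) * ?G $$ (i, l)))"
    unfolding solve_def sum_distrib_left sum_distrib_right by (subst sum.swap) (simp add: mult.assoc)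
  also have "\<dots> = (\<Sum>m<p. unit m * (if m = l then det ?G else 0))"
  proof (rule sum.cong[OF refl])
    fix m assume m: "m \<in> {..<p}"
    have "(\<Sum>i<p. adj_mat ?G $$ (m, i) * ?G $$ (i, l)) = (adj_mat ?G * ?G) $$ (m, l)"
      using m assms adj(2) diag_matrix_carrier[of w]
      by (auto simp: scalar_prod_def atLeast0LessThan intro!: sum.cong)
    also have "\<dots> = (if m = l then det ?G else 0)" unfolding adj(1) using m assms by simp
    finally show "unit m * (\<Sum>i<p. adj_mat ?G $$ (m, i) * ?G $$ (i, l))
      = unit m * (if m = l then det ?G else 0)" by simp
  qed
  also have "\<dots> = det ?G * unit l"
    using assms by (simp add: if_distrib[of "\<lambda>x. _ * x"] mult.commute cong: if_cong)
  finally show ?thesis .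
qed

lemma sum_diag:
  assumes "m < p" shows "(\<Sum>l<p. (\<Sum>t<n. u t * dg t l) * sg l m) = Phi u m m"
proof -
  have "(\<Sum>l<p. (\<Sum>t<n. u t * dg t l) * sg l m) = (\<Sum>t<n. u t * (\<Sum>l<p. dg t l * sg l m))"
    unfolding sum_distrib_left sum_distrib_right by (subst sum.swap) (simp add: mult.assoc)
  also have "\<dots> = Phi u m m" unfolding Phi_def by (rule sum.cong) (use assms dg in auto)
  finally show ?thesis .
qed

lemma sum_shifted_diag:
  assumes "m < p" shows "(\<Sum>l<p. (\<Sum>t<n. u t * dy t l) * sg l m) = \<beta> * Phi u (Suc m mod p) m"
proof -
  have "(\<Sum>l<p. (\<Sum>t<n. u t * dy t l) * sg l m) = (\<Sum>t<n. u t * (\<Sum>l<p. dy t l * sg l m))"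
    unfolding sum_distrib_left sum_distrib_right by (subst sum.swap) (simp add: mult.assoc)
  also have "\<dots> = (\<Sum>t<n. u t * (\<beta> * E t (Suc m mod p) m))"
    by (rule sum.cong) (use assms dy in auto)
  also have "\<dots> = \<beta> * Phi u (Suc m mod p) m" unfolding Phi_def sum_distrib_left
    by (rule sum.cong) (auto simp: mult_ac)
  finally show ?thesis .
qed

lemma Phi_combination:
  assumes "rank_one v s w" "m < p" "k < p"
  shows "Phi (\<lambda>t. \<Sum>i<p. c i * w i t) m k = v m * (\<Sum>i<p. c i * s i k)"
  unfolding Phi_sum sum_distrib_left using rank_oneD(2)[OF assms(1)] assms(2,3)
  by (intro sum.cong) auto

text \<open>The element \<open>u = v t\<^sup>T\<close> given by \<open>solve\<close> has diagonal entries \<open>v\<^sub>m t\<^sub>m\<close> all equal to the determinant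
  \<open>D\<close>, so no \<open>v\<^sub>m\<close> vanishes.  The diagonal entries of \<open>y u\<close> are \<open>\<beta> v\<^sub>m\<^sub>+\<^sub>1 t\<^sub>m = z\<^sub>m v\<^sub>m t\<^sub>m = D z\<^sub>m\<close>.  Thus \<open>z\<close>
  is recovered from the ideal by rational operations over the ground field.\<close>

lemma rank_one_cramer:
  assumes r: "rank_one v s w" and D: "det (diag_matrix w) \<noteq> 0"
  shows "m < p \<Longrightarrow> v m \<noteq> 0"
    and "z \<in> coord_space {..<p} \<Longrightarrow> eigenvector z v \<Longrightarrow> l < p \<Longrightarrow>
      numer w l = det (diag_matrix w) * z l"
proof -
  let ?u = "\<lambda>t. \<Sum>i<p. solve w i * w i t" and ?D = "det (diag_matrix w)"
  let ?s = "\<lambda>k. \<Sum>i<p. solve w i * s i k"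
  have vs: "v m * ?s m = ?D" if m: "m < p" for m
  proof -
    have "v m * ?s m = Phi ?u m m" by (rule Phi_combination[OF r m m, symmetric])
    also have "\<dots> = (\<Sum>l<p. ?D * unit l * sg l m)"
      unfolding sum_diag[OF m, symmetric] by (rule sum.cong) (auto simp: solve_diag)
    also have "\<dots> = ?D * (\<Sum>l<p. unit l * sg l m)" by (simp add: sum_distrib_left mult.assoc)
    finally show ?thesis using unit[OF m] by simp
  qed
  show "v m \<noteq> 0" if "m < p" using vs[OF that] D by auto
  assume z: "z \<in> coord_space {..<p}" "eigenvector z v" and l: "l < p"
  let ?y = "\<lambda>l. if l < p then numer w l else 0"
  have "?y = (\<lambda>l. ?D * z l)"
  proof (rule sig_eqD)
    show "?y \<in> coord_space {..<p}" by (auto simp: coord_space_def)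
    show "(\<lambda>l. ?D * z l) \<in> coord_space {..<p}" using z(1) by (auto simp: coord_space_def)
    fix m assume m: "m < p"
    have mm: "Suc m mod p < p" using p_pos by simp
    have "sig ?y m = (\<Sum>l<p. (\<Sum>t<n. ?u t * dy t l) * sg l m)"
      unfolding sig_def by (rule sum.cong) (auto simp: numer_def sum_rows_swap)
    also have "\<dots> = \<beta> * (v (Suc m mod p) * ?s m)"
      by (simp only: sum_shifted_diag[OF m] Phi_combination[OF r mm m])
    also have "\<dots> = (\<beta> * v (Suc m mod p)) * ?s m" by simp
    also have "\<dots> = (sig z m * v m) * ?s m" using z(2) m by (simp add: eigenvector_def)
    also have "\<dots> = sig z m * ?D" using vs[OF m] by simp
    also have "\<dots> = sig (\<lambda>l. ?D * z l) m" by (simp add: sig_def sum_distrib_left mult_ac)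
    finally show "sig ?y m = sig (\<lambda>l. ?D * z l) m" .
  qed
  then show "numer w l = ?D * z l" using l by (metis (no_types, lifting))
qed

text \<open>The diagonal of \<open>v t\<^sup>T\<close> has entries \<open>v\<^sub>m t\<^sub>m\<close>; it determines \<open>t\<close> if no \<open>v\<^sub>m\<close> vanishes.\<close>

lemma rank_one_det_nonzero:
  assumes "rank_one v s w" "square_basis s" "\<And>m. m < p \<Longrightarrow> v m \<noteq> 0"
  shows "det (diag_matrix w) \<noteq> 0"
  unfolding diag_matrix_def
proof (rule square_basis_det, unfold square_basis_def, intro allI impI)
  fix c i assume c: "\<forall>l<p. (\<Sum>i<p. c i * (\<Sum>t<n. w i t * dg t l)) = 0" and i: "i < p"
  have "(\<Sum>i<p. c i * s i k) = 0" if k: "k < p" for k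
  proof -
    have "v k * (\<Sum>i<p. c i * s i k) = Phi (\<lambda>t. \<Sum>i<p. c i * w i t) k k"
      by (rule Phi_combination[OF assms(1) k k, symmetric])
    also have "\<dots> = (\<Sum>l<p. 0 * sg l k)"
      unfolding sum_diag[OF k, symmetric] using c by (intro sum.cong) (auto simp: sum_rows_swap)
    finally show ?thesis using assms(3)[OF k] by simp
  qed
  then show "c i = 0" by (rule square_basis_zeroD[OF assms(2) _ i])
qed

subsection \<open>Recovering a basis from Pluecker coordinates\<close>

text \<open>The sign relating a minor to the Pluecker coordinate of its set of columns, 0 if a column is
  repeated.\<close>

definition minor_sign :: "(nat \<Rightarrow> nat) \<Rightarrow> 'c" where
  "minor_sign f = (if inj_on f {..<p} then
     SOME c. c \<in> {1, -1} \<and> (\<forall>w :: nat \<Rightarrow> nat \<Rightarrow> 'c. minor p w f = c * pluecker p n w (f ` {..<p}))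
   else 0)"

lemma minor_sign:
  fixes w :: "nat \<Rightarrow> nat \<Rightarrow> 'c"
  assumes "\<And>j. j < p \<Longrightarrow> f j < n"
  shows "minor p w f = minor_sign f * pluecker p n w (f ` {..<p})" "minor_sign f \<in> F"
    "minor_sign f \<noteq> 0 \<Longrightarrow> f ` {..<p} \<in> pluecker_index p n"
proof -
  have "minor p w f = minor_sign f * pluecker p n w (f ` {..<p}) \<and> minor_sign f \<in> F \<and>
    (minor_sign f \<noteq> 0 \<longrightarrow> f ` {..<p} \<in> pluecker_index p n)"
  proof (cases "inj_on f {..<p}")
    case True
    have sub: "f ` {..<p} \<subseteq> {..<n}" using assms by auto
    have ex: "\<exists>c. c \<in> {1, -1} \<and> (\<forall>w :: nat \<Rightarrow> nat \<Rightarrow> 'c. minor p w f = c * pluecker p n w (f ` {..<p}))"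
      using minor_eq_pluecker(2)[OF True sub] unfolding Bex_def .
    have "minor_sign f \<in> {1, -1} \<and>
      (\<forall>w :: nat \<Rightarrow> nat \<Rightarrow> 'c. minor p w f = minor_sign f * pluecker p n w (f ` {..<p}))"
      unfolding minor_sign_def if_P[OF True] by (rule someI_ex[OF ex])
    then have sign: "minor_sign f \<in> {1, -1}"
      and eq: "minor p w f = minor_sign f * pluecker p n w (f ` {..<p})" by (rule conjunct1, elim conjE spec)
    have "minor_sign f \<in> F" using sign one_mem uminus_mem[OF one_mem] by auto
    then show ?thesis using minor_eq_pluecker(1)[OF True sub] eq by blast
  next
    case False
    then show ?thesis using minor_not_inj[OF False] zero_mem by (simp add: minor_sign_def)
  qed
  then show "minor p w f = minor_sign f * pluecker p n w (f ` {..<p})" "minor_sign f \<in> F"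
    "minor_sign f \<noteq> 0 \<Longrightarrow> f ` {..<p} \<in> pluecker_index p n" by auto
qed

text \<open>If \<open>P\<close> is the Pluecker vector of \<open>w\<close>, then entry \<open>(i, j)\<close> is the minor with columns \<open>s\<close> in which
  column \<open>i\<close> has been exchanged for column \<open>j\<close> of \<open>w\<close>.  These rows are linear in \<open>P\<close> and are
  combinations of the rows of \<open>w\<close>, with the adjugate of the minor as coefficients.\<close>

definition chart_rows :: "(nat \<Rightarrow> nat) \<Rightarrow> (nat set \<Rightarrow> 'c) \<Rightarrow> nat \<Rightarrow> nat \<Rightarrow> 'c" where
  "chart_rows s P i j = (if j < n then minor_sign (s(i := j)) * P ((s(i := j)) ` {..<p}) else 0)"

lemma form_chart_rows:
  assumes "\<And>j. j < p \<Longrightarrow> s j < n"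
  shows "form F (pluecker_index p n) 1 (\<lambda>P. chart_rows s P i j)"
proof (cases "j < n \<and> minor_sign (s(i := j)) \<noteq> 0")
  case True
  define f where "f = s(i := j)"
  have lt: "\<And>k. k < p \<Longrightarrow> f k < n" using assms True by (simp add: f_def)
  have "form F (pluecker_index p n) 1 (\<lambda>P. minor_sign f * P (f ` {..<p}))"
    using True minor_sign(2,3)[of f, OF lt] by (intro form_cmult form_coord) (auto simp: f_def)
  then show ?thesis unfolding chart_rows_def f_def using True by simp
next
  case False
  then have "chart_rows s P i j = 0" for P by (auto simp: chart_rows_def)
  then show ?thesis by (simp add: form_zero)
qed

lemma chart_rows_pluecker:
  assumes "\<And>j. j < p \<Longrightarrow> s j < n" "\<And>i. i < p \<Longrightarrow> w i \<in> coord_space {..<n}" "i < p"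
  shows "chart_rows s (\<lambda>S. c * pluecker p n w S) i
    = (\<lambda>j. \<Sum>r<p. (c * adj_mat (mat p p (\<lambda>(i, j). w i (s j))) $$ (i, r)) * w r j)"
proof
  fix j
  show "chart_rows s (\<lambda>S. c * pluecker p n w S) i j
    = (\<Sum>r<p. (c * adj_mat (mat p p (\<lambda>(i, j). w i (s j))) $$ (i, r)) * w r j)"
  proof (cases "j < n")
    case True
    define f where "f = s(i := j)"
    have lt: "\<And>k. k < p \<Longrightarrow> f k < n" using assms True by (simp add: f_def)
    have "chart_rows s (\<lambda>S. c * pluecker p n w S) i j = c * minor p w (s(i := j))"
      unfolding chart_rows_def f_def[symmetric] using True by (simp add: minor_sign(1)[of f, OF lt])
    then show ?thesis
      unfolding minor_replace_column[OF assms(3)] by (simp add: sum_distrib_left mult.assoc)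
  next
    case False
    then have "w r j = 0" if "r < p" for r using assms(2)[OF that] by (auto simp: coord_space_def)
    then show ?thesis using False by (simp add: chart_rows_def)
  qed
qed

lemma rank_one_chart_rows:
  assumes "\<And>j. j < p \<Longrightarrow> s j < n" "rank_one v t w"
  shows "rank_one v (\<lambda>i k. \<Sum>r<p. (c * adj_mat (mat p p (\<lambda>(i, j). w i (s j))) $$ (i, r)) * t r k)
    (chart_rows s (\<lambda>S. c * pluecker p n w S))"
  unfolding rank_one_def
  using assms rank_oneD(1)[OF assms(2)]
  by (auto simp: chart_rows_pluecker Phi_combination[OF assms(2)] intro!: row_combination_coord)

definition chart_det :: "(nat \<Rightarrow> nat) \<Rightarrow> (nat set \<Rightarrow> 'c) \<Rightarrow> 'c" where
  "chart_det s P = det (diag_matrix (chart_rows s P))"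

lemma form_diag_entry:
  assumes "\<And>j. j < p \<Longrightarrow> s j < n" "l < p"
  shows "form F (pluecker_index p n) 1 (\<lambda>P. \<Sum>t<n. chart_rows s P i t * dg t l)"
    "form F (pluecker_index p n) 1 (\<lambda>P. \<Sum>t<n. chart_rows s P i t * dy t l)"
proof -
  have *: "form F (pluecker_index p n) (1 + 0) (\<lambda>P. chart_rows s P i t * x)" if "x \<in> F" for t x
    by (intro form_mult form_chart_rows assms form_const that)
  show "form F (pluecker_index p n) 1 (\<lambda>P. \<Sum>t<n. chart_rows s P i t * dg t l)"
    "form F (pluecker_index p n) 1 (\<lambda>P. \<Sum>t<n. chart_rows s P i t * dy t l)"
    by (rule form_sum; use * dg_mem dy_mem assms(2) in auto)+
qed

lemma form_chart_det:
  assumes "\<And>j. j < p \<Longrightarrow> s j < n"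
  shows "form F (pluecker_index p n) p (chart_det s)"
proof -
  have "form F (pluecker_index p n) (p * 1) (\<lambda>P. chart_det s P)"
    unfolding chart_det_def diag_matrix_def by (intro form_det form_diag_entry assms)
  then show ?thesis by simp
qed

lemma form_numer:
  assumes "\<And>j. j < p \<Longrightarrow> s j < n" "l < p"
  shows "form F (pluecker_index p n) p (\<lambda>P. numer (chart_rows s P) l)"
  unfolding numer_def
proof (rule form_sum)
  fix i assume i: "i \<in> {..<p}"
  have "form F (pluecker_index p n) ((p - 1) * 1) (\<lambda>P. solve (chart_rows s P) i)"
    unfolding solve_def diag_matrix_def
    by (intro form_sum form_cmult unit_mem form_adj_mat form_diag_entry assms) (use i in auto)
  then have "form F (pluecker_index p n) ((p - 1) * 1 + 1)
    (\<lambda>P. solve (chart_rows s P) i * (\<Sum>t<n. chart_rows s P i t * dy t l))"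
    by (intro form_mult form_diag_entry assms)
  then show "form F (pluecker_index p n) p
    (\<lambda>P. solve (chart_rows s P) i * (\<Sum>t<n. chart_rows s P i t * dy t l))"
    using p_pos by simp
qed

lemma orbit_inverse_formula:
  assumes s: "\<And>j. j < p \<Longrightarrow> s j < n" and z: "z \<in> coord_space {..<p}" "eigenvector z v"
    and P: "P = (\<lambda>S. c * pluecker p n (\<lambda>j. Q j (case_option 1 z)) S)" and D: "chart_det s P \<noteq> 0"
  shows "line_of (\<lambda>i. if i \<in> affine_index p then
      (case i of None \<Rightarrow> chart_det s P | Some l \<Rightarrow> numer (chart_rows s P) l) else 0)
    = line_of (case_option 1 z)"
proof -
  note r = rank_one_chart_rows[OF s rank_one_Q[OF z(2)], where c = c, folded P]
  have num: "numer (chart_rows s P) l = chart_det s P * z l" if "l < p" for l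
    using rank_one_cramer(2)[OF r _ z that] D by (simp add: chart_det_def)
  have z0: "z l = 0" if "\<not> l < p" for l using z(1) that by (auto simp: coord_space_def)
  have "(\<lambda>i. if i \<in> affine_index p then
      (case i of None \<Rightarrow> chart_det s P | Some l \<Rightarrow> numer (chart_rows s P) l) else 0)
    = (\<lambda>i. chart_det s P * case_option 1 z i)"
    using num z0 by (auto simp: fun_eq_iff split: option.split)
  then show ?thesis using D by (simp add: line_of_scale)
qed

text \<open>For a nonvanishing minor \<open>s\<close> the adjugate is invertible, so the rows of the chart form another
  basis of the same ideal.\<close>

lemma chart_det_nonzero_exists:
  assumes "rank_one v t w" "square_basis t" "\<And>m. m < p \<Longrightarrow> v m \<noteq> 0"
  obtains s where "\<And>j. j < p \<Longrightarrow> s j < n" "chart_det s (pluecker p n w) \<noteq> 0"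
proof -
  have wc: "\<And>i. i < p \<Longrightarrow> w i \<in> coord_space {..<n}" by (rule rank_oneD(1)[OF assms(1)])
  obtain s where s: "\<And>j. j < p \<Longrightarrow> s j < n" "minor p w s \<noteq> 0"
    by (rule independent_rows_nonzero_minor[OF rank_one_independent[OF assms(1,2) p_pos assms(3)[OF p_pos]] wc]) blast+
  let ?A = "mat p p (\<lambda>(i, j). w i (s j))"
  have A: "?A \<in> carrier_mat p p" by simp
  have "det (adj_mat ?A) * det ?A = det (det ?A \<cdot>\<^sub>m 1\<^sub>m p)"
    using adj_mat[OF A] A by (metis det_mult)
  also have "\<dots> \<noteq> 0" using s(2) by (simp add: minor_def)
  finally have adj_nz: "det (adj_mat ?A) \<noteq> 0" by auto
  have "diag_matrix (chart_rows s (pluecker p n w)) = adj_mat ?A * diag_matrix w"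
  proof (rule eq_matI)
    fix i l assume "i < dim_row (adj_mat ?A * diag_matrix w)" "l < dim_col (adj_mat ?A * diag_matrix w)"
    then have il: "i < p" "l < p" using adj_mat(1)[OF A] by (auto simp: diag_matrix_def)
    have "chart_rows s (pluecker p n w) i = (\<lambda>j. \<Sum>r<p. adj_mat ?A $$ (i, r) * w r j)"
      using chart_rows_pluecker[where s = s and w = w and c = 1, OF s(1) wc il(1)] by simp
    then have "diag_matrix (chart_rows s (pluecker p n w)) $$ (i, l)
      = (\<Sum>r<p. adj_mat ?A $$ (i, r) * (\<Sum>t<n. w r t * dg t l))"
      using il by (simp add: diag_matrix_def sum_rows_swap)
    also have "\<dots> = (adj_mat ?A * diag_matrix w) $$ (i, l)"
      using il adj_mat(1)[OF A] by (auto simp: diag_matrix_def scalar_prod_def atLeast0LessThan intro!: sum.cong)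
    finally show "diag_matrix (chart_rows s (pluecker p n w)) $$ (i, l)
      = (adj_mat ?A * diag_matrix w) $$ (i, l)" .
  qed (use adj_mat(1)[OF A] in \<open>auto simp: diag_matrix_def\<close>)
  then have "chart_det s (pluecker p n w) = det (adj_mat ?A) * det (diag_matrix w)"
    unfolding chart_det_def using adj_mat(1)[OF A] diag_matrix_carrier by (metis det_mult)
  then have "chart_det s (pluecker p n w) \<noteq> 0"
    using adj_nz rank_one_det_nonzero[OF assms] by simp
  with s(1) show ?thesis by (rule that)
qed

lemma orbit_point:
  assumes "l \<in> norm_locus"
  obtains z v where "l = line_of (case_option 1 z)" "z \<in> coord_space {..<p}" "eigenvector z v"
    "orbit_map l = line_of (pluecker p n (\<lambda>j. Q j (case_option 1 z)))"
proof (rule norm_locusE[OF assms])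
  fix z v assume *: "l = line_of (case_option 1 z)" "z \<in> coord_space {..<p}" "eigenvector z v"
    "case_option 1 z \<noteq> (\<lambda>_. 0)"
  show ?thesis by (rule that[OF *(1-3)]) (simp add: *(1) orbit_map_line_of[OF *(4)])
qed

lemma orbit_chart_exists:
  assumes "m \<in> orbit_map ` norm_locus"
  obtains s where "\<And>j. j < p \<Longrightarrow> s j < n" "m \<in> form_locus (pluecker_index p n) (chart_det s)"
proof -
  obtain l where l: "l \<in> norm_locus" "m = orbit_map l" using assms by blast
  obtain z v where z: "eigenvector z v" "orbit_map l = line_of (pluecker p n (\<lambda>j. Q j (case_option 1 z)))"
    by (rule orbit_point[OF l(1)])
  obtain s where s: "\<And>j. j < p \<Longrightarrow> s j < n" "chart_det s (pluecker p n (\<lambda>j. Q j (case_option 1 z))) \<noteq> 0"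
    by (rule chart_det_nonzero_exists[OF rank_one_Q[OF z(1)] square_basis_vandermonde eigenvector_nz[OF z(1)]])
      (use eigenvector_nz[OF z(1)] in auto)
  have "m \<in> form_locus (pluecker_index p n) (chart_det s)"
    unfolding l(2) z(2)
    using line_of_mem_form_locus[OF form_chart_det[OF s(1)] pluecker_mem_coord_space Q_pluecker_nonzero[OF z(1)]] s(2)
    by simp
  with s(1) show ?thesis by (rule that)
qed

text \<open>The formula for the inverse depends only on the Pluecker vector.  It therefore proves at the same
  time that the orbit map is injective and that its inverse is regular.\<close>

lemma orbit_in_chart:
  assumes s: "\<And>j. j < p \<Longrightarrow> s j < n" and l: "l \<in> norm_locus"
    and chart: "orbit_map l \<in> form_locus (pluecker_index p n) (chart_det s)"
    and P: "P \<in> orbit_map l" "P \<noteq> (\<lambda>_. 0)"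
  shows "chart_det s P \<noteq> 0"
    "line_of (\<lambda>i. if i \<in> affine_index p then
      (case i of None \<Rightarrow> chart_det s P | Some l \<Rightarrow> numer (chart_rows s P) l) else 0) = l"
proof -
  obtain z v where z: "l = line_of (case_option 1 z)" "z \<in> coord_space {..<p}" "eigenvector z v"
    "orbit_map l = line_of (pluecker p n (\<lambda>j. Q j (case_option 1 z)))"
    by (rule orbit_point[OF l])
  have "orbit_map l \<in> proj_space (pluecker_index p n)" using chart by (simp add: form_locus_def)
  note P' = proj_space_nonzero_mem[OF this P]
  show D: "chart_det s P \<noteq> 0"
    using line_of_mem_form_locus[OF form_chart_det[OF s] P'(2) P(2)] chart P'(1) by simp
  obtain c where c: "P = (\<lambda>S. c * pluecker p n (\<lambda>j. Q j (case_option 1 z)) S)"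
    using P(1) unfolding z(4) mem_line_of by blast
  show "line_of (\<lambda>i. if i \<in> affine_index p then
      (case i of None \<Rightarrow> chart_det s P | Some l \<Rightarrow> numer (chart_rows s P) l) else 0) = l"
    unfolding z(1) by (rule orbit_inverse_formula[OF s z(2,3) c D])
qed

lemma ideal_variety_subset_proj_space: "ideal_variety \<subseteq> proj_space (pluecker_index p n)"
proof
  fix l assume "l \<in> ideal_variety"
  then show "l \<in> proj_space (pluecker_index p n)"
  proof (rule ideal_variety_rank_one)
    fix v s w m assume *: "l = line_of (pluecker p n w)" "rank_one v s w" "square_basis s" "m < p" "v m \<noteq> 0"
    show ?thesis unfolding *(1)
      by (intro line_of_mem_proj_space pluecker_mem_coord_space independent_rows_pluecker_nonzero
          rank_one_independent[OF *(2-5)] rank_oneD(1)[OF *(2)])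
  qed
qed

lemma inj_orbit_map: "inj_on orbit_map norm_locus"
proof (rule inj_onI)
  fix l l' assume l: "l \<in> norm_locus" "l' \<in> norm_locus" "orbit_map l = orbit_map l'"
  obtain s where s: "\<And>j. j < p \<Longrightarrow> s j < n" "orbit_map l \<in> form_locus (pluecker_index p n) (chart_det s)"
    by (rule orbit_chart_exists[OF imageI[OF l(1)]]) blast
  obtain P where P: "P \<in> orbit_map l" "P \<noteq> (\<lambda>_. 0)"
    using s(2) self_mem_line_of by (auto simp: form_locus_def elim!: proj_space_obtain_nonzero)
  have P': "P \<in> orbit_map l'" and s': "orbit_map l' \<in> form_locus (pluecker_index p n) (chart_det s)"
    using P(1) s(2) l(3) by auto
  show "l = l'"
    using orbit_in_chart(2)[OF s(1) l(1) s(2) P] orbit_in_chart(2)[OF s(1) l(2) s' P' P(2)] by simp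
qed

text \<open>Since \<open>chart_det\<close> is nonzero, Cramer's rule for the rows of the chart shows that no \<open>v\<^sub>m\<close> vanishes.\<close>

lemma chart_subset_orbit:
  assumes s: "\<And>j. j < p \<Longrightarrow> s j < n"
    and l: "l \<in> ideal_variety" "l \<in> form_locus (pluecker_index p n) (chart_det s)"
  shows "l \<in> orbit_map ` norm_locus"
  using l(1)
proof (rule ideal_variety_rank_one)
  fix v t w m assume *: "l = line_of (pluecker p n w)" "rank_one v t w" "square_basis t" "m < p" "v m \<noteq> 0"
  have nz: "pluecker p n w \<noteq> (\<lambda>_. 0)"
    by (intro independent_rows_pluecker_nonzero rank_one_independent[OF *(2-5)] rank_oneD(1)[OF *(2)])
  have D: "chart_det s (\<lambda>S. 1 * pluecker p n w S) \<noteq> 0"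
    using line_of_mem_form_locus[OF form_chart_det[OF s] pluecker_mem_coord_space nz] l(2) *(1) by simp
  have "v m \<noteq> 0" if "m < p" for m
    using rank_one_cramer(1)[OF rank_one_chart_rows[OF s *(2)] D[unfolded chart_det_def] that] .
  then show ?thesis unfolding *(1) by (rule rank_one_mem_orbit[OF *(2,3)])
qed

lemma orbit_open: "openin (subtopology (zariski F (pluecker_index p n)) ideal_variety) (orbit_map ` norm_locus)"
proof -
  let ?T = "zariski F (pluecker_index p n)"
  let ?S = "{s. \<forall>j<p. s j < n}"
  let ?O = "\<Union>s\<in>?S. form_locus (pluecker_index p n) (chart_det s)"
  have "openin ?T ?O"
    by (rule openin_Union) (auto intro!: openin_form_locus form_chart_det)
  moreover have "orbit_map ` norm_locus = ?O \<inter> ideal_variety"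
  proof (intro equalityI subsetI)
    fix m assume m: "m \<in> orbit_map ` norm_locus"
    obtain s where "\<And>j. j < p \<Longrightarrow> s j < n" "m \<in> form_locus (pluecker_index p n) (chart_det s)"
      by (rule orbit_chart_exists[OF m]) blast
    then show "m \<in> ?O \<inter> ideal_variety" using m orbit_map_mem_ideal_variety by blast
  next
    fix m assume "m \<in> ?O \<inter> ideal_variety"
    then obtain s where "\<forall>j<p. s j < n" "m \<in> form_locus (pluecker_index p n) (chart_det s)" "m \<in> ideal_variety"
      by blast
    then show "m \<in> orbit_map ` norm_locus" by (intro chart_subset_orbit[of s]) auto
  qed
  ultimately show ?thesis unfolding openin_subtopology by blast
qed

lemma regular_orbit_inverse:
  "regular_map F (pluecker_index p n) (orbit_map ` norm_locus) (affine_index p) norm_locus (inv_into norm_locus orbit_map)"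
proof (rule regular_mapI)
  show "inv_into norm_locus orbit_map ` (orbit_map ` norm_locus) \<subseteq> norm_locus"
    using inv_into_into[of _ orbit_map norm_locus] by blast
  fix m assume m: "m \<in> orbit_map ` norm_locus"
  obtain s where s: "\<And>j. j < p \<Longrightarrow> s j < n" "m \<in> form_locus (pluecker_index p n) (chart_det s)"
    by (rule orbit_chart_exists[OF m]) blast
  let ?L = "form_locus (pluecker_index p n) (chart_det s)"
  let ?f = "\<lambda>i P. case i of None \<Rightarrow> chart_det s P | Some l \<Rightarrow> numer (chart_rows s P) l"
  show "\<exists>U f d. openin (subtopology (zariski F (pluecker_index p n)) (orbit_map ` norm_locus)) U \<and> m \<in> U \<and>
        (\<forall>i\<in>affine_index p. form F (pluecker_index p n) d (f i)) \<and>
        (\<forall>m\<in>U. \<forall>P\<in>m - {\<lambda>_. 0}. (\<exists>i\<in>affine_index p. f i P \<noteq> 0) \<and>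
           inv_into norm_locus orbit_map m = line_of (\<lambda>i. if i \<in> affine_index p then f i P else 0))"
  proof (intro exI conjI ballI)
    show "openin (subtopology (zariski F (pluecker_index p n)) (orbit_map ` norm_locus)) (orbit_map ` norm_locus \<inter> ?L)"
      by (intro openin_subtopology_Int2 openin_form_locus[OF form_chart_det[OF s(1)]])
    show "m \<in> orbit_map ` norm_locus \<inter> ?L" using m s(2) by blast
    show "form F (pluecker_index p n) p (?f i)" if "i \<in> affine_index p" for i
      using that form_chart_det[OF s(1)] form_numer[OF s(1)] by (cases i) auto
    fix m P assume "m \<in> orbit_map ` norm_locus \<inter> ?L" and P: "P \<in> m - {\<lambda>_. 0}"
    then obtain l where l: "l \<in> norm_locus" "m = orbit_map l" "orbit_map l \<in> ?L" by blast
    have P': "P \<in> orbit_map l" "P \<noteq> (\<lambda>_. 0)" using P l(2) by auto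
    note c = orbit_in_chart[OF s(1) l(1,3) P']
    show "\<exists>i\<in>affine_index p. ?f i P \<noteq> 0" using c(1) by auto
    show "inv_into norm_locus orbit_map m = line_of (\<lambda>i. if i \<in> affine_index p then ?f i P else 0)"
      unfolding l(2) inv_into_f_f[OF inj_orbit_map l(1)] using c(2) by simp
  qed
qed

lemma pluecker_along_line:
  fixes w w' :: "nat \<Rightarrow> nat \<Rightarrow> 'c"
  shows "\<exists>q. \<forall>\<tau>. pluecker p n (\<lambda>i j. w i j + \<tau> * w' i j) S = poly q \<tau>"
proof (cases "S \<in> pluecker_index p n")
  case True
  let ?xs = "sorted_list_of_set S"
  let ?q = "\<Sum>\<pi>\<in>{\<pi>. \<pi> permutes {0..<p}}. smult (signof \<pi>)
    (\<Prod>i\<in>{0..<p}. [:w i (?xs ! \<pi> i), w' i (?xs ! \<pi> i):])"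
  have "pluecker p n (\<lambda>i j. w i j + \<tau> * w' i j) S = poly ?q \<tau>" for \<tau>
    using True
    by (simp add: pluecker_def det_def'[of _ p] poly_sum poly_prod)
  then show ?thesis by blast
next
  case False
  then show ?thesis by (intro exI[of _ 0]) (simp add: pluecker_def)
qed

text \<open>An ideal with vector \<open>v\<close> is the value at \<open>\<tau> = 0\<close> of the curve of ideals with vectors
  \<open>v + \<tau> (1, \<dots>, 1)\<close>.  All but finitely many of them lie in the orbit, and all but finitely many lie in
  a given neighbourhood of the first one.\<close>

lemma orbit_dense: "ideal_variety \<subseteq> Abstract_Topology.closure_of (zariski F (pluecker_index p n)) (orbit_map ` norm_locus)"
proof
  fix l assume l: "l \<in> ideal_variety"
  then show "l \<in> Abstract_Topology.closure_of (zariski F (pluecker_index p n)) (orbit_map ` norm_locus)"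
  proof (rule ideal_variety_rank_one)
    fix v s w m assume *: "l = line_of (pluecker p n w)" "rank_one v s w" "square_basis s" "m < p" "v m \<noteq> 0"
    have "\<exists>u\<in>coord_space {..<n}. \<forall>m<p. \<forall>k<p. Phi u m k = s i k" for i
      using E_surj[of "\<lambda>m k. s i k"] unfolding Phi_def .
    then obtain w' where w': "\<And>i. w' i \<in> coord_space {..<n}"
      "\<And>i m k. m < p \<Longrightarrow> k < p \<Longrightarrow> Phi (w' i) m k = s i k" by metis
    let ?w = "\<lambda>\<tau> i j. w i j + \<tau> * w' i j"
    have r: "rank_one (\<lambda>m. v m + \<tau>) s (?w \<tau>)" for \<tau>
      unfolding rank_one_def
    proof (intro allI impI conjI)
      fix i assume i: "i < p"
      show "?w \<tau> i \<in> coord_space {..<n}"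
        using rank_oneD(1)[OF *(2) i] w'(1)[of i] by (auto simp: coord_space_def)
      fix m k assume mk: "m < p" "k < p"
      show "Phi (?w \<tau> i) m k = (v m + \<tau>) * s i k"
        by (simp add: Phi_add Phi_scale w'(2)[OF mk] rank_oneD(2)[OF *(2) i mk] distrib_right)
    qed
    show ?thesis unfolding in_closure_of
    proof (intro conjI allI impI)
      show "l \<in> topspace (zariski F (pluecker_index p n))"
        using l ideal_variety_subset_proj_space by (auto simp: topspace_zariski)
      fix T assume T: "l \<in> T \<and> openin (zariski F (pluecker_index p n)) T"
      let ?bad = "{\<tau>. line_of (pluecker p n (?w \<tau>)) \<notin> T}"
      have "finite ?bad \<or> (\<forall>\<tau>. line_of (pluecker p n (?w \<tau>)) \<notin> T)"
        by (rule openin_zariski_along_curve) (use T pluecker_along_line pluecker_mem_coord_space in auto)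
      moreover have "line_of (pluecker p n (?w 0)) \<in> T" using T *(1) by simp
      ultimately have "finite ?bad" by blast
      then have "finite (?bad \<union> (\<lambda>m. - v m) ` {..<p})" by simp
      then obtain \<tau> where \<tau>: "\<tau> \<notin> ?bad \<union> (\<lambda>m. - v m) ` {..<p}"
        using ex_new_if_finite[OF infinite_UNIV_char_0] by blast
      have "v m + \<tau> \<noteq> 0" if "m < p" for m
        using \<tau> that by (auto simp: add_eq_0_iff)
      then have "line_of (pluecker p n (?w \<tau>)) \<in> orbit_map ` norm_locus"
        by (intro rank_one_mem_orbit[OF r *(3)])
      moreover have "line_of (pluecker p n (?w \<tau>)) \<in> T" using \<tau> by blast
      ultimately show "\<exists>y. y \<in> orbit_map ` norm_locus \<and> y \<in> T" by blast
    qed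
  qed
qed

theorem orbit_isomorphic: "isomorphic_over F (affine_index p) norm_locus (pluecker_index p n) (orbit_map ` norm_locus)"
  unfolding isomorphic_over_def
  using regular_orbit_map regular_orbit_inverse inv_into_f_f[OF inj_orbit_map] by fastforce

end

lemma (in coefficient_ring) isomorphic_over_sym:
  "isomorphic_over F I V J W \<Longrightarrow> isomorphic_over F J W I V"
  unfolding isomorphic_over_def by blast

lemma (in coefficient_ring) isomorphic_over_trans:
  assumes "isomorphic_over F I V J W" "isomorphic_over F J W L Z"
  shows "isomorphic_over F I V L Z"
proof -
  obtain f g where f: "regular_map F I V J W f" "regular_map F J W I V g"
    "\<forall>l\<in>V. g (f l) = l" "\<forall>m\<in>W. f (g m) = m"
    using assms(1) unfolding isomorphic_over_def by (elim exE conjE)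
  obtain f' g' where f': "regular_map F J W L Z f'" "regular_map F L Z J W g'"
    "\<forall>l\<in>W. g' (f' l) = l" "\<forall>m\<in>Z. f' (g' m) = m"
    using assms(2) unfolding isomorphic_over_def by (elim exE conjE)
  have maps: "f ` V \<subseteq> W" "g' ` Z \<subseteq> W"
    by (rule f(1)[unfolded regular_map_def, THEN conjunct1],
        rule f'(2)[unfolded regular_map_def, THEN conjunct1])
  show ?thesis unfolding isomorphic_over_def
  proof (intro exI conjI ballI)
    show "regular_map F I V L Z (\<lambda>l. f' (f l))" by (rule regular_map_compose[OF f(1) f'(1)])
    show "regular_map F L Z I V (\<lambda>l. g (g' l))" by (rule regular_map_compose[OF f'(2) f(2)])
    show "g (g' (f' (f l))) = l" if "l \<in> V" for l
    proof -
      have "f l \<in> W" using maps(1) that by blast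
      then show ?thesis using f(3) f'(3) that by simp
    qed
    show "f' (f (g (g' m))) = m" if "m \<in> Z" for m
    proof -
      have "g' m \<in> W" using maps(2) that by blast
      then show ?thesis using f(4) f'(4) that by simp
    qed
  qed
qed

section \<open>The field generated by a root\<close>

definition ac_poly :: "'k::field poly \<Rightarrow> 'k alg_closure \<Rightarrow> 'k alg_closure" where
  "ac_poly f x = poly (map_poly to_ac f) x"

lemma ac_poly_0 [simp]: "ac_poly 0 x = 0"
  by (simp add: ac_poly_def)

lemma ac_poly_pCons [simp]: "ac_poly (pCons c f) x = to_ac c + x * ac_poly f x"
  by (simp add: ac_poly_def map_poly_pCons)

lemma ac_poly_add [simp]: "ac_poly (f + g) x = ac_poly f x + ac_poly g x"
  by (induction f g rule: poly_induct2) (auto simp: algebra_simps)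

lemma ac_poly_smult [simp]: "ac_poly (smult c f) x = to_ac c * ac_poly f x"
  by (induction f) (auto simp: algebra_simps)

lemma ac_poly_mult [simp]: "ac_poly (f * g) x = ac_poly f x * ac_poly g x"
  by (induction f) (auto simp: algebra_simps)

lemma ac_poly_pcompose: "ac_poly (f \<circ>\<^sub>p g) x = ac_poly f (ac_poly g x)"
  by (induction f) (auto simp: pcompose_pCons)

lemma ac_poly_1 [simp]: "ac_poly 1 x = 1"
  by (simp add: one_pCons)

lemma ac_poly_minus [simp]: "ac_poly (- f) x = - ac_poly f x"
  using ac_poly_smult[of "-1" f x] by simp

lemma ac_poly_diff [simp]: "ac_poly (f - g) x = ac_poly f x - ac_poly g x"
  using ac_poly_add[of f "- g" x] by simp

lemma ac_poly_sum: "ac_poly (\<Sum>i\<in>A. f i) x = (\<Sum>i\<in>A. ac_poly (f i) x)"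
  by (induction A rule: infinite_finite_induct) auto

lemma ac_poly_monom: "ac_poly (monom c n) x = to_ac c * x ^ n"
  by (induction n) (auto simp: monom_0 monom_Suc)

text \<open>An equation for \<open>x\<close> over the ground field may be divided by \<open>x\<close> until its constant term is nonzero;
  it then expresses the inverse.\<close>

lemma inverse_ac_poly:
  fixes x :: "'k::field alg_closure"
  assumes "x \<noteq> 0"
  obtains h where "inverse x = ac_poly h x"
proof -
  have "g \<noteq> 0 \<Longrightarrow> ac_poly g x = 0 \<Longrightarrow> \<exists>h. inverse x = ac_poly h x" for g
  proof (induction g)
    case (pCons c g)
    show ?case
    proof (cases "c = 0")
      case True
      then show ?thesis using pCons assms by auto
    next
      case False
      have "x * ac_poly g x = - to_ac c" using pCons.prems(2) by (simp add: add_eq_0_iff)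
      then have "inverse x = ac_poly (smult (- inverse c) g) x"
        using False assms by (simp add: field_simps)
      then show ?thesis by blast
    qed
  qed simp
  moreover obtain g where "g \<noteq> 0" "ac_poly g x = 0"
    using alg_closure_algebraic[of x] unfolding ac_poly_def by metis
  ultimately show ?thesis using that by blast
qed

text \<open>As \<open>\<alpha>\<close> is algebraic, the ring of its polynomial expressions is closed under inverses.\<close>

lemma carrier_simple_extension:
  "carrier (simple_extension \<alpha>) = range (\<lambda>f. ac_poly f \<alpha>)"
proof -
  let ?K = "ring_of_type_algebra :: 'a alg_closure ring"
  interpret K: field ?K by (rule field_from_type_algebra)
  have K: "carrier ?K = UNIV" "\<one>\<^bsub>?K\<^esub> = 1" "\<zero>\<^bsub>?K\<^esub> = 0"
    "x \<oplus>\<^bsub>?K\<^esub> y = x + y" "x \<otimes>\<^bsub>?K\<^esub> y = x * y" for x y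
    by (simp_all add: ring_of_type_algebra_def)
  have minus: "\<ominus>\<^bsub>?K\<^esub> x = - x" for x
    by (rule K.sum_zero_eq_neg[symmetric]) (simp_all add: K)
  have inv: "inv\<^bsub>?K\<^esub> x = inverse x" if "x \<noteq> 0" for x
    by (rule K.inv_unique'[symmetric]) (use that in \<open>simp_all add: K\<close>)
  have "x \<in> range (\<lambda>f. ac_poly f \<alpha>)" if "x \<in> generate_field ?K (insert \<alpha> (range to_ac))" for x
    using that
  proof induction
    case one
    show ?case by (rule range_eqI[of _ _ 1]) (simp add: K)
  next
    case (incl h)
    then consider "h = \<alpha>" | c where "h = to_ac c" by auto
    then show ?case
    proof cases
      case 1
      then show ?thesis by (intro range_eqI[of _ _ "[:0, 1:]"]) simp
    next
      case 2
      then show ?thesis by (intro range_eqI[of _ _ "[:c:]"]) simp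
    qed
  next
    case (a_inv h)
    then obtain f where "h = ac_poly f \<alpha>" by auto
    then show ?case by (intro range_eqI[of _ _ "- f"]) (simp add: minus)
  next
    case (m_inv h)
    then obtain f where f: "h = ac_poly f \<alpha>" by auto
    have nz: "h \<noteq> 0" using m_inv.hyps by (simp add: K)
    obtain g where "inverse h = ac_poly g h" by (rule inverse_ac_poly[OF nz])
    then show ?case unfolding inv[OF nz]
      by (intro range_eqI[of _ _ "g \<circ>\<^sub>p f"]) (simp add: f ac_poly_pcompose)
  next
    case (eng_add h1 h2)
    then obtain f1 f2 where "h1 = ac_poly f1 \<alpha>" "h2 = ac_poly f2 \<alpha>" by auto
    then show ?case by (intro range_eqI[of _ _ "f1 + f2"]) (simp add: K)
  next
    case (eng_mult h1 h2)
    then obtain f1 f2 where "h1 = ac_poly f1 \<alpha>" "h2 = ac_poly f2 \<alpha>" by auto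
    then show ?case by (intro range_eqI[of _ _ "f1 * f2"]) (simp add: K)
  qed
  moreover have "ac_poly f \<alpha> \<in> generate_field ?K (insert \<alpha> (range to_ac))" for f
  proof (induction f)
    case 0
    show ?case using generate_field.incl[of "to_ac 0" "insert \<alpha> (range to_ac)" ?K] by simp
  next
    case (pCons c f)
    have "to_ac c \<oplus>\<^bsub>?K\<^esub> (\<alpha> \<otimes>\<^bsub>?K\<^esub> ac_poly f \<alpha>) \<in> generate_field ?K (insert \<alpha> (range to_ac))"
      by (intro generate_field.eng_add generate_field.eng_mult generate_field.incl pCons) auto
    then show ?case by (simp add: K)
  qed
  ultimately show ?thesis unfolding simple_extension_def by auto
qed

lemma simple_extension_ops:
  "x \<otimes>\<^bsub>simple_extension \<alpha>\<^esub> y = x * y" "x \<oplus>\<^bsub>simple_extension \<alpha>\<^esub> y = x + y"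
  "\<zero>\<^bsub>simple_extension \<alpha>\<^esub> = 0"
  by (simp_all add: simple_extension_def ring_of_type_algebra_def)

lemma ring_simple_extension: "ring (simple_extension \<alpha>)"
proof -
  interpret K: field "ring_of_type_algebra :: 'a alg_closure ring" by (rule field_from_type_algebra)
  have "field (simple_extension \<alpha>)"
    unfolding simple_extension_def
    by (rule K.generate_field_is_field) (simp add: ring_of_type_algebra_def)
  then show ?thesis by (simp add: field_def domain_def cring_def)
qed

lemma finsum_simple_extension:
  assumes "finite A" "\<And>i. i \<in> A \<Longrightarrow> f i \<in> carrier (simple_extension \<alpha>)"
  shows "(\<Oplus>\<^bsub>simple_extension \<alpha>\<^esub>i\<in>A. f i) = (\<Sum>i\<in>A. f i)"
proof -
  interpret R: ring "simple_extension \<alpha>" by (rule ring_simple_extension)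
  show ?thesis using assms
  proof (induction A rule: finite_induct)
    case (insert x A)
    then have "f \<in> A \<rightarrow> carrier (simple_extension \<alpha>)" "f x \<in> carrier (simple_extension \<alpha>)" by auto
    then show ?case using insert by (simp add: R.finsum_insert simple_extension_ops)
  qed (simp add: simple_extension_ops)
qed

text \<open>Reduction modulo \<open>T\<^sup>p - a\<close>, with coefficients that serve for all roots \<open>x\<close> simultaneously.\<close>

lemma ac_poly_reduce:
  assumes "0 < p"
  shows "\<exists>c. \<forall>x. x ^ p = to_ac a \<longrightarrow> ac_poly f x = (\<Sum>j<p. to_ac (c j) * x ^ j)"
proof (induction f)
  case 0
  show ?case by (rule exI[of _ "\<lambda>_. 0"]) simp
next
  case (pCons d f)
  obtain c where c: "\<And>x. x ^ p = to_ac a \<Longrightarrow> ac_poly f x = (\<Sum>j<p. to_ac (c j) * x ^ j)"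
    using pCons.IH by blast
  obtain q where q: "p = Suc q" using assms by (cases p) auto
  let ?c = "\<lambda>j. case j of 0 \<Rightarrow> d + a * c q | Suc i \<Rightarrow> c i"
  show ?case
  proof (intro exI allI impI)
    fix x assume x: "x ^ p = to_ac a"
    have "ac_poly (pCons d f) x = to_ac d + (\<Sum>j<p. to_ac (c j) * x ^ Suc j)"
      by (simp add: c[OF x] sum_distrib_left mult_ac)
    also have "(\<Sum>j<p. to_ac (c j) * x ^ Suc j) = (\<Sum>j<q. to_ac (c j) * x ^ Suc j) + to_ac (c q) * to_ac a"
      using x unfolding q by simp
    also have "to_ac d + \<dots> = (\<Sum>j<p. to_ac (?c j) * x ^ j)"
      unfolding q sum.lessThan_Suc_shift by (simp add: algebra_simps)
    finally show "ac_poly (pCons d f) x = (\<Sum>j<p. to_ac (?c j) * x ^ j)" .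
  qed
qed

text \<open>The first \<open>p\<close> powers of \<open>\<alpha>\<close> span a space of dimension \<open>p\<close>, so they are independent.  Hence a
  polynomial that vanishes at \<open>\<alpha>\<close> vanishes at every \<open>p\<close>-th root of \<open>a\<close>, and the coordinates of a value
  at \<open>\<alpha>\<close> describe the values at all these roots: the embeddings of the field.\<close>

lemma simple_extension_basis:
  fixes \<alpha> :: "'k::field alg_closure"
  assumes p: "0 < p" and \<alpha>: "\<alpha> ^ p = to_ac a"
    and basis: "algebra_basis (simple_extension \<alpha>) to_ac p e"
  obtains f where "\<And>l. l < p \<Longrightarrow> e l = ac_poly (f l) \<alpha>"
    "\<And>g x. x ^ p = to_ac a \<Longrightarrow> ac_poly g x =
       (\<Sum>l<p. to_ac (algebra_coords (simple_extension \<alpha>) to_ac p e (ac_poly g \<alpha>) l) * ac_poly (f l) x)"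
proof -
  let ?R = "simple_extension \<alpha>" and ?co = "algebra_coords (simple_extension \<alpha>) to_ac p e"
  have ec: "e l \<in> carrier ?R" if "l < p" for l
    using basis that by (auto simp: algebra_basis_def)
  then have "\<exists>f. \<forall>l<p. e l = ac_poly (f l) \<alpha>"
    unfolding carrier_simple_extension by (intro choice) (metis imageE)
  then obtain f where f: "\<And>l. l < p \<Longrightarrow> e l = ac_poly (f l) \<alpha>" by blast
  have prod_c: "to_ac c * e l \<in> carrier ?R" if "l < p" for c l
    unfolding carrier_simple_extension f[OF that] by (rule range_eqI[of _ _ "smult c (f l)"]) simp
  have finsum: "(\<Oplus>\<^bsub>?R\<^esub>i\<in>{..<p}. to_ac (c i) \<otimes>\<^bsub>?R\<^esub> e i) = (\<Sum>i<p. to_ac (c i) * e i)" for c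
    by (subst finsum_simple_extension) (auto simp: simple_extension_ops prod_c)
  have ex1: "\<exists>!c. c \<in> coord_space {..<p} \<and> u = (\<Sum>i<p. to_ac (c i) * e i)"
    if "u \<in> carrier ?R" for u
    using basis that unfolding algebra_basis_def finsum by blast
  have co: "?co u \<in> coord_space {..<p}" "u = (\<Sum>i<p. to_ac (?co u i) * e i)" if "u \<in> carrier ?R" for u
    using theI'[OF ex1[OF that]] unfolding algebra_coords_def finsum by auto
  have pw: "ac_poly g \<alpha> \<in> carrier ?R" for g by (auto simp: carrier_simple_extension)
  have indep_e: "\<forall>l<p. c l = 0" if zero: "(\<Sum>i<p. to_ac (c i) * e i) = 0" for c
  proof -
    let ?c = "\<lambda>l. if l < p then c l else 0"
    obtain c0 where c0: "\<forall>c. c \<in> coord_space {..<p} \<and> 0 = (\<Sum>i<p. to_ac (c i) * e i) \<longrightarrow> c = c0"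
      using ex1[OF pw[of 0]] unfolding ac_poly_0 by (elim ex1E) (rule that)
    have "?c = c0" by (rule c0[rule_format]) (use zero in \<open>auto simp: coord_space_def\<close>)
    also have "c0 = (\<lambda>_. 0)" by (rule c0[rule_format, symmetric]) (auto simp: coord_space_def)
    finally have eq: "?c = (\<lambda>_. 0)" .
    show ?thesis
    proof (intro allI impI)
      fix l assume "l < p"
      then show "c l = 0" using fun_cong[OF eq, of l] by simp
    qed
  qed
  \<comment> \<open>\<open>C\<close> and \<open>D\<close> change between the given basis and the powers of \<open>\<alpha>\<close>; inverting this square matrix
    turns the independence of one family into that of the other.\<close>
  define C where "C j = ?co (\<alpha> ^ j)" for j
  have C: "\<alpha> ^ j = (\<Sum>l<p. to_ac (C j l) * e l)" for j
    unfolding C_def using co(2)[OF pw[of "monom 1 j"]] by (simp add: ac_poly_monom)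
  have "\<forall>l. \<exists>d. ac_poly (f l) \<alpha> = (\<Sum>j<p. to_ac (d j) * \<alpha> ^ j)"
    using ac_poly_reduce[OF p] \<alpha> by blast
  then obtain D where D: "\<And>l. ac_poly (f l) \<alpha> = (\<Sum>j<p. to_ac (D l j) * \<alpha> ^ j)" by metis
  have DC: "(\<Sum>j<p. D l j * C j m) = (if l = m then 1 else 0)" if "l < p" "m < p" for l m
  proof -
    have "(\<Sum>m<p. to_ac ((\<Sum>j<p. D l j * C j m) - (if l = m then 1 else 0)) * e m)
      = (\<Sum>m<p. (\<Sum>j<p. to_ac (D l j) * to_ac (C j m)) * e m) - (\<Sum>m<p. (if l = m then 1 else 0) * e m)"
      unfolding sum_subtractf[symmetric]
      by (rule sum.cong) (auto simp: to_ac_sum left_diff_distrib)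
    also have "(\<Sum>m<p. (if l = m then 1 else 0) * e m) = e l"
      using that by (simp add: if_distrib[of "\<lambda>x. x * _"] cong: if_cong)
    also have "(\<Sum>m<p. (\<Sum>j<p. to_ac (D l j) * to_ac (C j m)) * e m) = (\<Sum>j<p. to_ac (D l j) * \<alpha> ^ j)"
      unfolding C sum_distrib_left sum_distrib_right by (subst sum.swap) (simp add: mult.assoc)
    also have "\<dots> = e l" using D f that by simp
    finally show ?thesis
      using indep_e[of "\<lambda>m. (\<Sum>j<p. D l j * C j m) - (if l = m then 1 else 0)"] that by simp
  qed
  have indep_pow: "c j = 0" if "(\<Sum>j<p. to_ac (c j) * \<alpha> ^ j) = 0" "j < p" for c j
  proof -
    have "(\<Sum>m<p. to_ac (\<Sum>i<p. c i * C i m) * e m) = (\<Sum>i<p. to_ac (c i) * \<alpha> ^ i)"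
      unfolding C to_ac_sum sum_distrib_left sum_distrib_right by (subst sum.swap) (simp add: mult.assoc)
    then have "\<forall>m<p. (\<Sum>i<p. c i * C i m) = 0" using that indep_e[of "\<lambda>m. \<Sum>i<p. c i * C i m"] by simp
    then have "0 = (\<Sum>m<p. (\<Sum>i<p. c i * C i m) * D m j)" by simp
    also have "\<dots> = (\<Sum>i<p. c i * (\<Sum>m<p. C i m * D m j))"
      unfolding sum_distrib_left sum_distrib_right by (subst sum.swap) (simp add: mult.assoc)
    also have "\<dots> = (\<Sum>i<p. c i * (if i = j then 1 else 0))"
      by (rule sum.cong) (use left_inverse_imp_right_inverse[of p D C] DC that(2) in auto)
    also have "\<dots> = c j" using that(2) by (simp add: if_distrib[of "\<lambda>x. _ * x"] cong: if_cong)
    finally show ?thesis by simp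
  qed
  have vanish: "ac_poly g x = 0" if "ac_poly g \<alpha> = 0" "x ^ p = to_ac a" for g x
  proof -
    obtain c where c: "\<And>x. x ^ p = to_ac a \<Longrightarrow> ac_poly g x = (\<Sum>j<p. to_ac (c j) * x ^ j)"
      using ac_poly_reduce[OF p] by blast
    have "c j = 0" if "j < p" for j
      by (rule indep_pow[OF _ that]) (use c[OF \<alpha>] \<open>ac_poly g \<alpha> = 0\<close> in simp)
    then show ?thesis using c[OF that(2)] by simp
  qed
  show ?thesis
  proof (rule that[OF f])
    fix g and x :: "'k alg_closure" assume x: "x ^ p = to_ac a"
    let ?c = "?co (ac_poly g \<alpha>)"
    let ?g = "g - (\<Sum>l<p. smult (?c l) (f l))"
    have "ac_poly ?g \<alpha> = ac_poly g \<alpha> - (\<Sum>l<p. to_ac (?c l) * e l)"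
      by (simp add: ac_poly_sum f)
    then have "ac_poly ?g \<alpha> = 0" using co(2)[OF pw[of g]] by simp
    from vanish[OF this x] show "ac_poly g x = (\<Sum>l<p. to_ac (?c l) * ac_poly (f l) x)"
      by (simp add: ac_poly_sum)
  qed
qed

subsection \<open>Discrete Fourier inversion\<close>

lemma sum_powers_of_root_of_unity:
  fixes x :: "'c::field"
  assumes "x ^ p = 1" "x \<noteq> 1" shows "(\<Sum>j<p. x ^ j) = 0"
  using assms by (simp add: geometric_sum)

lemma fourier_inversion:
  fixes \<alpha> \<zeta> :: "'c::field_char_0"
  assumes \<zeta>: "primitive_root_of_unity p \<zeta>" and nz: "\<alpha> \<noteq> 0" and m: "m < p" "m' < p"
  shows "(\<Sum>j<p. inverse (of_nat p) * inverse ((\<alpha> * \<zeta> ^ m) ^ j) * (\<alpha> * \<zeta> ^ m') ^ j)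
    = (if m = m' then 1 else 0)"
proof -
  have \<zeta>nz: "\<zeta> \<noteq> 0" using \<zeta> unfolding primitive_root_of_unity_def by (metis power_0_left less_numeral_extra(3) zero_neq_one)
  let ?x = "\<zeta> ^ m' / \<zeta> ^ m"
  have summand: "inverse (of_nat p) * inverse ((\<alpha> * \<zeta> ^ m) ^ j) * (\<alpha> * \<zeta> ^ m') ^ j
    = inverse (of_nat p) * ?x ^ j" for j
    using nz \<zeta>nz by (simp add: power_mult_distrib power_divide field_simps)
  have "(\<Sum>j<p. ?x ^ j) = (if m = m' then of_nat p else 0)"
  proof (cases "m = m'")
    case True
    then show ?thesis using \<zeta>nz by simp
  next
    case False
    have "(\<zeta> ^ k) ^ p = 1" for k
    proof -
      have "(\<zeta> ^ k) ^ p = (\<zeta> ^ p) ^ k" by (simp flip: power_mult add: mult.commute)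
      then show ?thesis using \<zeta> by (simp add: primitive_root_of_unity_def)
    qed
    then have "?x ^ p = 1" by (simp add: power_divide)
    moreover have "?x \<noteq> 1"
    proof
      assume "?x = 1"
      then have eq: "\<zeta> ^ m' = \<zeta> ^ m" using \<zeta>nz by simp
      have "False" if lt: "i < k" "k < p" and "\<zeta> ^ i = \<zeta> ^ k" for i k
      proof -
        have "\<zeta> ^ k = \<zeta> ^ i * \<zeta> ^ (k - i)" using lt by (simp flip: power_add)
        then have "\<zeta> ^ (k - i) = 1" using that(3) \<zeta>nz by simp
        moreover have "0 < k - i" "k - i < p" using lt by auto
        ultimately show False using \<zeta> unfolding primitive_root_of_unity_def by blast
      qed
      from this[of m m'] this[of m' m] False m eq show False by (metis linorder_neqE_nat)
    qed
    ultimately have "(\<Sum>j<p. ?x ^ j) = 0" by (rule sum_powers_of_root_of_unity)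
    then show ?thesis using False by (simp only: if_False)
  qed
  then show ?thesis unfolding summand sum_distrib_left[symmetric] using m by simp
qed

section \<open>The splitting representation of the cyclic algebra\<close>

lemma ring_ring_of_type_algebra: "ring (ring_of_type_algebra :: 'a::ring_1 ring)"
proof -
  have "\<exists>y. x + y = 0" for x :: 'a by (rule exI[of _ "- x"]) simp
  then show ?thesis
    unfolding ring_of_type_algebra_def using add.right_inverse
    by unfold_locales (auto simp: algebra_simps Units_def)
qed

lemma ring_of_type_algebra_ops:
  "carrier ring_of_type_algebra = UNIV" "x \<otimes>\<^bsub>ring_of_type_algebra\<^esub> y = x * y"
  "x \<oplus>\<^bsub>ring_of_type_algebra\<^esub> y = x + y" "\<zero>\<^bsub>ring_of_type_algebra\<^esub> = 0"
  by (simp_all add: ring_of_type_algebra_def)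

lemma finsum_ring_of_type_algebra:
  fixes f :: "'i \<Rightarrow> 'a::ring_1"
  assumes "finite A"
  shows "(\<Oplus>\<^bsub>ring_of_type_algebra\<^esub>i\<in>A. f i) = (\<Sum>i\<in>A. f i)"
proof -
  interpret R: ring "ring_of_type_algebra :: 'a ring" by (rule ring_ring_of_type_algebra)
  show ?thesis using assms
  proof (induction A rule: finite_induct)
    case (insert x A)
    then show ?case by (subst R.finsum_insert) (auto simp: ring_of_type_algebra_ops)
  qed (simp add: ring_of_type_algebra_ops)
qed

lemma poly_mapping_as_sum:
  "g = (\<Sum>w\<in>Poly_Mapping.keys g. Poly_Mapping.single w (Poly_Mapping.lookup g w))"
proof (rule poly_mapping_eqI)
  fix k
  have "Poly_Mapping.lookup (\<Sum>w\<in>Poly_Mapping.keys g. Poly_Mapping.single w (Poly_Mapping.lookup g w)) k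
    = (\<Sum>w\<in>Poly_Mapping.keys g. if w = k then Poly_Mapping.lookup g k else 0)"
    unfolding lookup_sum by (rule sum.cong) (auto simp: lookup_single when_def)
  also have "\<dots> = Poly_Mapping.lookup g k" by (auto simp: in_keys_iff)
  finally show "Poly_Mapping.lookup g k = Poly_Mapping.lookup
    (\<Sum>w\<in>Poly_Mapping.keys g. Poly_Mapping.single w (Poly_Mapping.lookup g w)) k" by simp
qed

text \<open>The free algebra acts by \<open>p \<times> p\<close> matrices: \<open>x\<close> as the diagonal matrix of the \<open>p\<close>-th roots
  \<open>\<alpha> \<zeta>\<^sup>m\<close> of \<open>a\<close>, and \<open>y\<close> as \<open>\<beta>\<close> times the cyclic shift.  Taking \<open>\<beta>\<close> out of the shift treats all
  positions alike, at the price of a factor that is not in the ground field.\<close>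

locale cyclic_rep =
  fixes p :: nat and a b \<zeta> :: "'k::field_char_0" and \<alpha> \<beta> :: "'k alg_closure"
  assumes p_pos: "0 < p" and root: "primitive_root_of_unity p \<zeta>"
    and \<alpha>: "\<alpha> ^ p = to_ac a" and \<beta>: "\<beta> ^ p = to_ac b" and a_nz: "a \<noteq> 0" and b_nz: "b \<noteq> 0"
begin

lemma \<alpha>_nz: "\<alpha> \<noteq> 0" and \<beta>_nz: "\<beta> \<noteq> 0"
  using \<alpha> \<beta> a_nz b_nz p_pos by (auto simp: power_0_left)

definition lam :: "nat \<Rightarrow> 'k alg_closure" where
  "lam m = \<alpha> * to_ac \<zeta> ^ m"

lemma root_ac: "primitive_root_of_unity p (to_ac \<zeta>)"
  using root by (simp add: primitive_root_of_unity_def flip: to_ac_power to_ac_1 del: to_ac_1)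

lemma lam_power: "lam m ^ p = to_ac a"
proof -
  have "(to_ac \<zeta> ^ m) ^ p = (to_ac \<zeta> ^ p) ^ m" by (simp flip: power_mult add: mult.commute)
  then show ?thesis using root_ac by (simp add: lam_def power_mult_distrib \<alpha> primitive_root_of_unity_def)
qed

lemma lam_Suc: "lam (Suc m mod p) = to_ac \<zeta> * lam m" if "m < p"
proof (cases "Suc m = p")
  case True
  then have "to_ac \<zeta> * to_ac \<zeta> ^ m = 1"
    using root_ac unfolding primitive_root_of_unity_def by (metis power_Suc)
  then show ?thesis using True by (simp add: lam_def mult_ac)
next
  case False
  with that show ?thesis by (simp add: lam_def mult_ac)
qed

lemma fourier:
  assumes "m < p" "m' < p"
  shows "(\<Sum>j<p. inverse (of_nat p) * inverse (lam m ^ j) * lam m' ^ j) = (if m = m' then 1 else 0)"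
  using fourier_inversion[OF root_ac \<alpha>_nz assms] by (simp add: lam_def)

lemma lam_inj: "inj_on lam {..<p}"
proof (rule inj_onI, rule ccontr)
  fix m m' assume m: "m \<in> {..<p}" "m' \<in> {..<p}" "lam m = lam m'" "m \<noteq> m'"
  have "(\<Sum>j<p. inverse (of_nat p) * inverse (lam m ^ j) * lam m ^ j) = (1 :: 'k alg_closure)"
    using fourier[of m m] m by simp
  moreover have "(\<Sum>j<p. inverse (of_nat p) * inverse (lam m ^ j) * lam m ^ j) = (0 :: 'k alg_closure)"
    using fourier[of m m'] m by simp
  ultimately show False by simp
qed

primrec rep :: "generator list \<Rightarrow> nat \<Rightarrow> nat \<Rightarrow> 'k alg_closure" where
  "rep [] i j = (if i = j then 1 else 0)"
| "rep (g # w) i j = (case g of GenX \<Rightarrow> lam i * rep w i j | GenY \<Rightarrow> \<beta> * rep w (Suc i mod p) j)"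

definition rho :: "(word \<Rightarrow>\<^sub>0 'k) \<Rightarrow> nat \<Rightarrow> nat \<Rightarrow> 'k alg_closure" where
  "rho g i j = (\<Sum>w\<in>Poly_Mapping.keys g. to_ac (Poly_Mapping.lookup g w) * rep (letters w) i j)"

lemma rep_append: "i < p \<Longrightarrow> rep (u @ w) i j = (\<Sum>m<p. rep u i m * rep w m j)"
proof (induction u arbitrary: i)
  case Nil
  then show ?case by (simp add: if_distrib[of "\<lambda>x. x * _"] cong: if_cong)
next
  case (Cons g u)
  then show ?case using p_pos
    by (cases g) (simp_all add: sum_distrib_left mult.assoc)
qed

lemma rho_superset:
  assumes "finite A" "Poly_Mapping.keys g \<subseteq> A"
  shows "rho g i j = (\<Sum>w\<in>A. to_ac (Poly_Mapping.lookup g w) * rep (letters w) i j)"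
  unfolding rho_def
  by (rule sum.mono_neutral_left) (use assms in \<open>auto simp: in_keys_iff\<close>)

lemma rho_add: "rho (g + h) i j = rho g i j + rho h i j"
proof -
  let ?A = "Poly_Mapping.keys g \<union> Poly_Mapping.keys h"
  have "Poly_Mapping.keys (g + h) \<subseteq> ?A" by (rule Poly_Mapping.keys_add)
  then show ?thesis
    by (subst (1 2 3) rho_superset[of ?A]) (auto simp: lookup_add distrib_right sum.distrib)
qed

lemma rho_0 [simp]: "rho 0 i j = 0"
  by (simp add: rho_def)

lemma rho_uminus: "rho (- g) i j = - rho g i j"
  using rho_add[of g "- g" i j] by (simp add: add_eq_0_iff)

lemma rho_diff: "rho (g - h) i j = rho g i j - rho h i j"
  using rho_add[of g "- h" i j] by (simp add: rho_uminus)

lemma rho_sum: "rho (\<Sum>x\<in>A. f x) i j = (\<Sum>x\<in>A. rho (f x) i j)"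
  by (induction A rule: infinite_finite_induct) (auto simp: rho_add)

lemma rho_single: "rho (Poly_Mapping.single w c) i j = to_ac c * rep (letters w) i j"
  by (subst rho_superset[of "{w}"]) auto

lemma rho_mult:
  assumes "i < p" shows "rho (g * h) i j = (\<Sum>m<p. rho g i m * rho h m j)"
proof -
  let ?s = "\<lambda>g w. Poly_Mapping.single w (Poly_Mapping.lookup g w)"
  have "rho (g * h) i j = rho ((\<Sum>u\<in>Poly_Mapping.keys g. ?s g u) * (\<Sum>w\<in>Poly_Mapping.keys h. ?s h w)) i j"
    using poly_mapping_as_sum[of g] poly_mapping_as_sum[of h] by simp
  also have "\<dots> = (\<Sum>u\<in>Poly_Mapping.keys g. \<Sum>w\<in>Poly_Mapping.keys h. \<Sum>m<p.
      (to_ac (Poly_Mapping.lookup g u) * rep (letters u) i m) *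
      (to_ac (Poly_Mapping.lookup h w) * rep (letters w) m j))"
    unfolding sum_product rho_sum
    by (intro sum.cong refl)
      (simp add: mult_single rho_single plus_word_def rep_append[OF assms] sum_distrib_left mult_ac)
  also have "\<dots> = (\<Sum>m<p. rho g i m * rho h m j)"
    unfolding rho_def sum_product
    by (subst sum.swap[of _ _ "{..<p}"], rule sum.cong[OF refl], rule sum.swap)
  finally show ?thesis .
qed

lemma rho_const: "rho (free_const c) i j = (if i = j then to_ac c else 0)"
  by (simp add: free_const_def rho_single zero_word_def)

lemma rho_const_mult: "i < p \<Longrightarrow> rho (free_const c * g) i j = to_ac c * rho g i j"
  by (simp add: rho_mult rho_const if_distrib[of "\<lambda>x. x * _"] cong: if_cong)

lemma rho_X_mult: "i < p \<Longrightarrow> rho (free_gen GenX * g) i j = lam i * rho g i j"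
  by (simp add: rho_mult free_gen_def rho_single if_distrib[of "\<lambda>x. _ * x"] if_distrib[of "\<lambda>x. x * _"] cong: if_cong)

lemma rho_Y_mult: "i < p \<Longrightarrow> rho (free_gen GenY * g) i j = \<beta> * rho g (Suc i mod p) j"
  using p_pos
  by (simp add: rho_mult free_gen_def rho_single if_distrib[of "\<lambda>x. _ * x"] if_distrib[of "\<lambda>x. x * _"] cong: if_cong)

lemma rho_1: "rho 1 i j = (if i = j then 1 else 0)"
  using rho_const[of 1 i j] by (simp add: free_const_def single_one)

lemma rho_X_power_mult: "i < p \<Longrightarrow> rho (free_gen GenX ^ r * g) i j = lam i ^ r * rho g i j"
  by (induction r) (auto simp: mult.assoc rho_X_mult)

lemma rho_Y_power_mult: "i < p \<Longrightarrow> rho (free_gen GenY ^ r * g) i j = \<beta> ^ r * rho g ((i + r) mod p) j"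
proof (induction r arbitrary: i)
  case (Suc r)
  have "Suc i mod p < p" using p_pos by simp
  from Suc.IH[OF this] show ?case
    using Suc.prems by (simp add: mult.assoc rho_Y_mult mod_add_left_eq)
qed simp

definition J :: "(word \<Rightarrow>\<^sub>0 'k) set" where "J = cyclic_ideal p a b \<zeta>"

lemma ideal_J: "ideal J ring_of_type_algebra"
  unfolding J_def cyclic_ideal_def
  by (rule ring.genideal_ideal[OF ring_ring_of_type_algebra]) (simp add: ring_of_type_algebra_ops)

text \<open>The kernel of the representation is an ideal that contains the three defining relations.\<close>

lemma rho_J:
  assumes "g \<in> J" "i < p" "j < p" shows "rho g i j = 0"
proof -
  let ?R = "ring_of_type_algebra :: (word \<Rightarrow>\<^sub>0 'k) ring"
  let ?Z = "{g. \<forall>i<p. \<forall>j<p. rho g i j = 0}"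
  interpret R: ring ?R by (rule ring_ring_of_type_algebra)
  have minus: "\<ominus>\<^bsub>?R\<^esub> x = - x" for x
    by (rule R.minus_equality) (simp_all add: ring_of_type_algebra_ops)
  have "ideal ?Z ?R"
  proof (rule idealI[OF ring_ring_of_type_algebra])
    show "subgroup ?Z (add_monoid ?R)"
      by (rule R.add.subgroupI)
        (auto simp: ring_of_type_algebra_ops rho_add minus rho_uminus intro: exI[of _ 0])
  qed (auto simp: ring_of_type_algebra_ops rho_mult)
  moreover have "{free_gen GenX ^ p - free_const a, free_gen GenY ^ p - free_const b,
      free_gen GenY * free_gen GenX - free_const \<zeta> * free_gen GenX * free_gen GenY} \<subseteq> ?Z"
  proof -
    have "rho (free_gen GenX ^ p - free_const a) i j = 0" if "i < p" "j < p" for i j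
      using rho_X_power_mult[of i p 1 j] that by (simp add: rho_diff rho_1 rho_const lam_power)
    moreover have "rho (free_gen GenY ^ p - free_const b) i j = 0" if "i < p" "j < p" for i j
      using rho_Y_power_mult[of i p 1 j] that by (simp add: rho_diff rho_1 rho_const \<beta>)
    moreover have "rho (free_gen GenY * free_gen GenX - free_const \<zeta> * free_gen GenX * free_gen GenY) i j = 0"
      if "i < p" "j < p" for i j
    proof -
      have i': "Suc i mod p < p" using p_pos by simp
      have "rho (free_gen GenY * free_gen GenX) i j = \<beta> * (lam (Suc i mod p) * rho 1 (Suc i mod p) j)"
        using rho_Y_mult[OF that(1), of "free_gen GenX" j] rho_X_mult[OF i', of 1 j] by simp
      moreover have "rho (free_const \<zeta> * free_gen GenX * free_gen GenY) i j
        = to_ac \<zeta> * (lam i * (\<beta> * rho 1 (Suc i mod p) j))"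
        unfolding mult.assoc
        using rho_Y_mult[OF that(1), of 1 j] by (simp add: rho_const_mult rho_X_mult that(1))
      ultimately show ?thesis by (simp add: rho_diff lam_Suc[OF that(1)] mult_ac)
    qed
    ultimately show ?thesis by auto
  qed
  ultimately have "cyclic_ideal p a b \<zeta> \<subseteq> ?Z"
    unfolding cyclic_ideal_def by (rule R.genideal_minimal)
  then show ?thesis using assms by (auto simp: J_def)
qed

text \<open>On each cyclic diagonal the entries are, up to the common factor \<open>\<beta>\<^sup>s\<close>, the values at the roots
  \<open>lam m\<close> of one polynomial over the ground field.  For \<open>s = 0\<close> this makes the projection to the
  diagonal a map from the algebra to \<open>L\<close> that is defined over the ground field.\<close>

lemma rho_diagonals:
  "\<exists>F. \<forall>m<p. \<forall>s<p. rho g m ((m + s) mod p) = \<beta> ^ s * ac_poly (F s) (lam m)"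
proof -
  have word: "\<exists>F. \<forall>m<p. \<forall>s<p. rep w m ((m + s) mod p) = \<beta> ^ s * ac_poly (F s) (lam m)" for w
  proof (induction w)
    case Nil
    have "m = (m + s) mod p \<longleftrightarrow> s = 0" if "m < p" "s < p" for m s
    proof -
      have "(m + s) mod p = (if m + s < p then m + s else m + s - p)"
        using that by (simp add: le_mod_geq)
      then show ?thesis using that by auto
    qed
    then show ?case by (intro exI[of _ "\<lambda>s. if s = 0 then 1 else 0"]) auto
  next
    case (Cons g w)
    then obtain F where F: "\<And>m s. m < p \<Longrightarrow> s < p \<Longrightarrow> rep w m ((m + s) mod p) = \<beta> ^ s * ac_poly (F s) (lam m)"
      by blast
    show ?case
    proof (cases g)
      case GenX
      then show ?thesis
        by (intro exI[of _ "\<lambda>s. [:0, 1:] * F s"]) (auto simp: F)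
    next
      case GenY
      obtain q where q: "p = Suc q" using p_pos by (cases p) auto
      have \<beta>q: "\<beta> * \<beta> ^ q = to_ac b" using \<beta> unfolding q by simp
      \<comment> \<open>Row \<open>m\<close> of \<open>y M\<close> comes from row \<open>m + 1\<close> of \<open>M\<close>, whose root is \<open>\<zeta>\<close> times that of row \<open>m\<close>;
        on the diagonal the factors of \<open>\<beta>\<close> add up to \<open>\<beta>\<^sup>p = b\<close>.\<close>
      let ?F = "\<lambda>s. case s of 0 \<Rightarrow> smult b (F q \<circ>\<^sub>p [:0, \<zeta>:]) | Suc r \<Rightarrow> F r \<circ>\<^sub>p [:0, \<zeta>:]"
      have lam': "ac_poly [:0, \<zeta>:] (lam m) = lam (Suc m mod p)" if "m < p" for m
        using lam_Suc[OF that] by (simp add: mult.commute)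
      show ?thesis
      proof (intro exI[of _ ?F] allI impI)
        fix m s assume ms: "m < p" "s < p"
        have m': "Suc m mod p < p" using p_pos by simp
        show "rep (g # w) m ((m + s) mod p) = \<beta> ^ s * ac_poly (?F s) (lam m)"
        proof (cases s)
          case 0
          have "(Suc m mod p + q) mod p = (m + 0) mod p"
          proof -
            have "(Suc m mod p + q) mod p = (Suc m + q) mod p" by (rule mod_add_left_eq)
            also have "Suc m + q = m + p" using q by simp
            finally show ?thesis by simp
          qed
          then have "rep w (Suc m mod p) ((m + 0) mod p) = \<beta> ^ q * ac_poly (F q) (lam (Suc m mod p))"
            using F[OF m', of q] q by simp
          then have "\<beta> * rep w (Suc m mod p) ((m + 0) mod p) = to_ac b * ac_poly (F q) (lam (Suc m mod p))"
            by (simp only: \<beta>q mult.assoc[symmetric])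
          then show ?thesis using 0 GenY lam'[OF ms(1)]
            by (simp add: ac_poly_pcompose del: ac_poly_pCons)
        next
          case (Suc r)
          have "(Suc m mod p + r) mod p = (m + s) mod p"
            unfolding Suc by (simp add: mod_add_left_eq)
          then have "rep w (Suc m mod p) ((m + s) mod p) = \<beta> ^ r * ac_poly (F r) (lam (Suc m mod p))"
            using F[OF m', of r] Suc ms by simp
          then show ?thesis using Suc GenY lam'[OF ms(1)]
            by (simp add: ac_poly_pcompose del: ac_poly_pCons)
        qed
      qed
    qed
  qed
  then obtain F where F: "\<And>w m s. m < p \<Longrightarrow> s < p \<Longrightarrow> rep w m ((m + s) mod p) = \<beta> ^ s * ac_poly (F w s) (lam m)"
    by metis
  show ?thesis
  proof (intro exI allI impI)
    fix m s assume "m < p" "s < p"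
    then show "rho g m ((m + s) mod p) = \<beta> ^ s * ac_poly
      (\<Sum>w\<in>Poly_Mapping.keys g. smult (Poly_Mapping.lookup g w) (F (letters w) s)) (lam m)"
      by (simp add: rho_def F ac_poly_sum sum_distrib_left mult_ac)
  qed
qed

text \<open>This realises the inclusion of \<open>L\<close> as the diagonal matrices.\<close>

lemma free_poly_exists: "\<exists>g. \<forall>i<p. \<forall>j. rho g i j = (if i = j then ac_poly f (lam i) else 0)"
proof (induction f)
  case 0
  show ?case by (rule exI[of _ 0]) simp
next
  case (pCons c f)
  then obtain g where g: "\<And>i j. i < p \<Longrightarrow> rho g i j = (if i = j then ac_poly f (lam i) else 0)" by blast
  show ?case
    by (rule exI[of _ "free_const c + free_gen GenX * g"]) (auto simp: rho_add rho_const rho_X_mult g)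
qed

subsection \<open>Coordinates in the cyclic algebra\<close>

lemma coset_eq_imp_rho_eq:
  assumes "J +>\<^bsub>ring_of_type_algebra\<^esub> g = J +>\<^bsub>ring_of_type_algebra\<^esub> h" "i < p" "j < p"
  shows "rho g i j = rho h i j"
proof -
  let ?R = "ring_of_type_algebra :: (word \<Rightarrow>\<^sub>0 'k) ring"
  interpret J: ideal J ?R by (rule ideal_J)
  have "0 \<in> J" using additive_subgroup.zero_closed[OF ideal.axioms(1)[OF ideal_J]] by (simp add: ring_of_type_algebra_ops)
  then have "g \<in> J +>\<^bsub>?R\<^esub> h"
    unfolding assms(1)[symmetric] unfolding a_r_coset_def' ring_of_type_algebra_ops by (rule UN_I) simp
  then obtain k where "k \<in> J" "g = k + h" by (auto simp: a_r_coset_def' ring_of_type_algebra_ops)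
  then show ?thesis using rho_J[OF _ assms(2,3)] by (simp add: rho_add)
qed

text \<open>The representation is compatible with coordinates over the ground field: a word expression and the
  combination of lifted basis vectors that represents its coset differ by an element of the kernel.\<close>

lemma cyclic_algebra_coordinates:
  assumes basis: "algebra_basis (cyclic_algebra p a b \<zeta>) (cyclic_scalar p a b \<zeta>) n e"
  obtains gl where
    "\<And>g. algebra_coords (cyclic_algebra p a b \<zeta>) (cyclic_scalar p a b \<zeta>) n e
        (J +>\<^bsub>ring_of_type_algebra\<^esub> g) \<in> coord_space {..<n}"
    "\<And>g i j. i < p \<Longrightarrow> j < p \<Longrightarrow> rho g i j = (\<Sum>l<n. to_ac
      (algebra_coords (cyclic_algebra p a b \<zeta>) (cyclic_scalar p a b \<zeta>) n e
        (J +>\<^bsub>ring_of_type_algebra\<^esub> g) l) * rho (gl l) i j)"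
    "\<And>i j. i < n \<Longrightarrow> j < n \<Longrightarrow> e i \<otimes>\<^bsub>cyclic_algebra p a b \<zeta>\<^esub> e j
      = J +>\<^bsub>ring_of_type_algebra\<^esub> (gl i * gl j)"
proof -
  let ?R = "ring_of_type_algebra :: (word \<Rightarrow>\<^sub>0 'k) ring"
  let ?A = "cyclic_algebra p a b \<zeta>" and ?h = "cyclic_scalar p a b \<zeta>"
  let ?co = "algebra_coords ?A ?h n e"
  have A: "?A = ?R Quot J" by (simp add: cyclic_algebra_def J_def)
  interpret J: ideal J ?R by (rule ideal_J)
  interpret H: ring_hom_ring ?R ?A "(+>\<^bsub>?R\<^esub>) J"
    unfolding A by (rule J.rcos_ring_hom_ring)
  have carrier: "carrier ?A = range ((+>\<^bsub>?R\<^esub>) J)"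
    unfolding A FactRing_def partial_object.simps A_RCOSETS_def' ring_of_type_algebra_ops
    by (rule UNION_singleton_eq_range)
  have "\<exists>gl. \<forall>l. l < n \<longrightarrow> e l = J +>\<^bsub>?R\<^esub> gl l"
  proof (rule choice, rule allI)
    fix l show "\<exists>g. l < n \<longrightarrow> e l = J +>\<^bsub>?R\<^esub> g"
      using conjunct1[OF basis[unfolded algebra_basis_def]] unfolding carrier by auto
  qed
  then obtain gl where gl: "\<And>l. l < n \<Longrightarrow> e l = J +>\<^bsub>?R\<^esub> gl l" by blast
  have hom: "J +>\<^bsub>?R\<^esub> (x * y) = (J +>\<^bsub>?R\<^esub> x) \<otimes>\<^bsub>?A\<^esub> (J +>\<^bsub>?R\<^esub> y)" for x y
    using H.hom_mult[of x y] by (simp add: ring_of_type_algebra_ops)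
  have fs: "(\<Oplus>\<^bsub>?A\<^esub>i\<in>{..<n}. ?h (c i) \<otimes>\<^bsub>?A\<^esub> e i) = J +>\<^bsub>?R\<^esub> (\<Sum>i<n. free_const (c i) * gl i)" for c
  proof -
    let ?f = "\<lambda>i. free_const (c i) * gl i"
    have "J +>\<^bsub>?R\<^esub> (\<Sum>i<n. ?f i) = J +>\<^bsub>?R\<^esub> (\<Oplus>\<^bsub>?R\<^esub>i\<in>{..<n}. ?f i)"
      by (simp only: finsum_ring_of_type_algebra[OF finite_lessThan])
    also have "\<dots> = (\<Oplus>\<^bsub>?A\<^esub>i\<in>{..<n}. ((+>\<^bsub>?R\<^esub>) J \<circ> ?f) i)"
      by (subst H.hom_finsum) (auto simp: ring_of_type_algebra_ops)
    also have "\<dots> = (\<Oplus>\<^bsub>?A\<^esub>i\<in>{..<n}. ?h (c i) \<otimes>\<^bsub>?A\<^esub> e i)"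
      by (rule H.S.finsum_cong')
        (auto simp: hom gl cyclic_scalar_def J_def[symmetric] carrier simp flip: hom)
    finally show ?thesis by simp
  qed
  have co: "?co (J +>\<^bsub>?R\<^esub> g) \<in> coord_space {..<n}"
    "J +>\<^bsub>?R\<^esub> g = J +>\<^bsub>?R\<^esub> (\<Sum>i<n. free_const (?co (J +>\<^bsub>?R\<^esub> g) i) * gl i)" for g
  proof -
    have "\<exists>!c. c \<in> coord_space {..<n} \<and> J +>\<^bsub>?R\<^esub> g = (\<Oplus>\<^bsub>?A\<^esub>i\<in>{..<n}. ?h (c i) \<otimes>\<^bsub>?A\<^esub> e i)"
      by (rule bspec[OF conjunct2[OF basis[unfolded algebra_basis_def]]]) (simp add: carrier)
    from theI'[OF this] show "?co (J +>\<^bsub>?R\<^esub> g) \<in> coord_space {..<n}"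
      "J +>\<^bsub>?R\<^esub> g = J +>\<^bsub>?R\<^esub> (\<Sum>i<n. free_const (?co (J +>\<^bsub>?R\<^esub> g) i) * gl i)"
      unfolding algebra_coords_def[symmetric] fs[symmetric] by auto
  qed
  show ?thesis
  proof (rule that[OF co(1)])
    show "rho g i j = (\<Sum>l<n. to_ac (?co (J +>\<^bsub>?R\<^esub> g) l) * rho (gl l) i j)" if "i < p" "j < p" for g i j
      using coset_eq_imp_rho_eq[OF co(2)[of g] that] that by (simp add: rho_sum rho_const_mult)
    show "e i \<otimes>\<^bsub>?A\<^esub> e j = J +>\<^bsub>?R\<^esub> (gl i * gl j)" if "i < n" "j < n" for i j
      by (simp add: hom gl that)
  qed
qed

end

section \<open>The two varieties in common coordinates\<close>

lemma coefficient_ring_to_ac: "coefficient_ring (range (to_ac :: 'k::field \<Rightarrow> 'k alg_closure))"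
proof
  show "0 \<in> range (to_ac :: 'k \<Rightarrow> 'k alg_closure)" by (rule range_eqI[of _ _ 0]) simp
  show "1 \<in> range (to_ac :: 'k \<Rightarrow> 'k alg_closure)" by (rule range_eqI[of _ _ 1]) simp
qed (auto simp flip: to_ac_add to_ac_mult to_ac_minus)

lemma coord_space_zeroI:
  fixes u :: "nat \<Rightarrow> 'c::field"
  assumes inv: "\<And>l l'. l < n \<Longrightarrow> l' < n \<Longrightarrow> (\<Sum>q<n. M l q * N q l') = (if l = l' then 1 else 0)"
    and u: "u \<in> coord_space {..<n}" and zero: "\<And>q. q < n \<Longrightarrow> (\<Sum>l<n. u l * M l q) = 0"
  shows "u = (\<lambda>_. 0)"
proof
  fix l'
  show "u l' = 0"
  proof (cases "l' < n")
    case True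
    have "u l' = (\<Sum>l<n. u l * (if l = l' then 1 else 0))"
      using True by (simp add: if_distrib[of "\<lambda>x. _ * x"] cong: if_cong)
    also have "\<dots> = (\<Sum>l<n. u l * (\<Sum>q<n. M l q * N q l'))"
      by (rule sum.cong) (use inv True in auto)
    also have "\<dots> = (\<Sum>q<n. (\<Sum>l<n. u l * M l q) * N q l')"
      unfolding sum_distrib_left sum_distrib_right by (subst sum.swap) (simp add: mult.assoc)
    also have "\<dots> = 0" by (rule sum.neutral) (use zero in auto)
    finally show ?thesis .
  qed (use u in \<open>auto simp: coord_space_def\<close>)
qed

text \<open>The matrix \<open>sg\<close> of the embeddings diagonalises multiplication by \<open>z\<close>, with eigenvalues the
  conjugates of \<open>z\<close>.\<close>

lemma ext_norm_eq_prod: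
  fixes sg :: "nat \<Rightarrow> nat \<Rightarrow> 'k::field alg_closure"
  assumes mult: "\<And>i j m. i < n \<Longrightarrow> j < n \<Longrightarrow> m < n \<Longrightarrow>
      (\<Sum>l<n. to_ac (algebra_coords R h n e (e i \<otimes>\<^bsub>R\<^esub> e j) l) * sg l m) = sg i m * sg j m"
    and inv: "\<And>m m'. m < n \<Longrightarrow> m' < n \<Longrightarrow> (\<Sum>l<n. B m l * sg l m') = (if m = m' then 1 else 0)"
  shows "ext_norm R h n e z = (\<Prod>m<n. \<Sum>l<n. z l * sg l m)"
proof -
  let ?N = "\<lambda>l j. ext_mult R h n e z (\<lambda>i. if i = j then 1 else 0) l"
  let ?M = "mat n n (\<lambda>(l, j). ?N l j)"
  let ?S = "mat n n (\<lambda>(m, l). sg l m)"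
  let ?s = "\<lambda>m. \<Sum>l<n. z l * sg l m"
  have N: "?N l j = (\<Sum>i<n. z i * to_ac (algebra_coords R h n e (e i \<otimes>\<^bsub>R\<^esub> e j) l))" if "j < n" for l j
    unfolding ext_mult_def
    by (rule sum.cong[OF refl]) (use that in \<open>simp add: if_distrib[of "\<lambda>x. _ * x * _"] if_distrib[of "\<lambda>x. _ * x"]
        if_distrib[of "\<lambda>x. x * _"] cong: if_cong\<close>)
  have prod: "?S * ?M = mat n n (\<lambda>(m, j). ?s m * sg j m)"
  proof (rule eq_matI)
    fix m j assume "m < dim_row (mat n n (\<lambda>(m, j). ?s m * sg j m))"
      "j < dim_col (mat n n (\<lambda>(m, j). ?s m * sg j m))"
    then have mj: "m < n" "j < n" by auto
    have "(?S * ?M) $$ (m, j) = (\<Sum>l<n. sg l m * ?N l j)"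
      using mj by (simp add: scalar_prod_def atLeast0LessThan)
    also have "\<dots> = (\<Sum>l<n. \<Sum>i<n. z i * (to_ac (algebra_coords R h n e (e i \<otimes>\<^bsub>R\<^esub> e j) l) * sg l m))"
      using mj by (intro sum.cong refl) (simp add: N sum_distrib_left mult_ac)
    also have "\<dots> = (\<Sum>i<n. z i * (\<Sum>l<n. to_ac (algebra_coords R h n e (e i \<otimes>\<^bsub>R\<^esub> e j) l) * sg l m))"
      by (subst sum.swap) (simp add: sum_distrib_left)
    also have "\<dots> = (\<Sum>i<n. z i * (sg i m * sg j m))"
      by (intro sum.cong refl arg_cong2[of _ _ _ _ times]) (use mult mj in auto)
    also have "\<dots> = ?s m * sg j m" by (simp add: sum_distrib_right mult.assoc)
    finally show "(?S * ?M) $$ (m, j) = mat n n (\<lambda>(m, j). ?s m * sg j m) $$ (m, j)"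
      using mj by simp
  qed auto
  have "mat n n (\<lambda>(m, l). B m l) * mat n n (\<lambda>(l, m). sg l m) = 1\<^sub>m n"
    by (rule eq_matI) (auto simp: scalar_prod_def atLeast0LessThan inv)
  then have "det (mat n n (\<lambda>(m, l). B m l)) * det (mat n n (\<lambda>(l, m). sg l m)) = 1"
    by (metis det_mult det_one mat_carrier)
  moreover have "det ?S = det (mat n n (\<lambda>(l, m). sg l m))"
    by (subst det_transpose[symmetric, of _ n], simp, rule arg_cong[of _ _ det], rule eq_matI) auto
  ultimately have nz: "det ?S \<noteq> 0" by auto
  have "det ?S * det ?M = det (mat n n (\<lambda>(m, j). ?s m * sg j m))"
    unfolding prod[symmetric] by (rule det_mult[symmetric, of _ n]) auto
  also have "mat n n (\<lambda>(m, j). ?s m * sg j m) = mat n n (\<lambda>(m, j). if m = j then ?s m else 0) * ?S"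
    by (rule eq_matI)
      (auto simp: scalar_prod_def if_distrib[of "\<lambda>x. x * _"] cong: if_cong)
  also have "det \<dots> = det (mat n n (\<lambda>(m, j). if m = j then ?s m else 0)) * det ?S"
    by (rule det_mult[of _ n]) auto
  also have "det (mat n n (\<lambda>(m, j). if m = j then ?s m else 0)) = (\<Prod>m<n. ?s m)"
    by (subst det_lower_triangular[of n]) (auto simp: prod_list_diag_prod atLeast0LessThan)
  finally have "det ?M = (\<Prod>m<n. ?s m)" using nz by simp
  then show ?thesis by (simp add: ext_norm_def)
qed

context cyclic_rep begin

text \<open>A Fourier sum over the powers of \<open>x\<close> isolates one row, and a power of \<open>y\<close> has a single nonzero
  entry in it.  So the image of the algebra spans all matrices.\<close>

lemma matrix_units_exist:
  assumes co: "\<And>g i j. i < p \<Longrightarrow> j < p \<Longrightarrow> rho g i j = (\<Sum>l<n. to_ac (co g l) * E l i j)"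
  obtains U where "\<And>i0 k0 i k. i0 < p \<Longrightarrow> k0 < p \<Longrightarrow> i < p \<Longrightarrow> k < p \<Longrightarrow>
    (\<Sum>l<n. U i0 k0 l * E l i k) = (if i = i0 \<and> k = k0 then 1 else 0)"
proof -
  let ?s = "\<lambda>i0 k0. (k0 + p - i0) mod p"
  let ?g = "\<lambda>r s. free_gen GenX ^ r * free_gen GenY ^ s"
  let ?c = "\<lambda>i0 s r. inverse (of_nat p) * inverse (lam i0 ^ r) * inverse (\<beta> ^ s)"
  have rho_g: "rho (?g r s) i k = lam i ^ r * (\<beta> ^ s * (if (i + s) mod p = k then 1 else 0))"
    if "i < p" for r s i k
    using rho_Y_power_mult[OF that, of s 1 k] by (simp add: rho_X_power_mult that rho_1)
  show ?thesis
  proof (rule that[of "\<lambda>i0 k0 l. \<Sum>r<p. ?c i0 (?s i0 k0) r * to_ac (co (?g r (?s i0 k0)) l)"])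
    fix i0 k0 i k assume lt: "i0 < p" "k0 < p" "i < p" "k < p"
    let ?t = "?s i0 k0"
    have "(\<Sum>l<n. (\<Sum>r<p. ?c i0 ?t r * to_ac (co (?g r ?t) l)) * E l i k)
      = (\<Sum>r<p. ?c i0 ?t r * rho (?g r ?t) i k)"
      unfolding co[OF lt(3,4)] sum_distrib_left sum_distrib_right
      by (subst sum.swap) (simp add: mult.assoc)
    also have "\<dots> = (\<Sum>r<p. (inverse (of_nat p) * inverse (lam i0 ^ r) * lam i ^ r) *
      (if (i + ?t) mod p = k then 1 else 0))"
      unfolding rho_g[OF lt(3)] by (rule sum.cong[OF refl]) (use \<beta>_nz in simp)
    also have "\<dots> = (if i0 = i then 1 else 0) * (if (i + ?t) mod p = k then 1 else 0)"
      unfolding sum_distrib_right[symmetric] fourier[OF lt(1,3)] by (rule refl)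
    also have "\<dots> = (if i = i0 \<and> k = k0 then 1 else 0)"
    proof -
      have "(i0 + ?t) mod p = (i0 + (k0 + p - i0)) mod p" by (rule mod_add_right_eq)
      also have "i0 + (k0 + p - i0) = k0 + p" using lt by simp
      finally have "(i0 + ?t) mod p = k0" using lt by simp
      then show ?thesis by auto
    qed
    finally show "(\<Sum>l<n. (\<Sum>r<p. ?c i0 ?t r * to_ac (co (?g r ?t) l)) * E l i k)
      = (if i = i0 \<and> k = k0 then 1 else 0)" .
  qed
qed

text \<open>The algebra has a basis of length \<open>p\<^sup>2\<close> whose image spans the \<open>p \<times> p\<close> matrices, so the
  representation becomes an isomorphism over the closure.  In the field, Fourier inversion plays the
  same part for the embeddings.\<close>

lemma cyclic_data_exists:
  fixes eA :: "nat \<Rightarrow> (word \<Rightarrow>\<^sub>0 'k) set"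
  assumes basisL: "algebra_basis (simple_extension \<alpha>) to_ac p eL"
    and basisA: "algebra_basis (cyclic_algebra p a b \<zeta>) (cyclic_scalar p a b \<zeta>) (p\<^sup>2) eA"
  obtains E sg dg dy unit tw xv where
    "cyclic_data (range to_ac) p (p\<^sup>2) \<beta> E sg
      (ext_mult (cyclic_algebra p a b \<zeta>) (cyclic_scalar p a b \<zeta>) (p\<^sup>2) eA) dg dy unit tw xv lam"
    "\<And>z. ext_norm (simple_extension \<alpha>) to_ac p eL z = (\<Prod>m<p. \<Sum>l<p. z l * sg l m)"
proof -
  let ?A = "cyclic_algebra p a b \<zeta>" and ?h = "cyclic_scalar p a b \<zeta>"
  let ?n = "p\<^sup>2"
  obtain f where f: "\<And>l. l < p \<Longrightarrow> eL l = ac_poly (f l) \<alpha>"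
    and fx: "\<And>g x. x ^ p = to_ac a \<Longrightarrow> ac_poly g x =
      (\<Sum>l<p. to_ac (algebra_coords (simple_extension \<alpha>) to_ac p eL (ac_poly g \<alpha>) l) * ac_poly (f l) x)"
    by (rule simple_extension_basis[OF p_pos \<alpha> basisL]) blast
  define coL where "coL g = algebra_coords (simple_extension \<alpha>) to_ac p eL (ac_poly g \<alpha>)" for g
  define sg where "sg l m = ac_poly (f l) (lam m)" for l m
  have coL: "ac_poly g (lam m) = (\<Sum>l<p. to_ac (coL g l) * sg l m)" for g m
    unfolding coL_def sg_def by (rule fx[OF lam_power])
  \<comment> \<open>\<open>B\<close> inverts the matrix of the embeddings.\<close>
  define B where "B m l = (\<Sum>j<p. inverse (of_nat p) * inverse (lam m ^ j) * to_ac (coL (monom 1 j) l))" for m l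
  have B: "(\<Sum>l<p. B m l * sg l m') = (if m = m' then 1 else 0)" if "m < p" "m' < p" for m m'
  proof -
    have "(\<Sum>l<p. B m l * sg l m') = (\<Sum>j<p. inverse (of_nat p) * inverse (lam m ^ j) * ac_poly (monom 1 j) (lam m'))"
      unfolding B_def coL sum_distrib_left sum_distrib_right by (subst sum.swap) (simp add: mult.assoc)
    then show ?thesis using fourier[OF that] by (simp add: ac_poly_monom)
  qed
  have B': "(\<Sum>m<p. sg l m * B m l') = (if l = l' then 1 else 0)" if "l < p" "l' < p" for l l'
    by (rule left_inverse_imp_right_inverse[where A = B]) (use B that in auto)
  obtain gl where
    co_mem: "\<And>g. algebra_coords ?A ?h ?n eA (J +>\<^bsub>ring_of_type_algebra\<^esub> g) \<in> coord_space {..<?n}"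
    and co: "\<And>g i j. i < p \<Longrightarrow> j < p \<Longrightarrow> rho g i j = (\<Sum>l<?n. to_ac
      (algebra_coords ?A ?h ?n eA (J +>\<^bsub>ring_of_type_algebra\<^esub> g) l) * rho (gl l) i j)"
    and gl: "\<And>i j. i < ?n \<Longrightarrow> j < ?n \<Longrightarrow> eA i \<otimes>\<^bsub>?A\<^esub> eA j = J +>\<^bsub>ring_of_type_algebra\<^esub> (gl i * gl j)"
    by (rule cyclic_algebra_coordinates[OF basisA]) blast
  define coA where "coA g = algebra_coords ?A ?h ?n eA (J +>\<^bsub>ring_of_type_algebra\<^esub> g)" for g
  define E where "E l = rho (gl l)" for l
  have coA: "rho g i j = (\<Sum>l<?n. to_ac (coA g l) * E l i j)" if "i < p" "j < p" for g i j
    unfolding coA_def E_def by (rule co[OF that])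
  have coA_mem: "coA g \<in> coord_space {..<?n}" for g unfolding coA_def by (rule co_mem)
  obtain U where U: "\<And>i0 k0 i k. i0 < p \<Longrightarrow> k0 < p \<Longrightarrow> i < p \<Longrightarrow> k < p \<Longrightarrow>
    (\<Sum>l<?n. U i0 k0 l * E l i k) = (if i = i0 \<and> k = k0 then 1 else 0)"
    by (rule matrix_units_exist[OF coA]) blast+
  have divmod: "q div p < p" "q mod p < p" if "q < ?n" for q
    using that p_pos by (auto simp: power2_eq_square less_mult_imp_div_less)
  \<comment> \<open>Matrix positions are numbered by \<open>q = i p + k\<close>, which makes the coordinate change a square matrix.\<close>
  let ?U = "\<lambda>q l. U (q div p) (q mod p) l" and ?E = "\<lambda>l q. E l (q div p) (q mod p)"
  have "(\<Sum>l<?n. ?U q l * ?E l q') = (if q = q' then 1 else 0)" if "q < ?n" "q' < ?n" for q q'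
  proof -
    have "q div p = q' div p \<and> q mod p = q' mod p \<longleftrightarrow> q = q'" by (metis div_mult_mod_eq)
    then show ?thesis using U[OF divmod[OF that(1)] divmod[OF that(2)]] by (auto simp: eq_commute)
  qed
  then have EU: "(\<Sum>q<?n. ?E l q * ?U q l') = (if l = l' then 1 else 0)" if "l < ?n" "l' < ?n" for l l'
    by (intro left_inverse_imp_right_inverse[where A = ?U]) (use that in auto)
  have "\<exists>F. \<forall>l m. m < p \<longrightarrow> rho (free_gen GenY * gl l) m m = ac_poly (F l) (lam m)"
    "\<exists>F. \<forall>l m. m < p \<longrightarrow> rho (gl l) m m = ac_poly (F l) (lam m)"
  proof -
    have diag: "\<exists>F. \<forall>m. m < p \<longrightarrow> rho g m m = ac_poly F (lam m)" for g
    proof -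
      obtain F where "\<forall>m<p. \<forall>s<p. rho g m ((m + s) mod p) = \<beta> ^ s * ac_poly (F s) (lam m)"
        using rho_diagonals by blast
      then have "\<forall>m<p. rho g m ((m + 0) mod p) = \<beta> ^ 0 * ac_poly (F 0) (lam m)" using p_pos by blast
      then show ?thesis by (intro exI[of _ "F 0"]) simp
    qed
    show "\<exists>F. \<forall>l m. m < p \<longrightarrow> rho (free_gen GenY * gl l) m m = ac_poly (F l) (lam m)"
      "\<exists>F. \<forall>l m. m < p \<longrightarrow> rho (gl l) m m = ac_poly (F l) (lam m)"
      by (rule choice, rule allI, rule diag)+
  qed
  then obtain Fy Fd where
    Fy: "\<And>l m. m < p \<Longrightarrow> rho (free_gen GenY * gl l) m m = ac_poly (Fy l) (lam m)"
    and Fd: "\<And>l m. m < p \<Longrightarrow> rho (gl l) m m = ac_poly (Fd l) (lam m)" by blast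
  have "\<exists>FL. \<forall>l. \<forall>i<p. \<forall>j. rho (FL l) i j = (if i = j then ac_poly (f l) (lam i) else 0)"
    by (rule choice) (rule allI, rule free_poly_exists)
  then obtain FL where FL: "\<And>l i j. i < p \<Longrightarrow> rho (FL l) i j = (if i = j then sg l i else 0)"
    unfolding sg_def by blast
  define dg where "dg t l = to_ac (coL (Fd t) l)" for t l
  define dy where "dy t l = to_ac (coL (Fy t) l)" for t l
  define unit where "unit l = to_ac (coL 1 l)" for l
  define tw where "tw l j t = to_ac (coA (free_const (inverse b) * (free_gen GenY ^ (p - 1) * (FL l * gl j))) t)" for l j t
  define xv where "xv j t = to_ac (coA (free_gen GenX ^ j) t)" for j t
  let ?mulA = "ext_mult ?A ?h ?n eA"
  have mulA: "?mulA u v = (\<lambda>l. \<Sum>i<?n. \<Sum>j<?n. u i * v j * to_ac (coA (gl i * gl j) l))" for u v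
    unfolding ext_mult_def coA_def by (intro ext sum.cong refl) (simp add: gl)
  interpret F: coefficient_ring "range (to_ac :: 'k \<Rightarrow> 'k alg_closure)"
    by (rule coefficient_ring_to_ac)
  have "cyclic_data (range to_ac) p ?n \<beta> E sg ?mulA dg dy unit tw xv lam"
  proof unfold_locales
    show "0 < p" "\<beta> \<noteq> 0" "inj_on lam {..<p}" by (rule p_pos \<beta>_nz lam_inj)+
    show "dg t l \<in> range to_ac" "dy t l \<in> range to_ac" "unit l \<in> range to_ac"
      "tw l j t \<in> range to_ac" "xv j t \<in> range to_ac" for t l j
      by (simp_all add: dg_def dy_def unit_def tw_def xv_def)
    show "u = (\<lambda>_. 0)" if u: "u \<in> coord_space {..<?n}"
      and zero: "\<And>i k. i < p \<Longrightarrow> k < p \<Longrightarrow> (\<Sum>l<?n. u l * E l i k) = 0" for u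
      by (rule coord_space_zeroI[OF EU u]) (use zero divmod in auto)
    show "\<exists>u\<in>coord_space {..<?n}. \<forall>i<p. \<forall>k<p. (\<Sum>l<?n. u l * E l i k) = M i k" for M
    proof (intro bexI allI impI)
      let ?u = "\<lambda>l. if l < ?n then \<Sum>i<p. \<Sum>k<p. M i k * U i k l else 0"
      show "?u \<in> coord_space {..<?n}" by (auto simp: coord_space_def)
      fix i k assume ik: "i < p" "k < p"
      have "(\<Sum>l<?n. ?u l * E l i k) = (\<Sum>l<?n. \<Sum>i'<p. \<Sum>k'<p. M i' k' * (U i' k' l * E l i k))"
        by (intro sum.cong refl) (simp add: sum_distrib_right mult.assoc)
      also have "\<dots> = (\<Sum>i'<p. \<Sum>k'<p. M i' k' * (\<Sum>l<?n. U i' k' l * E l i k))"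
        unfolding sum_distrib_left
        by (subst sum.swap, rule sum.cong[OF refl], rule sum.swap)
      also have "\<dots> = (\<Sum>i'<p. \<Sum>k'<p. if i' = i then if k' = k then M i k else 0 else 0)"
        by (intro sum.cong refl) (use U ik in auto)
      also have "\<dots> = (\<Sum>i'<p. if i' = i then M i k else 0)"
        using ik by (intro sum.cong refl) simp
      also have "\<dots> = M i k" using ik by simp
      finally show "(\<Sum>l<?n. ?u l * E l i k) = M i k" .
    qed
    show "?mulA u v \<in> coord_space {..<?n}" for u v
      unfolding mulA using coA_mem by (auto simp: coord_space_def)
    show "(\<Sum>l<?n. ?mulA u v l * E l i k)
      = (\<Sum>m<p. (\<Sum>l<?n. u l * E l i m) * (\<Sum>l<?n. v l * E l m k))" if "i < p" "k < p" for u v i k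
    proof -
      have "(\<Sum>l<?n. ?mulA u v l * E l i k)
        = (\<Sum>l<?n. \<Sum>i'<?n. \<Sum>j'<?n. u i' * v j' * (to_ac (coA (gl i' * gl j') l) * E l i k))"
        unfolding mulA by (intro sum.cong refl) (simp add: sum_distrib_right mult.assoc)
      also have "\<dots> = (\<Sum>i'<?n. \<Sum>j'<?n. u i' * v j' * (\<Sum>l<?n. to_ac (coA (gl i' * gl j') l) * E l i k))"
        unfolding sum_distrib_left
        by (subst sum.swap, rule sum.cong[OF refl], rule sum.swap)
      also have "\<dots> = (\<Sum>i'<?n. \<Sum>j'<?n. u i' * v j' * (\<Sum>m<p. E i' i m * E j' m k))"
        unfolding coA[OF that, symmetric] unfolding rho_mult[OF that(1)] E_def ..
      also have "\<dots> = (\<Sum>i'<?n. \<Sum>j'<?n. \<Sum>m<p. (u i' * E i' i m) * (v j' * E j' m k))"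
        unfolding sum_distrib_left by (intro sum.cong refl) (simp add: mult_ac)
      also have "\<dots> = (\<Sum>m<p. (\<Sum>l<?n. u l * E l i m) * (\<Sum>l<?n. v l * E l m k))"
        unfolding sum_product
        by (subst sum.swap[of _ _ "{..<p}"], rule sum.cong[OF refl], rule sum.swap)
      finally show ?thesis .
    qed
    show "z = (\<lambda>_. 0)" if z: "z \<in> coord_space {..<p}"
      and zero: "\<And>m. m < p \<Longrightarrow> (\<Sum>l<p. z l * sg l m) = 0" for z
      by (rule coord_space_zeroI[OF B' z zero])
    show "\<exists>z\<in>coord_space {..<p}. \<forall>m<p. (\<Sum>l<p. z l * sg l m) = t m" for t
    proof (intro bexI allI impI)
      let ?z = "\<lambda>l. if l < p then \<Sum>m<p. t m * B m l else 0"
      show "?z \<in> coord_space {..<p}" by (auto simp: coord_space_def)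
      fix m assume m: "m < p"
      have "(\<Sum>l<p. ?z l * sg l m) = (\<Sum>l<p. (\<Sum>m'<p. t m' * B m' l) * sg l m)"
        by (rule sum.cong) auto
      also have "\<dots> = (\<Sum>m'<p. t m' * (\<Sum>l<p. B m' l * sg l m))"
        unfolding sum_distrib_left sum_distrib_right by (subst sum.swap) (simp add: mult.assoc)
      also have "\<dots> = (\<Sum>m'<p. if m' = m then t m else 0)"
        by (rule sum.cong) (use B m in auto)
      also have "\<dots> = t m" using m by simp
      finally show "(\<Sum>l<p. ?z l * sg l m) = t m" .
    qed
    show "(\<Sum>l<p. dg t l * sg l m) = E t m m" if "m < p" for t m
      unfolding dg_def coL[symmetric] E_def Fd[OF that] ..
    show "(\<Sum>l<p. dy t l * sg l m) = \<beta> * E t (Suc m mod p) m" if "m < p" for t m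
      unfolding dy_def coL[symmetric] E_def Fy[OF that, symmetric] by (rule rho_Y_mult[OF that])
    show "(\<Sum>l<p. unit l * sg l m) = 1" for m
      unfolding unit_def coL[symmetric] by simp
    show "(\<Sum>t<?n. xv j t * E t m k) = (if m = k then lam k ^ j else 0)" if "m < p" "k < p" for j m k
      unfolding xv_def coA[OF that, symmetric]
      using rho_X_power_mult[OF that(1), of j 1 k] by (simp add: rho_1)
    show "(\<Sum>t<?n. tw l j t * E t (Suc m mod p) k) = sg l m * E j m k / \<beta>" if "m < p" "k < p" for l j m k
    proof -
      have m': "Suc m mod p < p" using p_pos by simp
      have idx: "(Suc m mod p + (p - 1)) mod p = m"
      proof -
        have "(Suc m mod p + (p - 1)) mod p = (Suc m + (p - 1)) mod p" by (rule mod_add_left_eq)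
        also have "Suc m + (p - 1) = m + p" using p_pos by simp
        finally show ?thesis using that by simp
      qed
      have \<beta>b: "to_ac (inverse b) * \<beta> ^ (p - 1) = inverse \<beta>"
      proof -
        have "\<beta> ^ (p - 1) * \<beta> = to_ac b" using \<beta> p_pos by (metis power_minus_mult)
        then show ?thesis using b_nz \<beta>_nz by (simp add: field_simps)
      qed
      have "(\<Sum>t<?n. tw l j t * E t (Suc m mod p) k)
        = to_ac (inverse b) * (\<beta> ^ (p - 1) * rho (FL l * gl j) m k)"
        unfolding tw_def coA[OF m' that(2), symmetric] rho_const_mult[OF m'] rho_Y_power_mult[OF m'] idx ..
      also have "rho (FL l * gl j) m k = sg l m * E j m k"
        unfolding rho_mult[OF that(1)] E_def using that(1)
        by (simp add: FL if_distrib[of "\<lambda>x. x * _"] cong: if_cong)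
      also have "to_ac (inverse b) * (\<beta> ^ (p - 1) * (sg l m * E j m k)) = inverse \<beta> * (sg l m * E j m k)"
        unfolding \<beta>b[symmetric] by (simp only: mult.assoc)
      also have "\<dots> = sg l m * E j m k / \<beta>" by (simp only: divide_inverse mult.commute)
      finally show ?thesis .
    qed
  qed
  moreover have "ext_norm (simple_extension \<alpha>) to_ac p eL z = (\<Prod>m<p. \<Sum>l<p. z l * sg l m)" for z
  proof (rule ext_norm_eq_prod[OF _ B])
    show "(\<Sum>l<p. to_ac (algebra_coords (simple_extension \<alpha>) to_ac p eL
        (eL i \<otimes>\<^bsub>simple_extension \<alpha>\<^esub> eL j) l) * sg l m) = sg i m * sg j m" if "i < p" "j < p" for i j m
      using coL[of "f i * f j" m] that by (simp add: coL_def f simple_extension_ops sg_def)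
  qed
  ultimately show ?thesis by (rule that)
qed

end

theorem theorem4p1:
  fixes p n :: nat
    and a b \<zeta> :: "'k::field_char_0"
    and V :: "(nat \<Rightarrow> 'k alg_closure) set set"
    and e :: "nat \<Rightarrow> (word \<Rightarrow>\<^sub>0 'k) set"
  assumes "prime p" and "p > 2"
    and "primitive_root_of_unity p \<zeta>"
    and "a \<noteq> 0" and "b \<noteq> 0"
    and "milnor_K2_mod_symbol p a b \<noteq> \<one>\<^bsub>milnor_K2_mod p\<^esub>"
    and "standard_norm_variety p a b n V"
    and "algebra_basis (cyclic_algebra p a b \<zeta>) (cyclic_scalar p a b \<zeta>) (p\<^sup>2) e"
  shows "birational_over (range to_ac) {..n} V
           (pluecker_index p (p\<^sup>2))
           (severi_brauer (cyclic_algebra p a b \<zeta>) (cyclic_scalar p a b \<zeta>) p e)"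
proof -
  let ?F = "range (to_ac :: 'k \<Rightarrow> 'k alg_closure)"
  let ?A = "cyclic_algebra p a b \<zeta>" and ?h = "cyclic_scalar p a b \<zeta>"
  have p_pos: "0 < p" using assms(2) by simp
  obtain \<alpha> eL B where irr: "irreducible_in (zariski UNIV {..n}) V"
    and \<alpha>: "\<alpha> ^ p = to_ac a" and basisL: "algebra_basis (simple_extension \<alpha>) to_ac p eL"
    and B: "openin (subtopology (zariski ?F {..n}) V) B"
    and iso: "isomorphic_over ?F (affine_index p) (norm_hypersurface (simple_extension \<alpha>) to_ac p eL b) {..n} B"
    using assms(7) unfolding standard_norm_variety_def by (elim conjE exE) (rule that)
  obtain \<beta> :: "'k alg_closure" where \<beta>: "\<beta> ^ p = to_ac b"
    using nth_root_exists[OF p_pos] by metis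
  interpret cyclic_rep p a b \<zeta> \<alpha> \<beta>
    by unfold_locales (use p_pos assms \<alpha> \<beta> in auto)
  obtain E sg dg dy unit tw xv where
    data: "cyclic_data ?F p (p\<^sup>2) \<beta> E sg (ext_mult ?A ?h (p\<^sup>2) e) dg dy unit tw xv lam"
    and norm: "\<And>z. ext_norm (simple_extension \<alpha>) to_ac p eL z = (\<Prod>m<p. \<Sum>l<p. z l * sg l m)"
    by (rule cyclic_data_exists[OF basisL assms(8)]) blast
  interpret D: cyclic_data ?F p "p\<^sup>2" \<beta> E sg "ext_mult ?A ?h (p\<^sup>2) e" dg dy unit tw xv lam
    by (rule data)
  have norm_locus: "norm_hypersurface (simple_extension \<alpha>) to_ac p eL b = D.norm_locus"
    unfolding norm_hypersurface_def D.norm_locus_def D.sig_def norm \<beta> ..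
  have ideal_variety: "severi_brauer ?A ?h p e = D.ideal_variety"
    unfolding severi_brauer_def D.ideal_variety_def ..
  let ?O = "D.orbit_map ` D.norm_locus"
  have "isomorphic_over ?F {..n} B (affine_index p) D.norm_locus"
    using D.isomorphic_over_sym[OF iso] unfolding norm_locus .
  then have iso': "isomorphic_over ?F {..n} B (pluecker_index p (p\<^sup>2)) ?O"
    by (rule D.isomorphic_over_trans[OF _ D.orbit_isomorphic])
  have "B \<noteq> {}"
  proof -
    obtain \<phi> where "regular_map ?F (affine_index p) D.norm_locus {..n} B \<phi>"
      using iso unfolding norm_locus isomorphic_over_def by blast
    then have "\<phi> ` D.norm_locus \<subseteq> B" unfolding regular_map_def by (rule conjunct1)
    then show ?thesis using D.norm_locus_nonempty by blast
  qed
  then have "V \<subseteq> Abstract_Topology.closure_of (zariski ?F {..n}) B"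
    by (rule D.open_dense_of_irreducible[OF irr B])
  then show ?thesis
    unfolding birational_over_def ideal_variety
    using B D.orbit_open D.orbit_dense iso' by blast
qed

end
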